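(* Let $(G,\theta)$ be a reductive symmetric pair with variety of reductions $\mathfrak{R}$. Two regular $K$-orbits in $\mathfrak{R}$ compare in the same way as their corresponding regular decomposition classes: if $\mathcal{O}_0,\mathcal{O}_1$ are regular orbits in $\mathfrak{R}$ with associated decomposition classes $\mathcal{D}_0,\mathcal{D}_1$ in $\mathfrak{p}$, then $\mathcal{O}_1$ is more general than $\mathcal{O}_0$ if and only if $\mathcal{D}_1$ is more general than $\mathcal{D}_0$.
   Context: All groups and varieties are over $\mathbb{C}$. A reductive symmetric pair $(G,\theta)$ consists of a reductive complex algebraic group $G$ and an involution $\theta$ of $G$. Put $K=(G^\theta)^\circ$. The differential of $\theta$ decomposes the Lie algebra as $\mathfrak{g}=\mathfrak{k}\oplus\mathfrak{p}$ ($+1$ and $-1$ eigenspaces). A Cartan subspace of $\mathfrak{p}$ is a linear subspace of $\mathfrak{g}$ contained in $\mathfrak{p}$ and in some Cartan subalgebra of $\mathfrak{g}$, and maximal for inclusion among such subspaces. All Cartan subspaces are $K$-conjugate, of common dimension $r$, the rank of the pair. The variety of reductions $\mathfrak{R}$ is the closure in $\mathrm{Gr}(r,\mathfrak{p})$ of the set of all Cartan subspaces. For $u\in\mathfrak{p}$, $\mathfrak{c}_{\mathfrak{p}}(u)$ is its centralizer in $\mathfrak{p}$; $u$ is regular when $\dim \mathfrak{c}_{\mathfrak{p}}(u)$ is minimal, in which case $\mathfrak{c}_{\mathfrak{p}}(u)\in\mathfrak{R}$. The centralizer map is $\mathcal{C}:u\mapsto\mathfrak{c}_{\mathfrak{p}}(u)$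 from the set of regular elements to $\mathfrak{R}$. A reduction (point of $\mathfrak{R}$) is regular if it is in the image of $\mathcal{C}$, and a $K$-orbit in $\mathfrak{R}$ is regular if it passes through a regular reduction. Two elements $u=u_s+u_n$ and $v=v_s+v_n$ of $\mathfrak{p}$ (Chevalley–Jordan decompositions) have the same decomposition class when there is $g\in K$ with $g\cdot\mathfrak{c}_{\mathfrak{p}}(u_s)=\mathfrak{c}_{\mathfrak{p}}(v_s)$ and $g u_n=v_n$ (equivalently, $\mathfrak{c}_{\mathfrak{p}}(u)$ and $\mathfrak{c}_{\mathfrak{p}}(v)$ are $K$-conjugate). The equivalence classes are the decomposition classes in $\mathfrak{p}$; a class is regular if its elements are regular. The decomposition class associated with a regular orbit is the inverse image of that orbit under $\mathcal{C}$. An orbit $\mathcal{O}_1$ (resp. decomposition class $\mathcal{D}_1$) is more general than $\mathcal{O}_0$ (resp. $\mathcal{D}_0$) when $\mathcal{O}_0$ (resp. $\mathcal{D}_0$) is contained in the closure of $\mathcal{O}_1$ (resp. $\mathcal{D}_1$). *)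

theory Defs
  imports "HOL-Analysis.Analysis" "HOL-Algebra.Coset"
begin

section \<open>Complex matrices as a complex vector space and Lie algebra\<close>

type_synonym 'n cmat = "complex ^ 'n ^ 'n"

definition mscale :: "complex \<Rightarrow> 'n cmat \<Rightarrow> 'n::finite cmat"
  where "mscale c X = (\<chi> i j. c * X $ i $ j)"

text \<open>The type \<open>complex ^ 'n ^ 'n\<close> is only an instance of the class of \<^emph>\<open>real\<close> vector spaces.
  All linear algebra below is complex and goes through the following interpretation.\<close>

global_interpretation cmat: vector_space mscale
  by unfold_locales (simp_all add: mscale_def vec_eq_iff algebra_simps)

definition bracket :: "'n::finite cmat \<Rightarrow> 'n cmat \<Rightarrow> 'n cmat"
  where "bracket X Y = X ** Y - Y ** X"

definition lie_subalgebra :: "'n::finite cmat set \<Rightarrow> 'n cmat set \<Rightarrow> bool"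
  where "lie_subalgebra h g \<longleftrightarrow> cmat.subspace h \<and> h \<subseteq> g \<and> (\<forall>x\<in>h. \<forall>y\<in>h. bracket x y \<in> h)"

primrec lower_central :: "'n::finite cmat set \<Rightarrow> nat \<Rightarrow> 'n cmat set"
  where
    "lower_central h 0 = h"
  | "lower_central h (Suc k) = cmat.span {bracket x y | x y. x \<in> h \<and> y \<in> lower_central h k}"

definition nilpotent_lie :: "'n::finite cmat set \<Rightarrow> bool"
  where "nilpotent_lie h \<longleftrightarrow> (\<exists>k. lower_central h k = {0})"

definition cartan_subalgebra :: "'n::finite cmat set \<Rightarrow> 'n cmat set \<Rightarrow> bool"
  where "cartan_subalgebra h g \<longleftrightarrow>
    lie_subalgebra h g \<and> nilpotent_lie h \<and> {x \<in> g. \<forall>y\<in>h. bracket x y \<in> h} = h"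


section \<open>Zariski topologies\<close>

inductive_set fun_algebra :: "('a \<Rightarrow> complex) set \<Rightarrow> ('a \<Rightarrow> complex) set"
  for L :: "('a \<Rightarrow> complex) set"
  where
    const: "(\<lambda>x. c) \<in> fun_algebra L"
  | gen: "f \<in> L \<Longrightarrow> f \<in> fun_algebra L"
  | add: "f \<in> fun_algebra L \<Longrightarrow> g \<in> fun_algebra L \<Longrightarrow> (\<lambda>x. f x + g x) \<in> fun_algebra L"
  | mult: "f \<in> fun_algebra L \<Longrightarrow> g \<in> fun_algebra L \<Longrightarrow> (\<lambda>x. f x * g x) \<in> fun_algebra L"

definition zariski :: "('a \<Rightarrow> complex) set \<Rightarrow> 'a topology"
  where "zariski A = topology_generated_by {{x. f x \<noteq> 0} | f. f \<in> A}"

definition coords :: "('n::finite cmat \<Rightarrow> complex) set"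
  where "coords = {\<lambda>X. X $ i $ j | i j. True}"

definition tuple_coords :: "nat \<Rightarrow> ((nat \<Rightarrow> 'n::finite cmat) \<Rightarrow> complex) set"
  where "tuple_coords r = {\<lambda>v. v k $ i $ j | k i j. k < r}"

definition zariski_mat :: "'n::finite cmat topology"
  where "zariski_mat = zariski (fun_algebra coords)"

definition zariski_tuples :: "nat \<Rightarrow> (nat \<Rightarrow> 'n::finite cmat) topology"
  where "zariski_tuples r = zariski (fun_algebra (tuple_coords r))"


section \<open>The Grassmannian\<close>

definition grassmannian :: "nat \<Rightarrow> 'n::finite cmat set \<Rightarrow> 'n cmat set set"
  where "grassmannian r V = {a. cmat.subspace a \<and> a \<subseteq> V \<and> cmat.dim a = r}"

definition frames :: "nat \<Rightarrow> 'n::finite cmat set \<Rightarrow> (nat \<Rightarrow> 'n cmat) set"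
  where "frames r V = {v \<in> {..<r} \<rightarrow>\<^sub>E V. cmat.dim (v ` {..<r}) = r}"

text \<open>The Zariski topology of the Grassmannian, viewed as the quotient by \<open>GL\<^sub>r\<close> of the open subset
  of frames of \<open>V\<^sup>r\<close>: it is the quotient topology along the map sending a frame to its span.\<close>

definition grassmannian_open :: "nat \<Rightarrow> 'n::finite cmat set \<Rightarrow> 'n cmat set set \<Rightarrow> bool"
  where "grassmannian_open r V U \<longleftrightarrow> U \<subseteq> grassmannian r V \<and>
    openin (subtopology (zariski_tuples r) (frames r V))
      {v \<in> frames r V. cmat.span (v ` {..<r}) \<in> U}"

definition grassmannian_topology :: "nat \<Rightarrow> 'n::finite cmat set \<Rightarrow> 'n cmat set topology"
  where "grassmannian_topology r V = topology (grassmannian_open r V)"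

lemma istopology_grassmannian: "istopology (grassmannian_open r V)"
  unfolding istopology_def
proof (intro conjI allI impI)
  let ?X = "subtopology (zariski_tuples r) (frames r V)"
  let ?pre = "\<lambda>U. {v \<in> frames r V. cmat.span (v ` {..<r}) \<in> U}"
  fix S T :: "'a cmat set set"
  assume S: "grassmannian_open r V S" and T: "grassmannian_open r V T"
  then have "openin ?X (?pre S \<inter> ?pre T)"
    unfolding grassmannian_open_def by (intro openin_Int) auto
  moreover have "?pre S \<inter> ?pre T = ?pre (S \<inter> T)" by auto
  ultimately show "grassmannian_open r V (S \<inter> T)"
    using S by (auto simp: grassmannian_open_def)
next
  let ?X = "subtopology (zariski_tuples r) (frames r V)"
  let ?pre = "\<lambda>U. {v \<in> frames r V. cmat.span (v ` {..<r}) \<in> U}"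
  fix \<K> :: "'a cmat set set set"
  assume K: "\<forall>U\<in>\<K>. grassmannian_open r V U"
  then have "openin ?X (\<Union>U\<in>\<K>. ?pre U)"
    unfolding grassmannian_open_def by (intro openin_clauses(3)) auto
  moreover have "(\<Union>U\<in>\<K>. ?pre U) = ?pre (\<Union>\<K>)" by auto
  ultimately show "grassmannian_open r V (\<Union>\<K>)"
    using K unfolding grassmannian_open_def by auto
qed

lemma openin_grassmannian_topology:
  "openin (grassmannian_topology r V) = grassmannian_open r V"
  by (simp add: grassmannian_topology_def istopology_grassmannian topology_inverse')


section \<open>Reductive linear algebraic groups\<close>

text \<open>Linear algebraic groups are realised as Zariski closed subgroups of some \<open>GL\<^sub>n\<close>.\<close>

definition GL :: "'n::finite cmat monoid"
  where "GL = \<lparr>carrier = {A. invertible A}, mult = (**), one = mat 1\<rparr>"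

abbreviation subgroup_of_GL :: "'n::finite cmat set \<Rightarrow> 'n cmat monoid"
  where "subgroup_of_GL G \<equiv> GL\<lparr>carrier := G\<rparr>"

definition linear_algebraic_group :: "'n::finite cmat set \<Rightarrow> bool"
  where "linear_algebraic_group G \<longleftrightarrow>
    subgroup G GL \<and> closedin (subtopology zariski_mat (carrier GL)) G"

definition unipotent :: "'n::finite cmat \<Rightarrow> bool"
  where "unipotent A \<longleftrightarrow> (\<exists>k. (((**) (A - mat 1)) ^^ k) (mat 1) = 0)"

text \<open>Reductive means that the unipotent radical (the largest connected normal unipotent closed
  subgroup) is trivial; connectedness of the group itself is not required.\<close>

definition reductive_group :: "'n::finite cmat set \<Rightarrow> bool"
  where "reductive_group G \<longleftrightarrow> linear_algebraic_group G \<and>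
    (\<forall>U. U \<lhd> subgroup_of_GL G \<longrightarrow> linear_algebraic_group U \<longrightarrow> connectedin zariski_mat U \<longrightarrow>
      (\<forall>A\<in>U. unipotent A) \<longrightarrow> U = {mat 1})"

text \<open>Regular functions on \<open>GL\<^sub>n\<close>. Those on a closed subgroup are the restrictions of these.\<close>

definition regular_functions :: "('n::finite cmat \<Rightarrow> complex) set"
  where "regular_functions = fun_algebra (coords \<union> {\<lambda>X. inverse (det X)})"

text \<open>The Lie algebra is the Zariski tangent space at the identity.\<close>

definition derivation_at_one :: "'n::finite cmat \<Rightarrow> ('n cmat \<Rightarrow> complex) \<Rightarrow> complex"
  where "derivation_at_one X f = deriv (\<lambda>t. f (mat 1 + mscale t X)) 0"

definition lie_algebra :: "'n::finite cmat set \<Rightarrow> 'n cmat set"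
  where "lie_algebra G =
    {X. \<forall>f\<in>regular_functions. (\<forall>A\<in>G. f A = 0) \<longrightarrow> derivation_at_one X f = 0}"

definition adjoint_action :: "'n::finite cmat \<Rightarrow> 'n cmat \<Rightarrow> 'n cmat"
  where "adjoint_action A X = A ** X ** matrix_inv A"


section \<open>Symmetric pairs\<close>

text \<open>Only the values of \<open>\<theta>\<close> on \<open>G\<close> are relevant. The condition \<open>\<theta>\<^sup>2 = 1\<close> does not exclude the
  identity.\<close>

definition involution_of :: "'n::finite cmat set \<Rightarrow> ('n cmat \<Rightarrow> 'n cmat) \<Rightarrow> bool"
  where "involution_of G \<theta> \<longleftrightarrow>
    \<theta> \<in> hom (subgroup_of_GL G) (subgroup_of_GL G) \<and>
    (\<forall>i j. \<exists>f\<in>regular_functions. \<forall>A\<in>G. \<theta> A $ i $ j = f A) \<and>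
    (\<forall>A\<in>G. \<theta> (\<theta> A) = A)"

definition reductive_symmetric_pair :: "'n::finite cmat set \<Rightarrow> ('n cmat \<Rightarrow> 'n cmat) \<Rightarrow> bool"
  where "reductive_symmetric_pair G \<theta> \<longleftrightarrow> reductive_group G \<and> involution_of G \<theta>"

definition K_group :: "'n::finite cmat set \<Rightarrow> ('n cmat \<Rightarrow> 'n cmat) \<Rightarrow> 'n cmat set"
  where "K_group G \<theta> =
    connected_component_of_set (subtopology zariski_mat {A \<in> G. \<theta> A = A}) (mat 1)"

text \<open>The differential of \<open>\<theta>\<close> at the identity, computed entrywise with any regular functions on
  \<open>GL\<^sub>n\<close> extending the entries of \<open>\<theta>\<close>. On the tangent space of \<open>G\<close> it does not depend on the chosen
  extensions, since two of them differ by a regular function vanishing on \<open>G\<close>.\<close>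

definition differential ::
    "'n::finite cmat set \<Rightarrow> ('n cmat \<Rightarrow> 'n cmat) \<Rightarrow> 'n cmat \<Rightarrow> 'n cmat"
  where "differential G \<theta> X =
    (\<chi> i j. derivation_at_one X
      (SOME f. f \<in> regular_functions \<and> (\<forall>A\<in>G. \<theta> A $ i $ j = f A)))"

definition p_space :: "'n::finite cmat set \<Rightarrow> ('n cmat \<Rightarrow> 'n cmat) \<Rightarrow> 'n cmat set"
  where "p_space G \<theta> = {X \<in> lie_algebra G. differential G \<theta> X = - X}"


section \<open>Cartan subspaces and the variety of reductions\<close>

definition precartan :: "'n::finite cmat set \<Rightarrow> ('n cmat \<Rightarrow> 'n cmat) \<Rightarrow> 'n cmat set \<Rightarrow> bool"
  where "precartan G \<theta> a \<longleftrightarrow> cmat.subspace a \<and> a \<subseteq> p_space G \<theta> \<and>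
    (\<exists>h. cartan_subalgebra h (lie_algebra G) \<and> a \<subseteq> h)"

definition cartan_subspaces :: "'n::finite cmat set \<Rightarrow> ('n cmat \<Rightarrow> 'n cmat) \<Rightarrow> 'n cmat set set"
  where "cartan_subspaces G \<theta> =
    {a. precartan G \<theta> a \<and> (\<forall>b. precartan G \<theta> b \<longrightarrow> a \<subseteq> b \<longrightarrow> b = a)}"

text \<open>All Cartan subspaces have the same dimension; this is the rank.\<close>

definition pair_rank :: "'n::finite cmat set \<Rightarrow> ('n cmat \<Rightarrow> 'n cmat) \<Rightarrow> nat"
  where "pair_rank G \<theta> = the_elem (cmat.dim ` cartan_subspaces G \<theta>)"

definition reductions :: "'n::finite cmat set \<Rightarrow> ('n cmat \<Rightarrow> 'n cmat) \<Rightarrow> 'n cmat set set"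
  where "reductions G \<theta> =
    grassmannian_topology (pair_rank G \<theta>) (p_space G \<theta>) closure_of cartan_subspaces G \<theta>"

definition reductions_topology ::
    "'n::finite cmat set \<Rightarrow> ('n cmat \<Rightarrow> 'n cmat) \<Rightarrow> 'n cmat set topology"
  where "reductions_topology G \<theta> =
    subtopology (grassmannian_topology (pair_rank G \<theta>) (p_space G \<theta>)) (reductions G \<theta>)"


section \<open>Regular orbits and regular decomposition classes\<close>

definition centralizer_p ::
    "'n::finite cmat set \<Rightarrow> ('n cmat \<Rightarrow> 'n cmat) \<Rightarrow> 'n cmat \<Rightarrow> 'n cmat set"
  where "centralizer_p G \<theta> u = {v \<in> p_space G \<theta>. bracket u v = 0}"

definition regular_elements :: "'n::finite cmat set \<Rightarrow> ('n cmat \<Rightarrow> 'n cmat) \<Rightarrow> 'n cmat set"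
  where "regular_elements G \<theta> = {u \<in> p_space G \<theta>.
    \<forall>v\<in>p_space G \<theta>. cmat.dim (centralizer_p G \<theta> u) \<le> cmat.dim (centralizer_p G \<theta> v)}"

definition regular_reductions :: "'n::finite cmat set \<Rightarrow> ('n cmat \<Rightarrow> 'n cmat) \<Rightarrow> 'n cmat set set"
  where "regular_reductions G \<theta> =
    {a \<in> reductions G \<theta>. \<exists>u\<in>regular_elements G \<theta>. a = centralizer_p G \<theta> u}"

definition K_orbit ::
    "'n::finite cmat set \<Rightarrow> ('n cmat \<Rightarrow> 'n cmat) \<Rightarrow> 'n cmat set \<Rightarrow> 'n cmat set set"
  where "K_orbit G \<theta> a = {adjoint_action k ` a | k. k \<in> K_group G \<theta>}"

definition regular_orbits ::
    "'n::finite cmat set \<Rightarrow> ('n cmat \<Rightarrow> 'n cmat) \<Rightarrow> 'n cmat set set set"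
  where "regular_orbits G \<theta> =
    {orb \<in> K_orbit G \<theta> ` reductions G \<theta>. orb \<inter> regular_reductions G \<theta> \<noteq> {}}"

text \<open>The decomposition class associated with a regular orbit: its inverse image under the
  centralizer map, whose domain is the set of regular elements.\<close>

definition associated_class ::
    "'n::finite cmat set \<Rightarrow> ('n cmat \<Rightarrow> 'n cmat) \<Rightarrow> 'n cmat set set \<Rightarrow> 'n cmat set"
  where "associated_class G \<theta> orb = {u \<in> regular_elements G \<theta>. centralizer_p G \<theta> u \<in> orb}"

definition more_general :: "'a topology \<Rightarrow> 'a set \<Rightarrow> 'a set \<Rightarrow> bool"
  where "more_general T S\<^sub>1 S\<^sub>0 \<longleftrightarrow> S\<^sub>0 \<subseteq> T closure_of S\<^sub>1"

end

theory Submission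
  imports Defs "HOL-Computational_Algebra.Fundamental_Theorem_Algebra"
begin

text \<open>
  Write \<open>C u\<close> for the centralizer of \<open>u\<close> in \<open>\<pp>\<close>. The decomposition class of a regular orbit is its
  preimage under \<open>C\<close> on the regular locus, and every element of a regular orbit is of the form \<open>C u\<close>
  with \<open>u\<close> regular, because conjugation by fixed points of the involution preserves \<open>\<pp>\<close>, regularity
  and the set of reductions. So the theorem says that taking preimages under \<open>C\<close> preserves and
  reflects inclusion in closures, which follows from two properties of \<open>C\<close>.

  First, \<open>C\<close> is continuous on the regular locus: near a regular element the centralizer has constant
  dimension, and Cramer's rule provides a basis with polynomial entries (\<open>centralizer_chart\<close>). This
  carries closure relations from classes to orbits (\<open>orbits_more_general_if_classes\<close>).

  Second, if a point \<open>v\<close> of a regular reduction \<open>b\<close> is a regular element, then \<open>b = C v\<close>. Indeed \<open>b\<close> is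
  abelian, so \<open>b \<subseteq> C v\<close>, and the dimensions agree. Since the subspaces that meet a given open subset
  of \<open>\<pp>\<close> form an open set (\<open>meets_open\<close>), closure relations pass from orbits to classes
  (\<open>classes_more_general_if_orbits\<close>).

  The substance is that reductions are abelian (\<open>reduction_abelian\<close>). This is a closed condition, so it
  reduces to Cartan subalgebras of the Lie algebra of a reductive group being abelian
  (\<open>cartan_subalgebra_abelian\<close>), where reductive means that the unipotent radical is trivial. If a
  Cartan subalgebra \<open>h\<close> is not abelian, the last nonzero term of its lower central series contains a
  nonzero nilpotent matrix \<open>z\<close> which is central in \<open>h\<close>. The linear form \<open>trace (z y)\<close> vanishes on \<open>h\<close> and
  on \<open>[h, \<gg>]\<close>, hence on all of \<open>\<gg>\<close> by a weight argument (\<open>cartan_functional_zero\<close>); so \<open>z\<close> lies in the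
  radical of the trace form. Cartan's criterion shows that the derived algebra of this radical consists
  of nilpotent matrices, and a stable ideal of nilpotent matrices is zero
  (\<open>reductive_no_nilpotent_ideal\<close>): the group elements acting trivially on the graded pieces of its
  Engel flag form a normal closed unipotent subgroup. This subgroup is connected, because it contains
  the curve \<open>A ^ t\<close> with each \<open>A\<close>, and it contains the exponentials of the ideal. Hence the radical is
  abelian, its nilpotent elements again form such an ideal, and \<open>z = 0\<close>.
\<close>

section \<open>Linear operators on complex matrices\<close>

abbreviation clinear :: "('n::finite cmat \<Rightarrow> 'n cmat) \<Rightarrow> bool"
  where "clinear \<equiv> Vector_Spaces.linear mscale mscale"

definition unit_mats :: "'n::finite cmat set"
  where "unit_mats = range (\<lambda>(a, b). \<chi> i j. if i = a \<and> j = b then 1 else 0)"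

lemma mscale_nth [simp]: "mscale c X $ i $ j = c * X $ i $ j"
  by (simp add: mscale_def)

lemma sum_nth2: "(\<Sum>x\<in>A. f x) $ i $ j = (\<Sum>x\<in>A. f x $ i $ j)"
  by (simp add: sum_component)

lemma matrix_unit_expansion:
  "X = (\<Sum>(a, b)\<in>UNIV. mscale (X $ a $ b) (\<chi> i j. if i = a \<and> j = b then 1 else 0))"
proof -
  have "(\<Sum>(a, b)\<in>UNIV. mscale (X $ a $ b) (\<chi> i j. if i = a \<and> j = b then 1 else 0)) $ i $ j = X $ i $ j"
    for i j
  proof -
    have "(\<Sum>(a, b)\<in>UNIV. mscale (X $ a $ b) (\<chi> i j. if i = a \<and> j = b then 1 else 0)) $ i $ j
        = (\<Sum>ab\<in>UNIV. if ab = (i, j) then X $ i $ j else 0)"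
      unfolding sum_nth2 by (rule sum.cong) (auto split: if_splits)
    then show ?thesis by simp
  qed
  then show ?thesis by (simp add: vec_eq_iff)
qed

global_interpretation cfd: finite_dimensional_vector_space mscale "unit_mats :: 'n::finite cmat set"
proof
  show fin: "finite (unit_mats :: 'n cmat set)" by (simp add: unit_mats_def)
  show "cmat.span (unit_mats :: 'n cmat set) = UNIV"
  proof -
    have "X \<in> cmat.span unit_mats" for X :: "'n cmat"
      by (subst matrix_unit_expansion, rule cmat.span_sum)
        (clarsimp, rule cmat.span_scale, rule cmat.span_base, auto simp: unit_mats_def)
    then show ?thesis by auto
  qed
  show "\<not> cmat.dependent (unit_mats :: 'n cmat set)"
  proof (rule cmat.independent_if_scalars_zero[OF fin])
    fix f :: "'n cmat \<Rightarrow> complex" and x :: "'n cmat"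
    assume s: "(\<Sum>x\<in>unit_mats. mscale (f x) x) = 0" and "x \<in> unit_mats"
    then obtain a b where x: "x = (\<chi> i j. if i = a \<and> j = b then 1 else 0)"
      by (auto simp: unit_mats_def)
    have "(\<Sum>y\<in>unit_mats. f y * y $ a $ b) = (\<Sum>y\<in>unit_mats. if y = x then f x else 0)"
    proof (rule sum.cong)
      fix y :: "'n cmat" assume "y \<in> unit_mats"
      then obtain c d where y: "y = (\<chi> i j. if i = c \<and> j = d then 1 else 0)"
        by (auto simp: unit_mats_def)
      show "f y * y $ a $ b = (if y = x then f x else 0)"
      proof (cases "a = c \<and> b = d")
        case True then show ?thesis by (simp add: x y)
      next
        case False
        then have "y $ a $ b = 0" "x $ a $ b = 1" by (auto simp: x y)
        then show ?thesis by auto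
      qed
    qed simp
    also have "\<dots> = f x" using \<open>x \<in> unit_mats\<close> fin by simp
    finally show "f x = 0"
      using arg_cong[OF s, of "\<lambda>M. M $ a $ b"] by (simp add: sum_nth2)
  qed
qed

global_interpretation cpair: vector_space_pair mscale mscale
  by unfold_locales

lemma clinearI:
  assumes "\<And>x y. f (x + y) = f x + f y" "\<And>c x. f (mscale c x) = mscale c (f x)"
  shows "clinear f"
  using assms by unfold_locales auto

lemma clinear_simps:
  assumes "clinear f"
  shows "f (x + y) = f x + f y" "f (x - y) = f x - f y" "f 0 = 0" "f (- x) = - f x"
    "f (mscale c x) = mscale c (f x)" "f (sum h A) = (\<Sum>a\<in>A. f (h a))"
  using assms
  by (auto simp: cpair.linear_add cpair.linear_diff cpair.linear_0 cpair.linear_neg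
      cpair.linear_scale cpair.linear_sum)

lemma clinear_funpow: "clinear f \<Longrightarrow> clinear (f ^^ k)"
  by (induction k) (auto intro!: clinearI simp: clinear_simps)

lemma clinear_compose: "clinear f \<Longrightarrow> clinear g \<Longrightarrow> clinear (\<lambda>x. f (g x))"
  by (auto intro!: clinearI simp: clinear_simps)

lemmas cscale_simps = cmat.scale_left_distrib cmat.scale_right_distrib
  cmat.scale_left_diff_distrib cmat.scale_right_diff_distrib

lemma clinear_shift: "clinear f \<Longrightarrow> clinear (\<lambda>v. f v - mscale \<mu> v)"
  by (auto intro!: clinearI simp: clinear_simps cscale_simps algebra_simps)

lemma mscale_mult: "mscale a X ** Y = mscale a (X ** Y)" "X ** mscale a Y = mscale a (X ** Y)"
  by (simp_all add: vec_eq_iff matrix_matrix_mult_def sum_distrib_left algebra_simps)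

lemma matrix_neg_mult: "(- X) ** Y = - (X ** Y)" "X ** (- Y) = - (X ** (Y::'n::finite cmat))"
  by (simp_all add: vec_eq_iff matrix_matrix_mult_def sum_negf)

lemma matrix_diff_distrib:
  "(X - Y) ** Z = X ** Z - Y ** Z" "Z ** (X - Y) = Z ** X - Z ** (Y :: 'n::finite cmat)"
  by (simp_all add: vec_eq_iff matrix_matrix_mult_def sum_subtractf algebra_simps)

lemma matrix_zero_mult: "0 ** X = 0" "X ** 0 = (0 :: 'n::finite cmat)"
  by (simp_all add: vec_eq_iff matrix_matrix_mult_def)

lemma matrix_add_rdistrib: "(X + Y) ** Z = X ** Z + Y ** (Z :: 'n::finite cmat)"
  by (simp add: vec_eq_iff matrix_matrix_mult_def sum.distrib algebra_simps)

lemma matrix_sum_distrib: "sum f A ** X = (\<Sum>a\<in>A. f a ** X)"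
    "X ** sum f A = (\<Sum>a\<in>A. X ** (f a :: 'n::finite cmat))"
  by (induction A rule: infinite_finite_induct)
    (simp_all add: matrix_zero_mult matrix_add_rdistrib matrix_add_ldistrib)

lemmas mat_simps = mscale_mult matrix_neg_mult matrix_diff_distrib matrix_zero_mult
  matrix_add_rdistrib matrix_add_ldistrib matrix_mul_assoc

lemma clinear_mult_left: "clinear ((**) X)" and clinear_mult_right: "clinear (\<lambda>Y. Y ** X)"
  by (auto intro!: clinearI simp: mat_simps)

lemma bracket_simps:
  "bracket (x + x') y = bracket x y + bracket x' y" "bracket x (y + y') = bracket x y + bracket x y'"
  "bracket (x - x') y = bracket x y - bracket x' y" "bracket x (y - y') = bracket x y - bracket x y'"
  "bracket (mscale c x) y = mscale c (bracket x y)" "bracket x (mscale c y) = mscale c (bracket x y)"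
  "bracket 0 y = 0" "bracket x 0 = 0" "bracket x x = 0"
  "bracket (- x) y = - bracket x y" "bracket x (- y) = - bracket x y"
  by (simp_all add: bracket_def mat_simps cscale_simps algebra_simps)

lemma bracket_anti: "bracket x y = - bracket y x"
  by (simp add: bracket_def)

lemma bracket_jacobi: "bracket x (bracket y z) = bracket (bracket x y) z + bracket y (bracket x z)"
  by (simp add: bracket_def mat_simps algebra_simps)

lemma clinear_bracket: "clinear (bracket x)" and clinear_bracket_left: "clinear (\<lambda>x. bracket x y)"
  by (auto intro!: clinearI simp: bracket_simps)

lemma in_span_image_lessThan:
  assumes "x \<in> cmat.span (g ` {..<n::nat})"
  shows "\<exists>c. x = (\<Sum>i<n. mscale (c i) (g i))"
  using assms
proof (induction n arbitrary: x)
  case 0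
  then show ?case by simp
next
  case (Suc n)
  then obtain k where "x - mscale k (g n) \<in> cmat.span (g ` {..<n})"
    by (auto simp: lessThan_Suc cmat.span_insert)
  from Suc.IH[OF this] obtain c where "x - mscale k (g n) = (\<Sum>i<n. mscale (c i) (g i))" by blast
  then have "x = (\<Sum>i<Suc n. mscale ((c(n := k)) i) (g i))"
    by (simp add: algebra_simps)
  then show ?case by blast
qed

text \<open>Expanding \<open>f ^^ (m + k)\<close> on \<open>b u v\<close> by the Leibniz rule, every term applies \<open>g\<close> at least \<open>m\<close>
  times to \<open>u\<close> or \<open>h\<close> at least \<open>k\<close> times to \<open>v\<close>. With \<open>b\<close> the bracket this makes generalized null
  spaces of nilpotent Lie algebras stable; with \<open>b\<close> the matrix product it adds up generalized
  eigenvalues.\<close>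

lemma leibniz_nilpotent:
  fixes f g h :: "'n::finite cmat \<Rightarrow> 'n cmat" and b :: "'n cmat \<Rightarrow> 'n cmat \<Rightarrow> 'n cmat"
  assumes f: "clinear f"
    and b0: "\<And>v. b 0 v = 0" "\<And>u. b u 0 = 0"
    and leib: "\<And>u v. f (b u v) = b (g u) v + b u (h v)"
  shows "(g ^^ m) u = 0 \<Longrightarrow> (h ^^ k) v = 0 \<Longrightarrow> (f ^^ (m + k)) (b u v) = 0"
proof (induction "m + k" arbitrary: m k u v)
  case 0
  then show ?case by (simp add: b0)
next
  case (Suc n)
  note lin = clinear_simps[OF clinear_funpow[OF f]]
  show ?case
  proof (cases "m = 0 \<or> k = 0")
    case True
    then have "b u v = 0" using Suc.prems b0 by auto
    then show ?thesis by (simp add: lin)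
  next
    case False
    then obtain m' k' where mk: "m = Suc m'" "k = Suc k'" by (meson not0_implies_Suc)
    have "(f ^^ (m' + k)) (b (g u) v) = 0"
      by (rule Suc.hyps(1)) (use Suc.hyps Suc.prems mk in \<open>auto simp: funpow_swap1\<close>)
    moreover have "(f ^^ (m + k')) (b u (h v)) = 0"
      by (rule Suc.hyps(1)) (use Suc.hyps Suc.prems mk in \<open>auto simp: funpow_swap1\<close>)
    moreover have "(f ^^ (m + k)) (b u v) = (f ^^ n) (b (g u) v + b u (h v))"
      using Suc.hyps(2) by (metis funpow_Suc_right comp_apply leib)
    ultimately show ?thesis using Suc.hyps(2) mk by (simp add: lin)
  qed
qed

definition poly_apply :: "('n::finite cmat \<Rightarrow> 'n cmat) \<Rightarrow> complex poly \<Rightarrow> 'n cmat \<Rightarrow> 'n cmat"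
  where "poly_apply f p v = (\<Sum>i\<le>degree p. mscale (coeff p i) ((f ^^ i) v))"

lemma poly_apply_bound:
  "degree p \<le> n \<Longrightarrow> poly_apply f p v = (\<Sum>i\<le>n. mscale (coeff p i) ((f ^^ i) v))"
  unfolding poly_apply_def
  by (rule sum.mono_neutral_left) (auto simp: coeff_eq_0 not_le)

lemma poly_apply_linear_factor:
  assumes f: "clinear f"
  shows "poly_apply f ([:- \<mu>, 1:] * q) v = f (poly_apply f q v) - mscale \<mu> (poly_apply f q v)"
proof -
  let ?n = "degree q" and ?p = "[:- \<mu>, 1:] * q"
  have p: "?p = pCons 0 q - smult \<mu> q" by simp
  have "degree ?p \<le> Suc ?n"
    unfolding p by (intro degree_diff_le degree_pCons_le) (simp add: le_SucI)
  then have "poly_apply f ?p v = (\<Sum>i\<le>Suc ?n. mscale (coeff ?p i) ((f ^^ i) v))"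
    by (rule poly_apply_bound)
  also have "\<dots> = (\<Sum>i\<le>Suc ?n. mscale (coeff (pCons 0 q) i) ((f ^^ i) v))
      - mscale \<mu> (\<Sum>i\<le>Suc ?n. mscale (coeff q i) ((f ^^ i) v))"
    unfolding p by (simp add: cmat.scale_sum_right sum_subtractf cscale_simps del: sum.atMost_Suc)
  also have "(\<Sum>i\<le>Suc ?n. mscale (coeff q i) ((f ^^ i) v)) = poly_apply f q v"
    by (rule poly_apply_bound[symmetric]) simp
  also have "(\<Sum>i\<le>Suc ?n. mscale (coeff (pCons 0 q) i) ((f ^^ i) v)) = f (poly_apply f q v)"
    unfolding poly_apply_def by (simp add: sum.atMost_Suc_shift clinear_simps[OF f] del: sum.atMost_Suc)
  finally show ?thesis .
qed

text \<open>The iterates of \<open>f\<close> at \<open>v\<close> cannot all be linearly independent, and the first dependence is monic.\<close>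

lemma annihilating_poly:
  assumes f: "clinear f"
  shows "\<exists>p. p \<noteq> 0 \<and> poly_apply f p v = 0"
proof -
  let ?g = "\<lambda>i. (f ^^ i) v"
  \<comment> \<open>Without such an \<open>n\<close> the iterates form arbitrarily large independent families.\<close>
  have "\<exists>n. ?g n \<in> cmat.span (?g ` {..<n})"
  proof (rule ccontr)
    assume no: "\<nexists>n. ?g n \<in> cmat.span (?g ` {..<n})"
    have "cmat.independent (?g ` {..<n}) \<and> card (?g ` {..<n}) = n" for n
    proof (induction n)
      case (Suc n)
      have "?g n \<notin> cmat.span (?g ` {..<n})" using no by blast
      with Suc show ?case
        by (auto simp: lessThan_Suc cmat.independent_insert card_insert_if intro: cmat.span_base)
    qed (simp add: cmat.independent_empty)
    then have "n \<le> cmat.dim (UNIV :: 'a cmat set)" for n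
      using cfd.independent_card_le_dim[of "?g ` {..<n}" UNIV] by auto
    then show False using not_less_eq_eq by blast
  qed
  then obtain n c where c: "?g n = (\<Sum>i<n. mscale (c i) (?g i))"
    using in_span_image_lessThan by blast
  define p where "p = monom 1 n - (\<Sum>i<n. monom (c i) i)"
  have co: "coeff p i = (if i = n then 1 else 0) - (if i < n then c i else 0)" for i
    by (auto simp: p_def coeff_sum)
  have "p \<noteq> 0" using co[of n] by auto
  moreover have "degree p \<le> n" by (rule degree_le) (auto simp: co)
  then have "poly_apply f p v = (\<Sum>i\<le>n. mscale (coeff p i) (?g i))" by (rule poly_apply_bound)
  then have "poly_apply f p v = 0"
    using c by (simp add: co lessThan_Suc_atMost[symmetric] sum_negf)
  ultimately show ?thesis by blast
qed

definition gen_eigenspace :: "('n::finite cmat \<Rightarrow> 'n cmat) \<Rightarrow> complex \<Rightarrow> 'n cmat set"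
  where "gen_eigenspace f \<mu> = {v. \<exists>k. ((\<lambda>w. f w - mscale \<mu> w) ^^ k) v = 0}"

lemma funpow_zero_mono:
  assumes "clinear g" "(g ^^ k) v = 0" "k \<le> m" shows "(g ^^ m) v = 0"
proof -
  from \<open>k \<le> m\<close> obtain j where "m = j + k" by (metis add.commute le_Suc_ex)
  then show ?thesis using assms by (simp add: funpow_add clinear_simps[OF clinear_funpow])
qed

lemma subspace_eventual_kernel:
  assumes g: "clinear g"
  shows "cmat.subspace {v. \<exists>k. (g ^^ k) v = 0}"
proof (rule cmat.subspaceI)
  note lin = clinear_simps[OF clinear_funpow[OF g]]
  show "0 \<in> {v. \<exists>k. (g ^^ k) v = 0}" by (auto simp: lin)
  show "x + y \<in> {v. \<exists>k. (g ^^ k) v = 0}"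
    if "x \<in> {v. \<exists>k. (g ^^ k) v = 0}" "y \<in> {v. \<exists>k. (g ^^ k) v = 0}" for x y
  proof -
    from that obtain k l where kl: "(g ^^ k) x = 0" "(g ^^ l) y = 0" by auto
    have "(g ^^ (max k l)) (x + y) = 0"
      using funpow_zero_mono[OF g kl(1), of "max k l"] funpow_zero_mono[OF g kl(2), of "max k l"]
      by (simp add: lin)
    then show ?thesis by blast
  qed
  show "mscale c x \<in> {v. \<exists>k. (g ^^ k) v = 0}" if "x \<in> {v. \<exists>k. (g ^^ k) v = 0}" for c x
    using that by (auto simp: lin)
qed

lemma subspace_gen_eigenspace: "clinear f \<Longrightarrow> cmat.subspace (gen_eigenspace f \<mu>)"
  unfolding gen_eigenspace_def by (rule subspace_eventual_kernel[OF clinear_shift])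

lemma funpow_Suc_zero_iff: "(g ^^ Suc k) v = 0 \<longleftrightarrow> (g ^^ k) (g v) = 0"
  by (simp add: funpow_swap1)

lemma gen_eigenspace_stable:
  assumes f: "clinear f" and v: "v \<in> gen_eigenspace f \<mu>"
  shows "f v - mscale \<nu> v \<in> gen_eigenspace f \<mu>"
proof -
  let ?g = "\<lambda>w. f w - mscale \<mu> w"
  from v obtain k where "(?g ^^ k) v = 0" by (auto simp: gen_eigenspace_def)
  then have "(?g ^^ k) (?g v) = ?g 0" by (metis funpow_swap1)
  then have "?g v \<in> gen_eigenspace f \<mu>" by (auto simp: gen_eigenspace_def clinear_simps[OF f])
  then have "?g v + mscale (\<mu> - \<nu>) v \<in> gen_eigenspace f \<mu>"
    using subspace_gen_eigenspace[OF f, of \<mu>] v by (simp add: cmat.subspace_add cmat.subspace_scale)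
  then show ?thesis by (simp add: cscale_simps algebra_simps)
qed

lemma gen_eigenspace_disjoint:
  assumes f: "clinear f" and "v \<in> gen_eigenspace f \<nu>" "v \<in> gen_eigenspace f \<mu>" "\<nu> \<noteq> \<mu>"
  shows "v = 0"
proof -
  let ?g = "\<lambda>a w. f w - mscale a w"
  have "v = 0" if "(?g \<nu> ^^ k) v = 0" "v \<in> gen_eigenspace f \<mu>" for k v
    using that
  proof (induction k arbitrary: v)
    case (Suc k)
    have "?g \<nu> v = 0"
      using Suc.prems(1) gen_eigenspace_stable[OF f Suc.prems(2), of \<nu>]
      unfolding funpow_Suc_zero_iff by (rule Suc.IH)
    then have fv: "f v = mscale \<nu> v" by simp
    have "(?g \<mu> ^^ j) v = mscale ((\<nu> - \<mu>) ^ j) v" for j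
      by (induction j) (simp_all add: clinear_simps[OF f] fv cscale_simps algebra_simps)
    with Suc.prems(2) \<open>\<nu> \<noteq> \<mu>\<close> show ?case by (auto simp: gen_eigenspace_def)
  qed simp
  then show ?thesis using assms by (auto simp: gen_eigenspace_def)
qed

text \<open>A power of \<open>f - \<mu>\<close> kills the \<open>\<mu>\<close>-component of a relation and keeps the other components in their
  generalized eigenspaces, which meet that of \<open>\<mu>\<close> only in \<open>0\<close>.\<close>

lemma gen_eigenspace_independent:
  assumes f: "clinear f" and "finite \<Lambda>" and "\<And>\<nu>. \<nu> \<in> \<Lambda> \<Longrightarrow> c \<nu> \<in> gen_eigenspace f \<nu>"
    and "(\<Sum>\<nu>\<in>\<Lambda>. c \<nu>) = 0" and "\<nu> \<in> \<Lambda>"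
  shows "c \<nu> = 0"
proof -
  have "\<forall>\<nu>\<in>\<Lambda>. c \<nu> = 0"
    using assms(2-4)
  proof (induction \<Lambda> arbitrary: c rule: finite_induct)
    case (insert \<mu> \<Lambda>)
    define g where "g = (\<lambda>w. f w - mscale \<mu> w)"
    have g: "clinear g" unfolding g_def by (rule clinear_shift[OF f])
    obtain k where k: "(g ^^ k) (c \<mu>) = 0"
      using insert.prems(1)[of \<mu>] by (auto simp: gen_eigenspace_def g_def)
    have st: "(g ^^ j) v \<in> gen_eigenspace f \<nu>" if "v \<in> gen_eigenspace f \<nu>" for v \<nu> j
      using that by (induction j) (auto simp: g_def intro: gen_eigenspace_stable[OF f])
    have "(\<Sum>\<nu>\<in>\<Lambda>. (g ^^ k) (c \<nu>)) = (g ^^ k) (\<Sum>\<nu>\<in>insert \<mu> \<Lambda>. c \<nu>)"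
      using insert.hyps k by (simp add: clinear_simps[OF clinear_funpow[OF g]])
    also have "\<dots> = 0" using insert.prems(2) by (simp add: clinear_simps[OF clinear_funpow[OF g]])
    finally have "(\<Sum>\<nu>\<in>\<Lambda>. (g ^^ k) (c \<nu>)) = 0" .
    moreover have "(g ^^ k) (c \<nu>) \<in> gen_eigenspace f \<nu>" if "\<nu> \<in> \<Lambda>" for \<nu>
      by (rule st) (use that insert.prems(1) in blast)
    ultimately have gz: "\<forall>\<nu>\<in>\<Lambda>. (g ^^ k) (c \<nu>) = 0" by (rule insert.IH[rotated])
    have z: "\<forall>\<nu>\<in>\<Lambda>. c \<nu> = 0"
    proof
      fix \<nu> assume \<nu>: "\<nu> \<in> \<Lambda>"
      show "c \<nu> = 0"
      proof (rule gen_eigenspace_disjoint[OF f])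
        show "c \<nu> \<in> gen_eigenspace f \<nu>" using insert.prems(1) \<nu> by blast
        show "c \<nu> \<in> gen_eigenspace f \<mu>" using gz \<nu> unfolding gen_eigenspace_def g_def by blast
        show "\<nu> \<noteq> \<mu>" using insert.hyps \<nu> by blast
      qed
    qed
    with insert.prems(2) insert.hyps have "c \<mu> = 0" by simp
    with z show ?case by simp
  qed simp
  with assms show ?thesis by blast
qed

lemma span_UN_subspaces:
  assumes F: "\<And>i. cmat.subspace (F i)" and "v \<in> cmat.span (\<Union>i. F i)"
  shows "\<exists>\<Lambda> c. finite \<Lambda> \<and> (\<forall>i. c i \<in> F i) \<and> v = (\<Sum>i\<in>\<Lambda>. c i)"
  using assms(2)
proof (induction rule: cmat.span_induct_alt)
  case base
  then show ?case
    using cmat.subspace_0[OF F] by (intro exI[of _ "{}"] exI[of _ "\<lambda>_. 0"]) auto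
next
  case (step a x y)
  then obtain \<Lambda> c i where L: "finite \<Lambda>" "\<forall>i. c i \<in> F i" "y = (\<Sum>i\<in>\<Lambda>. c i)" and i: "x \<in> F i"
    by blast
  define c' where "c' = c(i := mscale a x + (if i \<in> \<Lambda> then c i else 0))"
  have "mscale a x + y = (\<Sum>j\<in>insert i \<Lambda>. c' j)"
  proof (cases "i \<in> \<Lambda>")
    case True
    have "y = c i + (\<Sum>j\<in>\<Lambda> - {i}. c j)" using L True by (simp add: sum.remove)
    moreover have "(\<Sum>j\<in>insert i \<Lambda>. c' j) = c' i + (\<Sum>j\<in>\<Lambda> - {i}. c' j)"
      using L True by (simp add: sum.remove insert_absorb)
    moreover have "(\<Sum>j\<in>\<Lambda> - {i}. c' j) = (\<Sum>j\<in>\<Lambda> - {i}. c j)"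
      by (rule sum.cong) (auto simp: c'_def)
    ultimately show ?thesis using True by (simp add: c'_def add.assoc)
  next
    case False
    have "(\<Sum>j\<in>\<Lambda>. c' j) = (\<Sum>j\<in>\<Lambda>. c j)"
      using False by (intro sum.cong) (auto simp: c'_def)
    then show ?thesis using L False by (simp add: c'_def)
  qed
  moreover have "\<forall>j. c' j \<in> F j"
    using L i F by (auto simp: c'_def intro: cmat.subspace_add cmat.subspace_scale)
  ultimately show ?case using L by blast
qed

text \<open>On the generalized eigenspace of \<open>\<nu>\<close> the operator \<open>f - \<mu>\<close> is the nonzero scalar \<open>\<nu> - \<mu>\<close> plus the
  nilpotent operator \<open>f - \<nu>\<close>, so a finite geometric series inverts it. The series is hidden in the
  induction, which stays inside the stable subspace \<open>S\<close>.\<close>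

lemma gen_eigenspace_shift_onto:
  assumes f: "clinear f" and S: "cmat.subspace S" and st: "f ` S \<subseteq> S"
    and w: "w \<in> S" "w \<in> gen_eigenspace f \<nu>" and "\<nu> \<noteq> \<mu>"
  shows "\<exists>v \<in> S \<inter> gen_eigenspace f \<nu>. f v - mscale \<mu> v = w"
proof -
  let ?g = "\<lambda>w. f w - mscale \<nu> w"
  have "\<exists>v \<in> S \<inter> gen_eigenspace f \<nu>. f v - mscale \<mu> v = w" if "(?g ^^ k) w = 0" "w \<in> S" for k w
    using that
  proof (induction k arbitrary: w)
    case 0
    then show ?case
      using cmat.subspace_0[OF S] cmat.subspace_0[OF subspace_gen_eigenspace[OF f, of \<nu>]]
      by (intro bexI[of _ 0]) (auto simp: clinear_simps[OF f])
  next
    case (Suc k)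
    have "?g w \<in> S" using Suc.prems(2) st S by (auto intro: cmat.subspace_diff cmat.subspace_scale)
    moreover have "(?g ^^ k) (?g w) = 0" using Suc.prems(1) unfolding funpow_Suc_zero_iff .
    ultimately obtain v' where v': "v' \<in> S" "v' \<in> gen_eigenspace f \<nu>" "f v' - mscale \<mu> v' = ?g w"
      using Suc.IH[of "?g w"] by auto
    have w': "w \<in> gen_eigenspace f \<nu>" using Suc.prems(1) unfolding gen_eigenspace_def by blast
    let ?v = "mscale (1 / (\<nu> - \<mu>)) (w - v')"
    have "f ?v - mscale \<mu> ?v = mscale (1 / (\<nu> - \<mu>)) ((f w - mscale \<mu> w) - (f v' - mscale \<mu> v'))"
      by (simp add: clinear_simps[OF f] cscale_simps algebra_simps)
    also have "(f w - mscale \<mu> w) - (f v' - mscale \<mu> v') = mscale (\<nu> - \<mu>) w"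
      unfolding v'(3) by (simp add: cscale_simps)
    also have "mscale (1 / (\<nu> - \<mu>)) \<dots> = w" using \<open>\<nu> \<noteq> \<mu>\<close> by simp
    finally have "f ?v - mscale \<mu> ?v = w" .
    moreover have "?v \<in> S \<inter> gen_eigenspace f \<nu>"
      using v' w' Suc.prems(2) S subspace_gen_eigenspace[OF f]
      by (simp add: cmat.subspace_scale cmat.subspace_diff)
    ultimately show ?case by blast
  qed
  then show ?thesis using w by (auto simp: gen_eigenspace_def)
qed

text \<open>Induction on the degree of a polynomial annihilating \<open>v\<close>. For a root \<open>\<mu>\<close>, the vector \<open>(f - \<mu>) v\<close> is
  annihilated by a polynomial of smaller degree, hence is a sum of generalized eigenvectors. All of
  its components except the one for \<open>\<mu>\<close> can be lifted along \<open>f - \<mu>\<close>; subtracting the lifts from \<open>v\<close>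
  leaves an element of the generalized eigenspace of \<open>\<mu>\<close>.\<close>

lemma primary_decomposition:
  assumes f: "clinear f" and S: "cmat.subspace S" and st: "f ` S \<subseteq> S"
  shows "S \<subseteq> cmat.span (\<Union>\<mu>. S \<inter> gen_eigenspace f \<mu>)"
proof
  let ?X = "\<Union>\<mu>. S \<inter> gen_eigenspace f \<mu>"
  have XS: "cmat.span ?X \<subseteq> S" by (rule cmat.span_minimal[OF _ S]) auto
  \<comment> \<open>Up to the \<open>\<mu>\<close>-component, every sum of generalized eigenvectors is in the image of \<open>f - \<mu>\<close>.\<close>
  have approx: "\<exists>y\<in>cmat.span ?X. f y - mscale \<mu> y - w \<in> gen_eigenspace f \<mu>"
    if "w \<in> cmat.span ?X" for w \<mu>
    using that
  proof (induction rule: cmat.span_induct_alt)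
    case base
    then show ?case
      using cmat.span_zero cmat.subspace_0[OF subspace_gen_eigenspace[OF f]]
      by (intro bexI[of _ 0]) (auto simp: clinear_simps[OF f])
  next
    case (step c x w)
    then obtain y \<nu> where y: "y \<in> cmat.span ?X" "f y - mscale \<mu> y - w \<in> gen_eigenspace f \<mu>"
      and x: "x \<in> S" "x \<in> gen_eigenspace f \<nu>" by blast
    obtain z where z: "z \<in> cmat.span ?X" "f z - mscale \<mu> z - x \<in> gen_eigenspace f \<mu>"
    proof (cases "\<nu> = \<mu>")
      case True
      show ?thesis
        using x True by (intro that[of 0])
          (auto simp: clinear_simps[OF f] cmat.span_zero intro: cmat.subspace_neg[OF subspace_gen_eigenspace[OF f]])
    next
      case False
      then obtain v where "v \<in> S \<inter> gen_eigenspace f \<nu>" "f v - mscale \<mu> v = x"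
        using gen_eigenspace_shift_onto[OF f S st x] by blast
      then show ?thesis
        by (intro that[of v]) (auto intro: cmat.span_base cmat.subspace_0[OF subspace_gen_eigenspace[OF f]])
    qed
    have "f (mscale c z + y) - mscale \<mu> (mscale c z + y) - (mscale c x + w)
        = mscale c (f z - mscale \<mu> z - x) + (f y - mscale \<mu> y - w)"
      by (simp add: clinear_simps[OF f] cscale_simps algebra_simps)
    also have "\<dots> \<in> gen_eigenspace f \<mu>"
      using y z subspace_gen_eigenspace[OF f] by (blast intro: cmat.subspace_add cmat.subspace_scale)
    finally show ?case
      using y z by (blast intro: cmat.span_add cmat.span_scale)
  qed
  fix v assume "v \<in> S"
  obtain p where "p \<noteq> 0" "poly_apply f p v = 0" using annihilating_poly[OF f] by blast
  with \<open>v \<in> S\<close> show "v \<in> cmat.span ?X"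
  proof (induction "degree p" arbitrary: p v)
    case 0
    then obtain a where "p = [:a:]" by (metis degree_eq_zeroE)
    with 0 show ?case by (simp add: poly_apply_def cmat.span_zero)
  next
    case (Suc n)
    then have "\<not> constant (poly p)" by (simp add: constant_degree)
    then obtain \<mu> where "poly p \<mu> = 0" using fundamental_theorem_of_algebra by blast
    then obtain q where q: "p = [:- \<mu>, 1:] * q" by (metis poly_eq_0_iff_dvd dvdE)
    with Suc.prems have "q \<noteq> 0" by auto
    then have n: "n = degree q" using Suc.hyps(2) unfolding q by (subst (asm) degree_mult_eq) auto
    let ?w = "f v - mscale \<mu> v"
    have "poly_apply f q ?w = f (poly_apply f q v) - mscale \<mu> (poly_apply f q v)"
      by (simp add: poly_apply_def clinear_simps[OF clinear_funpow[OF f]] clinear_simps[OF f]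
          sum_subtractf cmat.scale_sum_right cscale_simps mult.commute funpow_swap1)
    also have "\<dots> = 0"
      using Suc.prems(3) by (simp only: q poly_apply_linear_factor[OF f])
    finally have "?w \<in> cmat.span ?X"
      using Suc.prems(1) st S \<open>q \<noteq> 0\<close> n
      by (intro Suc.hyps(1)) (auto intro: cmat.subspace_diff cmat.subspace_scale)
    from approx[OF this, of \<mu>] obtain y where y: "y \<in> cmat.span ?X" "f y - mscale \<mu> y - ?w \<in> gen_eigenspace f \<mu>"
      by blast
    let ?g = "\<lambda>w. f w - mscale \<mu> w"
    have "?g (y - v) = f y - mscale \<mu> y - ?w" by (simp add: clinear_simps[OF f] cscale_simps algebra_simps)
    with y obtain k where "(?g ^^ k) (?g (y - v)) = 0" by (auto simp: gen_eigenspace_def)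
    then have "(?g ^^ Suc k) (y - v) = 0" unfolding funpow_Suc_zero_iff .
    then have "y - v \<in> gen_eigenspace f \<mu>" unfolding gen_eigenspace_def by blast
    moreover have "y - v \<in> S" using y XS Suc.prems(1) S by (blast intro: cmat.subspace_diff)
    ultimately have "y - v \<in> cmat.span ?X" by (auto intro: cmat.span_base)
    then have "y - (y - v) \<in> cmat.span ?X" using y by (blast intro: cmat.span_diff)
    then show ?case by simp
  qed
qed

lemma primary_decomposition_sum:
  assumes f: "clinear f" and S: "cmat.subspace S" and st: "f ` S \<subseteq> S" and "v \<in> S"
  shows "\<exists>\<Lambda> c. finite \<Lambda> \<and> (\<forall>\<mu>. c \<mu> \<in> S \<inter> gen_eigenspace f \<mu>) \<and> v = (\<Sum>\<mu>\<in>\<Lambda>. c \<mu>)"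
proof (rule span_UN_subspaces)
  show "cmat.subspace (S \<inter> gen_eigenspace f \<mu>)" for \<mu>
    by (rule cmat.subspace_inter[OF S subspace_gen_eigenspace[OF f]])
  show "v \<in> cmat.span (\<Union>\<mu>. S \<inter> gen_eigenspace f \<mu>)"
    using primary_decomposition[OF f S st] \<open>v \<in> S\<close> by blast
qed

section \<open>Traces of nilpotent and idempotent matrices\<close>

text \<open>Polynomial functions of one variable are kept as functions: they arise by composing polynomials in
  matrix entries with curves of matrices, where no polynomial is given explicitly.\<close>

definition polyfun :: "(complex \<Rightarrow> complex) \<Rightarrow> bool"
  where "polyfun F \<longleftrightarrow> (\<exists>p. \<forall>t. F t = poly p t)"

lemma polyfun_const [intro]: "polyfun (\<lambda>t. c)"
  unfolding polyfun_def by (rule exI[of _ "[:c:]"]) simp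

lemma polyfun_id [intro]: "polyfun (\<lambda>t. t)"
  unfolding polyfun_def by (rule exI[of _ "[:0, 1:]"]) simp

lemma polyfun_add [intro]: "polyfun F \<Longrightarrow> polyfun G \<Longrightarrow> polyfun (\<lambda>t. F t + G t)"
  unfolding polyfun_def by (metis poly_add)

lemma polyfun_diff [intro]: "polyfun F \<Longrightarrow> polyfun G \<Longrightarrow> polyfun (\<lambda>t. F t - G t)"
  unfolding polyfun_def by (metis poly_diff)

lemma polyfun_mult [intro]: "polyfun F \<Longrightarrow> polyfun G \<Longrightarrow> polyfun (\<lambda>t. F t * G t)"
  unfolding polyfun_def by (metis poly_mult)

lemma polyfun_sum [intro]: "(\<And>a. a \<in> A \<Longrightarrow> polyfun (F a)) \<Longrightarrow> polyfun (\<lambda>t. \<Sum>a\<in>A. F a t)"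
  by (induction A rule: infinite_finite_induct) auto

lemma polyfun_prod [intro]: "(\<And>a. a \<in> A \<Longrightarrow> polyfun (F a)) \<Longrightarrow> polyfun (\<lambda>t. \<Prod>a\<in>A. F a t)"
  by (induction A rule: infinite_finite_induct) auto

lemma polyfun_det:
  assumes "\<And>i j. polyfun (\<lambda>t. M t $ i $ j)"
  shows "polyfun (\<lambda>t. det (M t))"
  unfolding det_def using assms by (intro polyfun_sum polyfun_mult polyfun_const polyfun_prod)

lemma polyfun_no_zero_const:
  assumes "polyfun F" "\<And>t. F t \<noteq> 0" shows "F t = F s"
  using assms fundamental_theorem_of_algebra by (metis constant_def polyfun_def)

lemma polyfun_vanishing:
  assumes "polyfun F" "infinite {t. F t = 0}" shows "F t = 0"
  using assms poly_roots_finite by (metis (no_types, lifting) Collect_cong poly_0 polyfun_def)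

lemma polyfun_both_nonzero:
  assumes "polyfun F" "polyfun G" "F s \<noteq> 0" "G t \<noteq> 0" shows "\<exists>u. F u \<noteq> 0 \<and> G u \<noteq> 0"
proof (rule ccontr)
  assume "\<not> ?thesis"
  then have "UNIV = {t. F t = 0} \<union> {t. G t = 0}" by blast
  moreover have "finite {t. F t = 0}" "finite {t. G t = 0}"
    using polyfun_vanishing assms by blast+
  ultimately show False using infinite_UNIV_char_0 by (metis finite_UnI)
qed

lemma has_field_derivative_prod:
  fixes F :: "'i \<Rightarrow> complex \<Rightarrow> complex"
  assumes "finite A" "\<And>i. i \<in> A \<Longrightarrow> (F i has_field_derivative F' i) (at t)"
  shows "((\<lambda>t. \<Prod>i\<in>A. F i t) has_field_derivative (\<Sum>i\<in>A. F' i * (\<Prod>j\<in>A - {i}. F j t))) (at t)"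
  using assms
proof (induction A rule: finite_induct)
  case (insert a A)
  have eq: "(\<Prod>j\<in>insert a A - {i}. F j t) = F a t * (\<Prod>j\<in>A - {i}. F j t)" if "i \<in> A" for i
  proof -
    have "insert a A - {i} = insert a (A - {i})" using that insert.hyps by auto
    then show ?thesis using insert.hyps by simp
  qed
  have "((\<lambda>t. F a t * (\<Prod>i\<in>A. F i t)) has_field_derivative
      (F a t * (\<Sum>i\<in>A. F' i * (\<Prod>j\<in>A - {i}. F j t)) + F' a * (\<Prod>i\<in>A. F i t))) (at t)"
    using insert by (intro DERIV_mult') auto
  moreover have "F a t * (\<Sum>i\<in>A. F' i * (\<Prod>j\<in>A - {i}. F j t)) + F' a * (\<Prod>i\<in>A. F i t)
      = (\<Sum>i\<in>insert a A. F' i * (\<Prod>j\<in>insert a A - {i}. F j t))"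
    using insert.hyps eq by (simp add: sum_distrib_left mult_ac cong: sum.cong)
  ultimately show ?case using insert.hyps by simp
qed simp

lemma mat_1_nth: "mat 1 $ i $ j = (if i = j then 1 else 0)"
  by (simp add: mat_def)

text \<open>In the Leibniz formula a permutation other than the identity moves at least two indices. Its product
  therefore has two factors vanishing at \<open>0\<close> and contributes nothing to the derivative.\<close>

lemma det_derivative_at_one:
  fixes M :: "'n::finite cmat"
  shows "((\<lambda>t. det (mat 1 + mscale t M)) has_field_derivative trace M) (at 0)"
proof -
  let ?F = "\<lambda>p i t. (mat 1 + mscale t M) $ i $ (p i)"
  have d: "((\<lambda>t. \<Prod>i\<in>UNIV. ?F p i t) has_field_derivative
      (\<Sum>i\<in>UNIV. M $ i $ p i * (\<Prod>j\<in>UNIV - {i}. ?F p j 0))) (at 0)" for p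
    by (rule has_field_derivative_prod) (auto intro!: derivative_eq_intros)
  have z: "(\<Sum>i\<in>UNIV. M $ i $ p i * (\<Prod>j\<in>UNIV - {i}. ?F p j 0)) = (if p = id then trace M else 0)"
    if p: "p permutes (UNIV :: 'n set)" for p
  proof (cases "p = id")
    case True
    then show ?thesis by (simp add: trace_def mat_1_nth)
  next
    case False
    then obtain a where a: "p a \<noteq> a" by (auto simp: fun_eq_iff)
    have pa: "p (p a) \<noteq> p a" using a p by (metis permutes_def)
    have zero: "(\<Prod>j\<in>UNIV - {i}. ?F p j 0) = 0" for i
    proof (rule prod_zero)
      show "\<exists>j\<in>UNIV - {i}. ?F p j 0 = 0"
        using a pa by (cases "i = a") (auto simp: mat_1_nth intro: bexI[of _ "p a"] bexI[of _ a])
    qed simp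
    show ?thesis unfolding zero using False by simp
  qed
  have "((\<lambda>t. \<Sum>p\<in>{p. p permutes (UNIV :: 'n set)}. of_int (sign p) * (\<Prod>i\<in>UNIV. ?F p i t))
     has_field_derivative (\<Sum>p\<in>{p. p permutes (UNIV :: 'n set)}. of_int (sign p) *
        (\<Sum>i\<in>UNIV. M $ i $ p i * (\<Prod>j\<in>UNIV - {i}. ?F p j 0)))) (at 0)"
    by (intro DERIV_sum DERIV_cmult d)
  also have "(\<Sum>p\<in>{p. p permutes (UNIV :: 'n set)}. of_int (sign p) *
        (\<Sum>i\<in>UNIV. M $ i $ p i * (\<Prod>j\<in>UNIV - {i}. ?F p j 0)))
      = (\<Sum>p\<in>{p. p permutes (UNIV :: 'n set)}. if p = id then trace M else 0)"
    by (intro sum.cong refl) (simp only: mem_Collect_eq z, auto simp: sign_id)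
  also have "\<dots> = trace M" by (simp add: permutes_id)
  finally show ?thesis unfolding det_def .
qed

definition nilpotent_mat :: "'n::finite cmat \<Rightarrow> bool"
  where "nilpotent_mat N \<longleftrightarrow> (\<exists>k. (((**) N) ^^ k) (mat 1) = 0)"

lemma mult_funpow_mult:
  fixes N Y Z :: "'n::finite cmat"
  shows "(((**) N) ^^ k) (Y ** Z) = ((((**) N) ^^ k) Y) ** Z"
proof (induction k)
  case (Suc k)
  then show ?case by (simp add: matrix_mul_assoc)
qed simp

lemma nilpotent_mat_iff:
  fixes N :: "'n::finite cmat"
  shows "nilpotent_mat N \<longleftrightarrow> (\<exists>k. \<forall>Y :: 'n cmat. (((**) N) ^^ k) Y = 0)"
proof
  assume "nilpotent_mat N"
  then obtain k where k: "(((**) N) ^^ k) (mat 1) = 0" by (auto simp: nilpotent_mat_def)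
  have "(((**) N) ^^ k) Y = 0" for Y :: "'n cmat"
    using mult_funpow_mult[of k N "mat 1" Y] by (simp add: k matrix_zero_mult)
  then show "\<exists>k. \<forall>Y :: 'n cmat. (((**) N) ^^ k) Y = 0" by (intro exI[of _ k] allI)
qed (auto simp: nilpotent_mat_def)

lemma nilpotent_mscale: "nilpotent_mat N \<Longrightarrow> nilpotent_mat (mscale c N)"
proof -
  have "(((**) (mscale c N)) ^^ k) Y = mscale (c ^ k) ((((**) N) ^^ k) Y)" for k and Y :: "'a cmat"
    by (induction k) (simp_all add: mscale_mult)
  then show "nilpotent_mat N \<Longrightarrow> nilpotent_mat (mscale c N)" by (auto simp: nilpotent_mat_def)
qed

text \<open>The equation \<open>(1 + N) Z = Y\<close> is solved by \<open>Z = Y - Z'\<close> where \<open>(1 + N) Z' = N Y\<close>; this recursion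
  stops because \<open>N\<close> is nilpotent.\<close>

lemma invertible_one_plus_nilpotent:
  assumes "nilpotent_mat (N :: 'n::finite cmat)" shows "invertible (mat 1 + N)"
proof -
  have "\<exists>Z. (mat 1 + N) ** Z = Y" if "(((**) N) ^^ k) Y = 0" for k and Y :: "'n cmat"
    using that
  proof (induction k arbitrary: Y)
    case 0
    then show ?case by (auto intro: exI[of _ 0] simp: matrix_zero_mult)
  next
    case (Suc k)
    then obtain Z where Z: "(mat 1 + N) ** Z = N ** Y"
      unfolding funpow_Suc_zero_iff by blast
    have "(mat 1 + N) ** (Y - Z) = Y"
      by (simp add: matrix_diff_distrib(2) Z) (simp add: mat_simps)
    then show ?case by blast
  qed
  then have "\<exists>Z. (mat 1 + N) ** Z = mat 1" using assms by (auto simp: nilpotent_mat_def)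
  then show ?thesis by (simp add: invertible_right_inverse)
qed

text \<open>The polynomial \<open>det (1 + t N)\<close> has no zero, hence is constant, and its derivative at \<open>0\<close> is the trace.\<close>

lemma trace_nilpotent:
  assumes "nilpotent_mat N" shows "trace N = 0"
proof -
  let ?F = "\<lambda>t. det (mat 1 + mscale t N)"
  have "polyfun ?F"
    by (rule polyfun_det, simp, intro polyfun_add polyfun_mult polyfun_const polyfun_id)
  moreover have "?F t \<noteq> 0" for t
    using invertible_one_plus_nilpotent[OF nilpotent_mscale[OF assms]] by (simp add: invertible_det_nz)
  ultimately have "?F t = ?F 0" for t by (rule polyfun_no_zero_const)
  then have "?F = (\<lambda>t. ?F 0)" by blast
  then show ?thesis
    using det_derivative_at_one[of N] by (metis DERIV_const DERIV_unique)
qed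

text \<open>The polynomial \<open>q u = det (1 + (u - 1) P)\<close> is multiplicative in \<open>u\<close>, so its only possible zero is
  \<open>0\<close> and it is a power \<open>u ^ m\<close>. Its derivative at \<open>1\<close> is both \<open>m\<close> and the trace of \<open>P\<close>; the number
  \<open>m\<close> is the rank of \<open>P\<close>.\<close>

lemma trace_idempotent:
  fixes P :: "'n::finite cmat"
  assumes P: "P ** P = P"
  shows "\<exists>m. trace P = of_nat m \<and> (m = 0 \<longrightarrow> P = 0)"
proof -
  define q where "q u = det (mat 1 + mscale (u - 1) P)" for u
  have mult: "q u * q v = q (u * v)" for u v
  proof -
    have "(mat 1 + mscale (u - 1) P) ** (mat 1 + mscale (v - 1) P)
        = mat 1 + mscale (u - 1) P + mscale (v - 1) P + mscale ((u - 1) * (v - 1)) P"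
      by (simp add: mat_simps P algebra_simps)
    also have "\<dots> = mat 1 + mscale (u * v - 1) P"
      by (simp add: cscale_simps algebra_simps)
    finally show ?thesis unfolding q_def by (metis det_mul)
  qed
  have q1: "q 1 = 1" by (simp add: q_def)
  have "polyfun q" unfolding q_def
    by (rule polyfun_det, simp, intro polyfun_add polyfun_mult polyfun_diff polyfun_const polyfun_id)
  then obtain p where p: "\<And>u. q u = poly p u" unfolding polyfun_def by blast
  have nz: "poly p u \<noteq> 0" if "u \<noteq> 0" for u
    using mult[of u "1 / u"] that q1 by (auto simp: p)
  have "p \<noteq> 0" using nz[of 1] by auto
  then obtain m r where r: "p = [:- 0, 1:] ^ m * r" "\<not> [:- 0, 1:] dvd r"
    using order_decomp[of p 0] by blast
  have "poly r u \<noteq> 0" for u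
  proof (cases "u = 0")
    case True
    then show ?thesis using r(2) by (metis poly_eq_0_iff_dvd)
  next
    case False
    then have "poly ([:- 0, 1:] ^ m * r) u \<noteq> 0" using nz[of u] r(1) by argo
    then show ?thesis by (simp add: poly_mult)
  qed
  then have "poly r u = poly r 1" for u
    by (rule polyfun_no_zero_const[rotated]) (auto simp: polyfun_def)
  then have pu: "poly p u = u ^ m * poly r 1" for u
    using arg_cong[OF r(1), of "\<lambda>p. poly p u"] by (simp add: poly_power)
  have "poly r 1 = 1" using pu[of 1] q1 p[of 1] by simp
  with pu have qu: "q u = u ^ m" for u by (simp add: p)
  have "((\<lambda>t. det (mat 1 + mscale t P)) has_field_derivative trace P) (at 0)"
    by (rule det_derivative_at_one)
  also have "(\<lambda>t. det (mat 1 + mscale t P)) = (\<lambda>t. (t + 1) ^ m)"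
  proof
    fix t show "det (mat 1 + mscale t P) = (t + 1) ^ m"
      using qu[of "t + 1"] by (simp add: q_def)
  qed
  finally have "((\<lambda>t. (t + 1) ^ m) has_field_derivative trace P) (at 0)" .
  moreover have "((\<lambda>t. (t + 1) ^ m) has_field_derivative of_nat m) (at (0::complex))"
    by (auto intro!: derivative_eq_intros)
  ultimately have "trace P = of_nat m" by (rule DERIV_unique)
  moreover have "P = 0" if "m = 0"
  proof -
    have "q 0 = 1" using qu[of 0] that by simp
    then have "invertible (mat 1 - P)" by (simp add: q_def invertible_det_nz)
    then obtain B where "(mat 1 - P) ** B = mat 1" by (auto simp: invertible_def)
    moreover have "P ** (mat 1 - P) = 0" by (simp add: mat_simps P)
    ultimately show ?thesis by (metis matrix_mul_assoc matrix_mul_rid matrix_zero_mult(1))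
  qed
  ultimately show ?thesis by blast
qed

lemma trace_simps:
  "trace (X + Y) = trace X + trace (Y :: 'n::finite cmat)" "trace (X - Y) = trace X - trace Y"
  "trace (mscale c X) = c * trace X" "trace (0 :: 'n cmat) = 0"
  "trace (sum f A) = (\<Sum>a\<in>A. trace (f a :: 'n cmat))"
  by (simp_all add: trace_def sum.distrib sum_subtractf sum_distrib_left sum_nth2)
    (rule sum.swap)

lemma trace_bracket: "trace (bracket a b ** c) = trace (b ** bracket c a)"
  "trace (bracket a b ** c) = trace (a ** bracket b c)"
proof -
  have "trace (a ** b ** c) = trace (b ** (c ** a))" "trace (b ** a ** c) = trace (b ** (a ** c))"
    "trace (b ** a ** c) = trace (a ** (c ** b))"
    by (metis matrix_mul_assoc trace_mul_sym)+
  then show "trace (bracket a b ** c) = trace (b ** bracket c a)"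
    "trace (bracket a b ** c) = trace (a ** bracket b c)"
    by (simp_all add: bracket_def mat_simps trace_simps)
qed

lemma gen_eigenspace_mult_right:
  fixes x Y Z :: "'n::finite cmat"
  assumes "Y \<in> gen_eigenspace ((**) x) \<mu>"
  shows "Y ** Z \<in> gen_eigenspace ((**) x) \<mu>"
proof -
  have pow: "((\<lambda>w. x ** w - mscale \<mu> w) ^^ k) (Y ** Z) = ((\<lambda>w. x ** w - mscale \<mu> w) ^^ k) Y ** Z" for k
    by (induction k) (simp_all add: mat_simps)
  from assms obtain k where "((\<lambda>w. x ** w - mscale \<mu> w) ^^ k) Y = 0"
    unfolding gen_eigenspace_def by blast
  then have "((\<lambda>w. x ** w - mscale \<mu> w) ^^ k) (Y ** Z) = 0"
    unfolding pow by (simp only: matrix_zero_mult(1))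
  then show ?thesis unfolding gen_eigenspace_def by blast
qed

text \<open>Left multiplication by \<open>x\<close> satisfies \<open>x (a Y) = [x, a] Y + a (x Y)\<close>, so an element of \<open>ad x\<close>-weight
  \<open>\<mu>\<close> raises the eigenvalue by \<open>\<mu>\<close>.\<close>

lemma gen_eigenspace_bracket_mult:
  assumes "a \<in> gen_eigenspace (bracket x) \<mu>" "Y \<in> gen_eigenspace ((**) x) \<nu>"
  shows "a ** Y \<in> gen_eigenspace ((**) x) (\<nu> + \<mu>)"
proof -
  from assms obtain m k where "((\<lambda>w. bracket x w - mscale \<mu> w) ^^ m) a = 0"
    "((\<lambda>w. x ** w - mscale \<nu> w) ^^ k) Y = 0" by (auto simp: gen_eigenspace_def)
  then have "((\<lambda>w. x ** w - mscale (\<nu> + \<mu>) w) ^^ (m + k)) (a ** Y) = 0"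
    by (rule leibniz_nilpotent[OF clinear_shift[OF clinear_mult_left], rotated 3])
      (auto simp: mat_simps bracket_def cscale_simps)
  then show ?thesis by (auto simp: gen_eigenspace_def)
qed

text \<open>The matrix \<open>D\<close> acts on each generalized eigenspace of \<open>x\<close> by the complex conjugate of the eigenvalue.
  Since conjugation is additive, \<open>ad D\<close> acts on the generalized eigenspace of \<open>ad x\<close> for \<open>\<mu>\<close> by
  \<open>cnj \<mu>\<close>; in particular \<open>ad D\<close> preserves every subspace stable under \<open>ad x\<close>. The trace of \<open>x D\<close> is
  the sum of the squared absolute values of the eigenvalues with multiplicity, so it detects
  nilpotency. This is the element that drives Cartan's criterion.\<close>

lemma nilpotency_test_element:
  fixes x :: "'n::finite cmat"
  shows "\<exists>D. (\<forall>\<mu> a. a \<in> gen_eigenspace (bracket x) \<mu> \<longrightarrow> bracket D a = mscale (cnj \<mu>) a) \<and>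
    (trace (x ** D) = 0 \<longrightarrow> nilpotent_mat x)"
proof -
  note f = clinear_mult_left[of x]
  obtain \<Lambda> P0 where L: "finite \<Lambda>" and P0: "\<And>\<mu>. P0 \<mu> \<in> gen_eigenspace ((**) x) \<mu>"
    "mat 1 = (\<Sum>\<mu>\<in>\<Lambda>. P0 \<mu>)"
    using primary_decomposition_sum[OF f cmat.subspace_UNIV, of "mat 1"] by auto
  \<comment> \<open>The components of the identity matrix are the spectral projections of \<open>x\<close>.\<close>
  define P where "P \<mu> = (if \<mu> \<in> \<Lambda> then P0 \<mu> else 0)" for \<mu>
  have PE: "P \<mu> \<in> gen_eigenspace ((**) x) \<mu>" for \<mu>
    using P0(1) cmat.subspace_0[OF subspace_gen_eigenspace[OF f]] by (simp add: P_def)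
  have one: "mat 1 = (\<Sum>\<mu>\<in>\<Lambda>. P \<mu>)" using P0(2) by (simp add: P_def)
  have proj: "P \<mu> ** Y = (if \<mu> = \<nu> then Y else 0)" if Y: "Y \<in> gen_eigenspace ((**) x) \<nu>" for \<mu> \<nu> Y
  proof (cases "\<mu> \<in> insert \<nu> \<Lambda>")
    case False
    then show ?thesis by (auto simp: P_def matrix_zero_mult)
  next
    case True
    define c where "c \<mu> = P \<mu> ** Y - (if \<mu> = \<nu> then Y else 0)" for \<mu>
    have "c \<mu> = 0"
    proof (rule gen_eigenspace_independent[OF f, of "insert \<nu> \<Lambda>"])
      show "c \<mu> \<in> gen_eigenspace ((**) x) \<mu>" for \<mu>
        unfolding c_def using Y gen_eigenspace_mult_right[OF PE]
          cmat.subspace_0[OF subspace_gen_eigenspace[OF f]]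
        by (auto intro!: cmat.subspace_diff[OF subspace_gen_eigenspace[OF f]])
      have "(\<Sum>\<mu>\<in>insert \<nu> \<Lambda>. P \<mu> ** Y) = (\<Sum>\<mu>\<in>\<Lambda>. P \<mu> ** Y)"
        by (rule sum.mono_neutral_right) (use L in \<open>auto simp: P_def matrix_zero_mult\<close>)
      also have "\<dots> = Y" by (simp add: matrix_sum_distrib(1)[symmetric] one[symmetric])
      finally show "(\<Sum>\<mu>\<in>insert \<nu> \<Lambda>. c \<mu>) = 0"
        unfolding c_def sum_subtractf using L by simp
    qed (use L True in auto)
    then show ?thesis by (simp add: c_def)
  qed
  define D where "D = (\<Sum>\<mu>\<in>\<Lambda>. mscale (cnj \<mu>) (P \<mu>))"
  have DY: "D ** Y = mscale (cnj \<nu>) Y" if "Y \<in> gen_eigenspace ((**) x) \<nu>" for \<nu> Y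
  proof -
    have "D ** Y = (\<Sum>\<mu>\<in>\<Lambda>. mscale (cnj \<nu>) (P \<mu> ** Y))"
      unfolding D_def matrix_sum_distrib(1)
      by (rule sum.cong) (auto simp: mscale_mult proj[OF that])
    also have "\<dots> = mscale (cnj \<nu>) ((\<Sum>\<mu>\<in>\<Lambda>. P \<mu>) ** Y)"
      by (simp add: matrix_sum_distrib(1) cmat.scale_sum_right)
    finally show ?thesis by (simp add: one[symmetric])
  qed
  have "bracket D a = mscale (cnj \<mu>) a" if a: "a \<in> gen_eigenspace (bracket x) \<mu>" for \<mu> a
  proof -
    have aa: "a = (\<Sum>\<nu>\<in>\<Lambda>. a ** P \<nu>)"
      by (simp add: matrix_sum_distrib(2)[symmetric] one[symmetric])
    have "D ** a = (\<Sum>\<nu>\<in>\<Lambda>. D ** (a ** P \<nu>))"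
      by (subst aa) (simp add: matrix_sum_distrib(2))
    also have "\<dots> = (\<Sum>\<nu>\<in>\<Lambda>. mscale (cnj (\<nu> + \<mu>)) (a ** P \<nu>))"
      using DY[OF gen_eigenspace_bracket_mult[OF a PE]] by simp
    also have "\<dots> = a ** D + mscale (cnj \<mu>) (\<Sum>\<nu>\<in>\<Lambda>. a ** P \<nu>)"
      by (simp add: D_def matrix_sum_distrib(2) cscale_simps sum.distrib mscale_mult cmat.scale_sum_right)
    finally show ?thesis by (simp add: bracket_def aa[symmetric])
  qed
  moreover have "nilpotent_mat x" if tr: "trace (x ** D) = 0"
  proof -
    have "P \<mu> ** P \<mu> = P \<mu>" for \<mu> using proj[OF PE] by simp
    then have "\<forall>\<mu>. \<exists>m. trace (P \<mu>) = of_nat m \<and> (m = 0 \<longrightarrow> P \<mu> = 0)"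
      using trace_idempotent by blast
    then obtain m where m: "\<And>\<mu>. trace (P \<mu>) = of_nat (m \<mu>)" "\<And>\<mu>. m \<mu> = 0 \<Longrightarrow> P \<mu> = 0"
      by metis
    have trP: "trace (x ** P \<mu>) = \<mu> * of_nat (m \<mu>)" for \<mu>
    proof -
      let ?g = "\<lambda>w. x ** w - mscale \<mu> w"
      \<comment> \<open>On the image of \<open>P \<mu>\<close>, \<open>x\<close> is \<open>\<mu>\<close> plus a nilpotent part, whose trace vanishes.\<close>
      define N where "N = ?g (P \<mu>)"
      have st: "(?g ^^ k) (P \<mu>) \<in> gen_eigenspace ((**) x) \<mu>" for k
        by (induction k) (auto intro: PE gen_eigenspace_stable[OF f])
      have N: "N ** Y = ?g Y" if "Y \<in> gen_eigenspace ((**) x) \<mu>" for Y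
      proof -
        have "N ** Y = ?g (P \<mu> ** Y)" by (simp add: N_def mat_simps)
        then show ?thesis using proj[OF that, of \<mu>] by simp
      qed
      have "(((**) N) ^^ Suc k) (mat 1) = (?g ^^ Suc k) (P \<mu>)" for k
      proof (induction k)
        case (Suc k)
        show ?case using N[OF st[of "Suc k"]] Suc by simp
      qed (simp add: N_def)
      moreover obtain k where k: "(?g ^^ k) (P \<mu>) = 0" using PE[of \<mu>] by (auto simp: gen_eigenspace_def)
      ultimately have "(((**) N) ^^ Suc k) (mat 1) = 0"
        by (simp add: matrix_zero_mult)
      then have "trace N = 0" by (intro trace_nilpotent) (auto simp: nilpotent_mat_def simp del: funpow.simps)
      then show ?thesis using m(1)[of \<mu>] by (simp add: N_def trace_simps)
    qed
    have "complex_of_real ((cmod \<mu>)\<^sup>2 * real (m \<mu>)) = cnj \<mu> * (\<mu> * of_nat (m \<mu>))" for \<mu>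
      by (simp only: of_real_mult complex_norm_square of_real_of_nat_eq mult_ac)
    then have "(\<Sum>\<mu>\<in>\<Lambda>. complex_of_real ((cmod \<mu>)\<^sup>2 * real (m \<mu>))) = trace (x ** D)"
      by (simp only: D_def matrix_sum_distrib(2) mscale_mult trace_simps trP)
    then have "complex_of_real (\<Sum>\<mu>\<in>\<Lambda>. (cmod \<mu>)\<^sup>2 * real (m \<mu>)) = 0"
      by (simp only: of_real_sum tr)
    then have "(\<Sum>\<mu>\<in>\<Lambda>. (cmod \<mu>)\<^sup>2 * real (m \<mu>)) = 0" by (simp only: of_real_eq_0_iff)
    then have "\<forall>\<mu>\<in>\<Lambda>. (cmod \<mu>)\<^sup>2 * real (m \<mu>) = 0"
      using L by (subst (asm) sum_nonneg_eq_0_iff) auto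
    then have "P \<mu> = 0" if "\<mu> \<noteq> 0" for \<mu>
      using m(2)[of \<mu>] that by (cases "\<mu> \<in> \<Lambda>") (auto simp: P_def)
    then have "mat 1 = (\<Sum>\<mu>\<in>\<Lambda>. if \<mu> = 0 then P 0 else 0)"
      unfolding one by (intro sum.cong) auto
    then have "mat 1 = P 0" using L by (auto simp: P_def)
    with PE[of 0] show ?thesis by (auto simp: gen_eigenspace_def nilpotent_mat_def)
  qed
  ultimately show ?thesis by blast
qed

section \<open>Engel's theorem\<close>

definition bracket_closed :: "'n::finite cmat set \<Rightarrow> bool"
  where "bracket_closed L \<longleftrightarrow> cmat.subspace L \<and> (\<forall>x\<in>L. \<forall>y\<in>L. bracket x y \<in> L)"

text \<open>All representations needed below can be carried by the space of matrices itself: left multiplication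
  stands for the natural representation (repeated once per column), and the bracket for the adjoint
  one.\<close>

definition lie_action :: "('n::finite cmat \<Rightarrow> 'n cmat \<Rightarrow> 'n cmat) \<Rightarrow> bool"
  where "lie_action act \<longleftrightarrow> (\<forall>x. clinear (act x)) \<and> (\<forall>v. clinear (\<lambda>x. act x v)) \<and>
    (\<forall>x y v. act (bracket x y) v = act x (act y v) - act y (act x v))"

lemma lie_action_mult: "lie_action (**)"
  by (auto simp: lie_action_def clinear_mult_left clinear_mult_right bracket_def mat_simps)

lemma lie_action_bracket: "lie_action bracket"
proof -
  have "bracket (bracket x y) v = bracket x (bracket y v) - bracket y (bracket x v)" for x y v :: "'a cmat"
    by (simp add: bracket_jacobi[of x y v])
  then show ?thesis by (auto simp: lie_action_def clinear_bracket clinear_bracket_left)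
qed

lemma subspace_psubset_dim:
  "cmat.subspace M \<Longrightarrow> cmat.subspace L \<Longrightarrow> M \<subset> L \<Longrightarrow> cmat.dim M < cmat.dim L"
  using cfd.dim_psubset[of M L] by (simp add: cmat.span_eq_iff[THEN iffD2])

text \<open>A relative form of Engel's theorem: the quotient \<open>S / T\<close> on which \<open>L\<close> acts nilpotently is never
  formed. A proper subalgebra \<open>M\<close> of maximal dimension acts nilpotently on \<open>L / M\<close>, so by induction
  some \<open>y\<close> outside \<open>M\<close> normalizes \<open>M\<close>; by maximality \<open>L = M + \<complex> y\<close>. By induction again \<open>M\<close> kills a
  nonzero vector of \<open>S / T\<close>, the vectors killed by \<open>M\<close> are stable under \<open>y\<close>, and the last nonzero
  iterate of \<open>y\<close> on such a vector is killed by all of \<open>L\<close>. The hypothesis that \<open>L\<close> is ad-nilpotent is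
  what permits the first induction for actions that are not faithful.\<close>

theorem engel:
  assumes "bracket_closed L" and "\<forall>x\<in>L. \<forall>y\<in>L. \<exists>k. (bracket x ^^ k) y = 0"
    and "lie_action act" and "cmat.subspace S" "cmat.subspace T" "T \<subset> S"
    and "\<forall>x\<in>L. act x ` S \<subseteq> S" "\<forall>x\<in>L. act x ` T \<subseteq> T"
    and "\<forall>x\<in>L. \<forall>v\<in>S. \<exists>k. (act x ^^ k) v \<in> T"
  shows "\<exists>v\<in>S - T. \<forall>x\<in>L. act x v \<in> T"
  using assms
proof (induction "cmat.dim L" arbitrary: L act S T rule: less_induct)
  case less
  note L = less.prems(1) and ad = less.prems(2) and act = less.prems(3)
    and S = less.prems(4) and T = less.prems(5) and TS = less.prems(6)
    and LS = less.prems(7) and LT = less.prems(8) and nil = less.prems(9)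
  have lin: "clinear (act x)" "clinear (\<lambda>x. act x v)"
    and rep: "act (bracket x y) v = act x (act y v) - act y (act x v)" for x y v
    using act by (auto simp: lie_action_def)
  have subL: "cmat.subspace L" and cl: "\<And>x y. x \<in> L \<Longrightarrow> y \<in> L \<Longrightarrow> bracket x y \<in> L"
    using L by (auto simp: bracket_closed_def)
  show ?case
  proof (cases "L \<subseteq> {0}")
    case True
    obtain v where "v \<in> S - T" using TS by blast
    moreover have "act x v \<in> T" if "x \<in> L" for x
      using True that cmat.subspace_0[OF T] clinear_simps(3)[OF lin(2)] by auto
    ultimately show ?thesis by blast
  next
    case False
    define Pr where "Pr M \<longleftrightarrow> bracket_closed M \<and> M \<subset> L" for M
    have "Pr {0}"
      using False cmat.subspace_0[OF subL] by (auto simp: Pr_def bracket_closed_def bracket_simps cmat.subspace_single_0)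
    moreover have "\<forall>M. Pr M \<longrightarrow> cmat.dim M < Suc (cmat.dim L)"
      by (auto simp: Pr_def less_Suc_eq_le intro: cfd.dim_subset)
    ultimately have "\<exists>M. Pr M \<and> (\<forall>M'. Pr M' \<longrightarrow> cmat.dim M' \<le> cmat.dim M)"
      by (rule ex_has_greatest_nat)
    then obtain M where M: "Pr M" and max: "\<And>M'. Pr M' \<Longrightarrow> cmat.dim M' \<le> cmat.dim M"
      by blast
    have subM: "cmat.subspace M" and clM: "\<And>x y. x \<in> M \<Longrightarrow> y \<in> M \<Longrightarrow> bracket x y \<in> M"
      and MsubL: "M \<subset> L" and bM: "bracket_closed M"
      using M by (auto simp: Pr_def bracket_closed_def)
    have dimM: "cmat.dim M < cmat.dim L" by (rule subspace_psubset_dim[OF subM subL MsubL])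
    have "\<exists>v\<in>L - M. \<forall>x\<in>M. bracket x v \<in> M"
    proof (rule less.hyps[OF dimM bM _ lie_action_bracket subL subM MsubL])
      show "\<forall>x\<in>M. \<forall>y\<in>M. \<exists>k. (bracket x ^^ k) y = 0" using ad MsubL by blast
      show "\<forall>x\<in>M. bracket x ` L \<subseteq> L" using cl MsubL by blast
      show "\<forall>x\<in>M. bracket x ` M \<subseteq> M" using clM by blast
      show "\<forall>x\<in>M. \<forall>v\<in>L. \<exists>k. (bracket x ^^ k) v \<in> M"
      proof (intro ballI)
        fix x v assume "x \<in> M" "v \<in> L"
        then obtain k where "(bracket x ^^ k) v = 0" using ad MsubL by blast
        then show "\<exists>k. (bracket x ^^ k) v \<in> M" using cmat.subspace_0[OF subM] by (intro exI[of _ k]) simp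
      qed
    qed
    then obtain y where y: "y \<in> L" "y \<notin> M" "\<And>x. x \<in> M \<Longrightarrow> bracket x y \<in> M" by blast
    define N where "N = cmat.span (insert y M)"
    have Nform: "x \<in> N \<longleftrightarrow> (\<exists>c. x - mscale c y \<in> M)" for x
      by (simp add: N_def cmat.span_insert cmat.span_eq_iff[THEN iffD2, OF subM])
    have "N \<subseteq> L" unfolding N_def using y MsubL subL by (intro cmat.span_minimal) auto
    have MN: "M \<subset> N" unfolding N_def using y by (auto intro: cmat.span_base)
    have "bracket x z \<in> N" if xz: "x \<in> N" "z \<in> N" for x z
    proof -
      from xz obtain c d where cd: "x - mscale c y \<in> M" "z - mscale d y \<in> M" by (auto simp: Nform)
      define x' z' where "x' = x - mscale c y" and "z' = z - mscale d y"
      have xz': "x = x' + mscale c y" "z = z' + mscale d y" "x' \<in> M" "z' \<in> M"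
        using cd by (simp_all add: x'_def z'_def)
      have "bracket x z = bracket x' z' + mscale d (bracket x' y) - mscale c (bracket z' y)"
        using bracket_anti[of y z'] by (simp add: xz' bracket_simps)
      also have "\<dots> \<in> M"
        using xz' y clM subM by (intro cmat.subspace_diff cmat.subspace_add cmat.subspace_scale) auto
      finally show ?thesis using MN by blast
    qed
    then have "bracket_closed N" by (simp add: bracket_closed_def N_def)
    have "N = L"
    proof (rule ccontr)
      assume "N \<noteq> L"
      then have "cmat.dim N \<le> cmat.dim M"
        using \<open>N \<subseteq> L\<close> \<open>bracket_closed N\<close> by (intro max) (auto simp: Pr_def)
      moreover have "cmat.dim M < cmat.dim N"
        using MN subM by (intro subspace_psubset_dim) (auto simp: N_def)
      ultimately show False by simp
    qed
    have "\<exists>w\<in>S - T. \<forall>x\<in>M. act x w \<in> T"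
    proof (rule less.hyps[OF dimM bM _ act S T TS])
      show "\<forall>x\<in>M. \<forall>y\<in>M. \<exists>k. (bracket x ^^ k) y = 0" using ad MsubL by blast
      show "\<forall>x\<in>M. act x ` S \<subseteq> S" by (rule ballI, rule bspec[OF LS]) (use MsubL in blast)
      show "\<forall>x\<in>M. act x ` T \<subseteq> T" by (rule ballI, rule bspec[OF LT]) (use MsubL in blast)
      show "\<forall>x\<in>M. \<forall>v\<in>S. \<exists>k. (act x ^^ k) v \<in> T"
        by (rule ballI, rule bspec[OF nil]) (use MsubL in blast)
    qed
    then obtain w where w: "w \<in> S" "w \<notin> T" "\<And>x. x \<in> M \<Longrightarrow> act x w \<in> T" by blast
    obtain k0 where "(act y ^^ k0) w \<in> T" using nil y(1) w(1) by blast
    then obtain k where k: "(act y ^^ k) w \<notin> T" "(act y ^^ Suc k) w \<in> T"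
    proof (induction k0 arbitrary: thesis)
      case 0
      then show ?case using w by simp
    next
      case (Suc k0)
      then show ?case by blast
    qed
    have inv: "(act y ^^ j) w \<in> S \<and> (\<forall>x\<in>M. act x ((act y ^^ j) w) \<in> T)" for j
    proof (induction j)
      case 0
      then show ?case using w by simp
    next
      case (Suc j)
      let ?u = "(act y ^^ j) w"
      have "act x (act y ?u) \<in> T" if x: "x \<in> M" for x
      proof -
        have "act x (act y ?u) = act (bracket x y) ?u + act y (act x ?u)" by (simp add: rep)
        also have "\<dots> \<in> T"
          using Suc x y LT by (intro cmat.subspace_add[OF T]) blast+
        finally show ?thesis .
      qed
      moreover have "act y ?u \<in> S" using Suc LS y(1) by blast
      ultimately show ?case by simp
    qed
    let ?v = "(act y ^^ k) w"
    have "act x ?v \<in> T" if "x \<in> L" for x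
    proof -
      obtain c where c: "x - mscale c y \<in> M" using \<open>x \<in> L\<close> \<open>N = L\<close> Nform by blast
      have "act x ?v = act (x - mscale c y) ?v + mscale c (act y ?v)"
        using lin(2) by (simp add: clinear_simps[OF lin(2)])
      also have "\<dots> \<in> T"
        using inv[of k] c k(2) by (intro cmat.subspace_add[OF T] cmat.subspace_scale[OF T]) auto
      finally show ?thesis .
    qed
    then show ?thesis using inv[of k] k(1) by blast
  qed
qed

section \<open>Regular functions and the Lie algebra of a linear algebraic group\<close>

lemma fun_algebra_sum:
  "(\<And>a. a \<in> A \<Longrightarrow> f a \<in> fun_algebra L) \<Longrightarrow> (\<lambda>x. \<Sum>a\<in>A. f a x) \<in> fun_algebra L"
  by (induction A rule: infinite_finite_induct) (auto intro: fun_algebra.intros)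

lemma fun_algebra_prod:
  "(\<And>a. a \<in> A \<Longrightarrow> f a \<in> fun_algebra L) \<Longrightarrow> (\<lambda>x. \<Prod>a\<in>A. f a x) \<in> fun_algebra L"
  by (induction A rule: infinite_finite_induct) (auto intro: fun_algebra.intros)

lemma fun_algebra_diff:
  assumes "f \<in> fun_algebra L" "g \<in> fun_algebra L" shows "(\<lambda>x. f x - g x) \<in> fun_algebra L"
proof -
  have "(\<lambda>x. f x + (- 1) * g x) \<in> fun_algebra L"
    by (intro fun_algebra.add fun_algebra.mult fun_algebra.const assms)
  then show ?thesis by simp
qed

lemma fun_algebra_compose:
  assumes "f \<in> fun_algebra L" and "\<And>f. f \<in> L \<Longrightarrow> (\<lambda>x. f (h x)) \<in> fun_algebra M"
  shows "(\<lambda>x. f (h x)) \<in> fun_algebra M"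
  using assms(1) by induction (auto intro: fun_algebra.intros assms(2))

lemma fun_algebra_mono: "f \<in> fun_algebra L \<Longrightarrow> L \<subseteq> M \<Longrightarrow> f \<in> fun_algebra M"
  using fun_algebra_compose[of f L "\<lambda>x. x" M] by (auto intro: fun_algebra.gen)

text \<open>The nonvanishing sets of an algebra of functions are closed under intersection, so they form a basis
  and not just a subbasis.\<close>

lemma openin_zariski:
  "openin (zariski (fun_algebra L)) S \<longleftrightarrow> (\<forall>x\<in>S. \<exists>f\<in>fun_algebra L. f x \<noteq> 0 \<and> {y. f y \<noteq> 0} \<subseteq> S)"
proof
  assume "openin (zariski (fun_algebra L)) S"
  then have "generate_topology_on {{x. f x \<noteq> 0} | f. f \<in> fun_algebra L} S"
    by (simp add: zariski_def openin_topology_generated_by_iff)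
  then show "\<forall>x\<in>S. \<exists>f\<in>fun_algebra L. f x \<noteq> 0 \<and> {y. f y \<noteq> 0} \<subseteq> S"
  proof induction
    case (Int a b)
    show ?case
    proof
      fix x assume x: "x \<in> a \<inter> b"
      obtain f g where "f \<in> fun_algebra L" "g \<in> fun_algebra L" "f x \<noteq> 0" "g x \<noteq> 0"
        "{y. f y \<noteq> 0} \<subseteq> a" "{y. g y \<noteq> 0} \<subseteq> b"
        using Int.IH x by blast
      then show "\<exists>f\<in>fun_algebra L. f x \<noteq> 0 \<and> {y. f y \<noteq> 0} \<subseteq> a \<inter> b"
        by (intro bexI[of _ "\<lambda>x. f x * g x"]) (auto intro: fun_algebra.mult)
    qed
  next
    case (UN K)
    then show ?case by (meson Union_iff Union_upper subset_trans)
  qed auto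
next
  assume S: "\<forall>x\<in>S. \<exists>f\<in>fun_algebra L. f x \<noteq> 0 \<and> {y. f y \<noteq> 0} \<subseteq> S"
  have "openin (zariski (fun_algebra L)) {y. f y \<noteq> 0}" if "f \<in> fun_algebra L" for f
    unfolding zariski_def using that by (intro topology_generated_by_Basis) auto
  then show "openin (zariski (fun_algebra L)) S"
    by (subst openin_subopen) (use S in blast)
qed

lemma topspace_zariski [simp]: "topspace (zariski (fun_algebra L)) = UNIV"
proof -
  have "openin (zariski (fun_algebra L)) UNIV"
    unfolding openin_zariski by (auto intro!: bexI[of _ "\<lambda>x. 1"] fun_algebra.const)
  then show ?thesis using openin_subset by blast
qed

lemma coords_subset_regular: "fun_algebra coords \<subseteq> regular_functions"
  unfolding regular_functions_def by (auto intro: fun_algebra_mono)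

lemma coord_in: "(\<lambda>X. X $ i $ j) \<in> fun_algebra coords"
  by (rule fun_algebra.gen) (auto simp: coords_def)

lemma coord_sandwich_in: "(\<lambda>X. (A ** X ** B) $ i $ j) \<in> fun_algebra coords"
proof -
  have "(\<lambda>X. \<Sum>k\<in>UNIV. (\<Sum>l\<in>UNIV. A $ i $ l * X $ l $ k) * B $ k $ j) \<in> fun_algebra coords"
    by (intro fun_algebra_sum fun_algebra.mult fun_algebra.const coord_in)
  then show ?thesis by (simp add: matrix_matrix_mult_def)
qed

lemma regular_induct [consumes 1, case_names const coord inv_det add mult]:
  assumes "f \<in> regular_functions"
    and "\<And>c. P (\<lambda>x. c)" and "\<And>i j. P (\<lambda>X. X $ i $ j)" and "P (\<lambda>X. inverse (det X))"
    and "\<And>f g. f \<in> regular_functions \<Longrightarrow> P f \<Longrightarrow> g \<in> regular_functions \<Longrightarrow> P g \<Longrightarrow> P (\<lambda>x. f x + g x)"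
    and "\<And>f g. f \<in> regular_functions \<Longrightarrow> P f \<Longrightarrow> g \<in> regular_functions \<Longrightarrow> P g \<Longrightarrow> P (\<lambda>x. f x * g x)"
  shows "P f"
  using assms(1) unfolding regular_functions_def
proof induction
  case (gen f)
  then show ?case using assms(3,4) by (auto simp: coords_def)
next
  case (add f g)
  then show ?case using assms(5)[of f g] by (simp add: regular_functions_def)
next
  case (mult f g)
  then show ?case using assms(6)[of f g] by (simp add: regular_functions_def)
qed (rule assms(2))

lemma regular_intros:
  "(\<lambda>x. c) \<in> regular_functions" "(\<lambda>X. X $ i $ j) \<in> regular_functions"
  "(\<lambda>X. inverse (det X)) \<in> regular_functions"
  "f \<in> regular_functions \<Longrightarrow> g \<in> regular_functions \<Longrightarrow> (\<lambda>x. f x + g x) \<in> regular_functions"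
  "f \<in> regular_functions \<Longrightarrow> g \<in> regular_functions \<Longrightarrow> (\<lambda>x. f x - g x) \<in> regular_functions"
  "f \<in> regular_functions \<Longrightarrow> g \<in> regular_functions \<Longrightarrow> (\<lambda>x. f x * g x) \<in> regular_functions"
  "(\<And>a. a \<in> I \<Longrightarrow> F a \<in> regular_functions) \<Longrightarrow> (\<lambda>x. \<Sum>a\<in>I. F a x) \<in> regular_functions"
  "(\<lambda>X. (A ** X ** B) $ i $ j) \<in> regular_functions"
  unfolding regular_functions_def
  by (auto intro: fun_algebra.intros fun_algebra_diff fun_algebra_sum
      intro: fun_algebra_mono[OF coord_in] fun_algebra_mono[OF coord_sandwich_in])

lemma regular_sandwich:
  fixes A B :: "'n::finite cmat"
  assumes "f \<in> regular_functions" shows "(\<lambda>X. f (A ** X ** B)) \<in> regular_functions"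
  using assms
proof (induction rule: regular_induct)
  case inv_det
  have "(\<lambda>X. inverse (det A) * inverse (det X) * inverse (det B)) \<in> regular_functions"
    by (intro regular_intros)
  then show ?case by (simp add: det_mul)
qed (auto intro: regular_intros)

text \<open>The left-invariant vector field of \<open>X\<close>, acting on functions. Working with it instead of derivations
  at the identity allows iteration.\<close>

definition lderiv :: "'n::finite cmat \<Rightarrow> ('n cmat \<Rightarrow> complex) \<Rightarrow> 'n cmat \<Rightarrow> complex"
  where "lderiv X f A = deriv (\<lambda>t. f (A ** (mat 1 + mscale t X))) 0"

lemma derivation_at_one_lderiv: "derivation_at_one X f = lderiv X f (mat 1)"
  by (simp add: derivation_at_one_def lderiv_def)

lemma has_derivative_coord:
  fixes A X :: "'n::finite cmat"
  shows "((\<lambda>t. (A ** (mat 1 + mscale t X)) $ i $ j) has_field_derivative (A ** X) $ i $ j) (at t0)"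
proof -
  have "(\<lambda>t. (A ** (mat 1 + mscale t X)) $ i $ j) = (\<lambda>t. A $ i $ j + t * (A ** X) $ i $ j)"
    by (simp add: mat_simps)
  then show ?thesis by (auto intro!: derivative_eq_intros)
qed

lemma has_derivative_inv_det:
  "((\<lambda>t. inverse (det (A ** (mat 1 + mscale t X)))) has_field_derivative
    - trace X * inverse (det A)) (at 0)"
proof (cases "det A = 0")
  case True
  then show ?thesis by (simp add: det_mul)
next
  case False
  then show ?thesis
    by (auto simp: det_mul power2_eq_square field_simps
        intro!: derivative_eq_intros det_derivative_at_one)
qed

lemma lderiv_coord: "lderiv X (\<lambda>X. X $ i $ j) = (\<lambda>A. (A ** X) $ i $ j)"
  unfolding lderiv_def by (rule ext, rule DERIV_imp_deriv, rule has_derivative_coord)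

lemma lderiv_coord_mult:
  fixes X Y :: "'n::finite cmat"
  shows "lderiv X (\<lambda>A. (A ** Y) $ i $ j) = (\<lambda>A. (A ** X ** Y) $ i $ j)"
proof
  fix A :: "'n cmat"
  have "(\<lambda>t. (A ** (mat 1 + mscale t X) ** Y) $ i $ j) = (\<lambda>t. (A ** Y) $ i $ j + t * (A ** X ** Y) $ i $ j)"
    by (simp add: mat_simps)
  moreover have "((\<lambda>t. (A ** Y) $ i $ j + t * (A ** X ** Y) $ i $ j) has_field_derivative (A ** X ** Y) $ i $ j) (at 0)"
    by (auto intro!: derivative_eq_intros)
  ultimately show "lderiv X (\<lambda>A. (A ** Y) $ i $ j) A = (A ** X ** Y) $ i $ j"
    unfolding lderiv_def by (simp add: DERIV_imp_deriv)
qed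

lemma lderiv_inv_det: "lderiv X (\<lambda>X. inverse (det X)) = (\<lambda>A. - trace X * inverse (det A))"
  unfolding lderiv_def by (rule ext, rule DERIV_imp_deriv, rule has_derivative_inv_det)

lemma lderiv_const: "lderiv X (\<lambda>X. c) = (\<lambda>A. 0)"
  unfolding lderiv_def by simp

lemma regular_differentiable:
  assumes "f \<in> regular_functions"
  shows "(\<lambda>t. f (A ** (mat 1 + mscale t X))) field_differentiable (at 0)"
  using assms
proof (induction rule: regular_induct)
  case (coord i j)
  then show ?case using has_derivative_coord field_differentiable_def by blast
next
  case inv_det
  then show ?case using has_derivative_inv_det field_differentiable_def by blast
qed (auto intro: field_differentiable_add field_differentiable_mult)

lemma lderiv_has_derivative:
  "f \<in> regular_functions \<Longrightarrow>
    ((\<lambda>t. f (A ** (mat 1 + mscale t X))) has_field_derivative lderiv X f A) (at 0)"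
  unfolding lderiv_def using regular_differentiable field_differentiable_derivI by blast

lemma lderiv_add:
  "f \<in> regular_functions \<Longrightarrow> g \<in> regular_functions \<Longrightarrow>
    lderiv X (\<lambda>x. f x + g x) = (\<lambda>A. lderiv X f A + lderiv X g A)"
  by (rule ext, subst lderiv_def, rule DERIV_imp_deriv) (intro DERIV_add lderiv_has_derivative)

lemma lderiv_diff:
  "f \<in> regular_functions \<Longrightarrow> g \<in> regular_functions \<Longrightarrow>
    lderiv X (\<lambda>x. f x - g x) = (\<lambda>A. lderiv X f A - lderiv X g A)"
  by (rule ext, subst lderiv_def, rule DERIV_imp_deriv) (intro DERIV_diff lderiv_has_derivative)

lemma lderiv_mult:
  assumes "f \<in> regular_functions" "g \<in> regular_functions"
  shows "lderiv X (\<lambda>x. f x * g x) = (\<lambda>A. lderiv X f A * g A + f A * lderiv X g A)"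
proof
  fix A
  show "lderiv X (\<lambda>x. f x * g x) A = lderiv X f A * g A + f A * lderiv X g A"
    using DERIV_mult[OF lderiv_has_derivative[OF assms(1)] lderiv_has_derivative[OF assms(2)], of A X A X]
    by (subst lderiv_def, intro DERIV_imp_deriv) (simp add: algebra_simps)
qed

lemma lderiv_sum:
  assumes "\<And>a. a \<in> I \<Longrightarrow> F a \<in> regular_functions"
  shows "lderiv X (\<lambda>x. \<Sum>a\<in>I. F a x) = (\<lambda>A. \<Sum>a\<in>I. lderiv X (F a) A)"
  using assms
  by (induction I rule: infinite_finite_induct) (simp_all add: lderiv_const lderiv_add regular_intros)

lemma lderiv_regular: "f \<in> regular_functions \<Longrightarrow> lderiv X f \<in> regular_functions"
proof (induction rule: regular_induct)
  case (coord i j)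
  show ?case using regular_intros(8)[of "mat 1" X i j] by (simp add: lderiv_coord)
next
  case inv_det
  show ?case unfolding lderiv_inv_det by (intro regular_intros)
qed (auto simp: lderiv_const lderiv_add lderiv_mult intro: regular_intros)

lemma lderiv_linear:
  assumes "f \<in> regular_functions"
  shows "lderiv (X + Y) f A = lderiv X f A + lderiv Y f A" "lderiv (mscale c X) f A = c * lderiv X f A"
  using assms
  by (induction rule: regular_induct)
    (simp_all add: lderiv_const lderiv_add lderiv_mult lderiv_coord lderiv_inv_det mat_simps
      trace_simps algebra_simps)

text \<open>Both sides are derivations in \<open>f\<close>, so it suffices to compare them on matrix entries and on the inverse
  of the determinant; the latter uses that the trace of a commutator vanishes.\<close>

lemma lderiv_bracket:
  assumes "f \<in> regular_functions"
  shows "lderiv (bracket X Y) f A = lderiv X (lderiv Y f) A - lderiv Y (lderiv X f) A"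
  using assms
proof (induction rule: regular_induct)
  case (coord i j)
  show ?case
    by (simp only: lderiv_coord lderiv_coord_mult bracket_def matrix_diff_distrib matrix_mul_assoc
        vector_minus_component)
next
  case inv_det
  have tr: "trace (bracket X Y) = 0" by (simp add: bracket_def trace_simps(2) trace_mul_sym[of X Y])
  have inv: "lderiv Z (\<lambda>A. c * inverse (det A)) A = - trace Z * (c * inverse (det A))" for c Z
    using lderiv_mult[of "\<lambda>_. c" "\<lambda>A. inverse (det A)" Z]
    by (simp add: regular_intros lderiv_const lderiv_inv_det)
  show ?case unfolding lderiv_inv_det inv tr by simp
next
  case (add f g)
  then show ?case by (simp add: lderiv_add lderiv_regular)
next
  case (mult f g)
  then show ?case
    by (simp add: lderiv_add lderiv_mult lderiv_regular regular_intros) (simp add: algebra_simps)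
qed (simp add: lderiv_const)

lemma lderiv_translate: "lderiv X (\<lambda>B. f (C ** B)) A = lderiv X f (C ** A)"
  by (simp add: lderiv_def matrix_mul_assoc)

text \<open>The chain rule for integral curves of a left-invariant vector field.\<close>

lemma curve_derivative:
  assumes "f \<in> fun_algebra coords"
    and \<gamma>: "\<And>i j. ((\<lambda>t. \<gamma> t $ i $ j) has_field_derivative (\<gamma> t0 ** X) $ i $ j) (at t0)"
  shows "((\<lambda>t. f (\<gamma> t)) has_field_derivative lderiv X f (\<gamma> t0)) (at t0)"
  using assms(1)
proof induction
  case (const c)
  then show ?case by (simp add: lderiv_const)
next
  case (gen f)
  then show ?case using \<gamma> by (auto simp: coords_def lderiv_coord)
next
  case (add f g)
  then have "f \<in> regular_functions" "g \<in> regular_functions" using coords_subset_regular by auto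
  then show ?case using add.IH by (auto simp: lderiv_add intro: DERIV_add)
next
  case (mult f g)
  then have "f \<in> regular_functions" "g \<in> regular_functions" using coords_subset_regular by auto
  then show ?case
    using DERIV_mult[OF mult.IH] by (simp add: lderiv_mult mult.commute)
qed

lemma lderiv_coords:
  "f \<in> fun_algebra coords \<Longrightarrow> lderiv X f \<in> fun_algebra coords"
proof (induction rule: fun_algebra.induct)
  case (gen f)
  then show ?case using coord_sandwich_in[of "mat 1" X] by (auto simp: coords_def lderiv_coord)
next
  case (add f g)
  then have "f \<in> regular_functions" "g \<in> regular_functions" using coords_subset_regular by auto
  then show ?case using add by (auto simp: lderiv_add intro: fun_algebra.intros)
next
  case (mult f g)
  then have "f \<in> regular_functions" "g \<in> regular_functions" using coords_subset_regular by auto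
  then show ?case using mult by (auto simp: lderiv_mult intro: fun_algebra.intros)
qed (auto simp: lderiv_const intro: fun_algebra.intros)

lemma matrix_inv_inverse:
  "invertible (A :: 'n::finite cmat) \<Longrightarrow> A ** matrix_inv A = mat 1"
  "invertible (A :: 'n::finite cmat) \<Longrightarrow> matrix_inv A ** A = mat 1"
  unfolding invertible_def matrix_inv_def by (metis (mono_tags, lifting) someI_ex)+

lemma group_GL: "group (GL :: 'n::finite cmat monoid)"
proof (rule groupI)
  fix x :: "'n cmat" assume "x \<in> carrier GL"
  then show "\<exists>y\<in>carrier GL. y \<otimes>\<^bsub>GL\<^esub> x = \<one>\<^bsub>GL\<^esub>"
    by (auto simp: GL_def invertible_def)
qed (auto simp: GL_def matrix_mul_assoc invertible_mult, auto simp: invertible_def intro: exI[of _ "mat 1"])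

lemma inv_GL: assumes "invertible (A :: 'n::finite cmat)" shows "inv\<^bsub>GL\<^esub> A = matrix_inv A"
proof -
  interpret group "GL :: 'n cmat monoid" by (rule group_GL)
  show ?thesis
    using assms matrix_inv_inverse[OF assms]
    by (intro inv_equality) (auto simp: GL_def invertible_def)
qed

lemma subgroup_GL_iff:
  "subgroup G (GL :: 'n::finite cmat monoid) \<longleftrightarrow>
    (\<forall>A\<in>G. invertible A) \<and> mat 1 \<in> G \<and> (\<forall>A\<in>G. \<forall>B\<in>G. A ** B \<in> G) \<and> (\<forall>A\<in>G. matrix_inv A \<in> G)"
proof -
  have *: "(\<forall>A\<in>G. invertible A) \<Longrightarrow> (\<forall>A\<in>G. inv\<^bsub>GL\<^esub> A \<in> G) \<longleftrightarrow> (\<forall>A\<in>G. matrix_inv A \<in> G)"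
    by (auto simp: inv_GL)
  show ?thesis
  proof
    assume "subgroup G (GL :: 'n cmat monoid)"
    then interpret subgroup G "GL :: 'n cmat monoid" .
    have inv: "\<forall>A\<in>G. invertible A" using subset by (auto simp: GL_def)
    moreover have "mat 1 \<in> G" using one_closed by (simp add: GL_def)
    moreover have "\<forall>A\<in>G. \<forall>B\<in>G. A ** B \<in> G" using m_closed by (simp add: GL_def)
    moreover have "\<forall>A\<in>G. matrix_inv A \<in> G" using * inv m_inv_closed by blast
    ultimately show "(\<forall>A\<in>G. invertible A) \<and> mat 1 \<in> G \<and> (\<forall>A\<in>G. \<forall>B\<in>G. A ** B \<in> G) \<and> (\<forall>A\<in>G. matrix_inv A \<in> G)"
      by blast
  next
    assume "(\<forall>A\<in>G. invertible A) \<and> mat 1 \<in> G \<and> (\<forall>A\<in>G. \<forall>B\<in>G. A ** B \<in> G) \<and> (\<forall>A\<in>G. matrix_inv A \<in> G)"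
    with * show "subgroup G (GL :: 'n cmat monoid)"
      by unfold_locales (auto simp: GL_def)
  qed
qed

text \<open>A closed subset of \<open>GL\<close> contains every invertible matrix at which all polynomials vanishing on the
  subset vanish; membership in algebraic groups is always proved in this form.\<close>

lemma linear_algebraic_group_iff:
  "linear_algebraic_group (G :: 'n::finite cmat set) \<longleftrightarrow> subgroup G GL \<and>
    (\<forall>B. invertible B \<longrightarrow> (\<forall>f\<in>fun_algebra coords. (\<forall>A\<in>G. f A = 0) \<longrightarrow> f B = 0) \<longrightarrow> B \<in> G)"
proof -
  let ?C = "carrier (GL :: 'n cmat monoid)"
  have C: "?C = {A. invertible A}" by (simp add: GL_def)
  have "closedin (subtopology zariski_mat ?C) G \<longleftrightarrow>
    (\<forall>B. invertible B \<longrightarrow> (\<forall>f\<in>fun_algebra coords. (\<forall>A\<in>G. f A = 0) \<longrightarrow> f B = 0) \<longrightarrow> B \<in> G)"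
    if G: "G \<subseteq> ?C"
  proof
    assume "closedin (subtopology zariski_mat ?C) G"
    then obtain T where T: "openin zariski_mat T" "?C - G = T \<inter> ?C"
      by (auto simp: closedin_def openin_subtopology zariski_mat_def)
    show "\<forall>B. invertible B \<longrightarrow> (\<forall>f\<in>fun_algebra coords. (\<forall>A\<in>G. f A = 0) \<longrightarrow> f B = 0) \<longrightarrow> B \<in> G"
    proof (intro allI impI, rule ccontr)
      fix B assume B: "invertible B" "\<forall>f\<in>fun_algebra coords. (\<forall>A\<in>G. f A = 0) \<longrightarrow> f B = 0" "B \<notin> G"
      then have "B \<in> T" using T C by blast
      then obtain f where f: "f \<in> fun_algebra coords" "f B \<noteq> 0" "{y. f y \<noteq> 0} \<subseteq> T"
        using T(1) unfolding zariski_mat_def openin_zariski by blast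
      then have "\<forall>A\<in>G. f A = 0" using T(2) G by blast
      with f B show False by blast
    qed
  next
    assume *: "\<forall>B. invertible B \<longrightarrow> (\<forall>f\<in>fun_algebra coords. (\<forall>A\<in>G. f A = 0) \<longrightarrow> f B = 0) \<longrightarrow> B \<in> G"
    let ?T = "\<Union>f\<in>{f \<in> fun_algebra coords. \<forall>A\<in>G. f A = 0}. {y. f y \<noteq> 0}"
    have opT: "openin zariski_mat ?T" unfolding zariski_mat_def openin_zariski by blast
    have CT: "?C - G = ?T \<inter> ?C"
    proof (intro equalityI subsetI)
      fix B assume B: "B \<in> ?C - G"
      then have "\<not> (\<forall>f\<in>fun_algebra coords. (\<forall>A\<in>G. f A = 0) \<longrightarrow> f B = 0)"
        using * C by blast
      then show "B \<in> ?T \<inter> ?C" using B by blast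
    qed blast
    have top: "topspace (subtopology zariski_mat ?C) = ?C" by (simp add: zariski_mat_def)
    have "openin (subtopology zariski_mat ?C) (?C - G)"
      unfolding CT by (rule openin_subtopology_Int[OF opT])
    then show "closedin (subtopology zariski_mat ?C) G"
      unfolding closedin_def top using G by blast
  qed
  then have closed: "G \<subseteq> ?C \<Longrightarrow> closedin (subtopology zariski_mat ?C) G \<longleftrightarrow>
    (\<forall>B. invertible B \<longrightarrow> (\<forall>f\<in>fun_algebra coords. (\<forall>A\<in>G. f A = 0) \<longrightarrow> f B = 0) \<longrightarrow> B \<in> G)" .
  show ?thesis
  proof (cases "subgroup G (GL :: 'n cmat monoid)")
    case True
    show ?thesis
      unfolding linear_algebraic_group_def closed[OF subgroup.subset[OF True]] ..
  next
    case False
    then show ?thesis unfolding linear_algebraic_group_def by iprover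
  qed
qed

lemma linear_algebraic_groupD:
  assumes "linear_algebraic_group G"
  shows "\<forall>A\<in>G. invertible A" "mat 1 \<in> G" "\<forall>A\<in>G. \<forall>B\<in>G. A ** B \<in> G"
    "\<forall>A\<in>G. matrix_inv A \<in> G"
proof -
  note G = assms[unfolded linear_algebraic_group_iff, THEN conjunct1, unfolded subgroup_GL_iff]
  show "\<forall>A\<in>G. invertible A" by (rule G[THEN conjunct1])
  show "mat 1 \<in> G" by (rule G[THEN conjunct2, THEN conjunct1])
  show "\<forall>A\<in>G. \<forall>B\<in>G. A ** B \<in> G" by (rule G[THEN conjunct2, THEN conjunct2, THEN conjunct1])
  show "\<forall>A\<in>G. matrix_inv A \<in> G" by (rule G[THEN conjunct2, THEN conjunct2, THEN conjunct2])
qed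

lemma linear_algebraic_group_closed:
  assumes G: "linear_algebraic_group G" and B: "invertible B"
    and f: "\<And>f. f \<in> fun_algebra coords \<Longrightarrow> \<forall>A\<in>G. f A = 0 \<Longrightarrow> f B = 0"
  shows "B \<in> G"
proof (rule G[unfolded linear_algebraic_group_iff, THEN conjunct2, THEN spec, THEN mp, THEN mp, OF B])
  show "\<forall>h\<in>fun_algebra coords. (\<forall>A\<in>G. h A = 0) \<longrightarrow> h B = 0"
    by (intro ballI impI) (rule f)
qed

lemma matrix_inv_cancel:
  fixes A X :: "'n::finite cmat"
  assumes "invertible A"
  shows "X ** matrix_inv A ** A = X" "X ** A ** matrix_inv A = X"
  by (simp_all only: matrix_mul_assoc[symmetric] matrix_inv_inverse[OF assms] matrix_mul_rid)

lemma matrix_inv_unique: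
  fixes A B :: "'n::finite cmat"
  assumes "A ** B = mat 1" shows "matrix_inv A = B"
proof -
  have "invertible A" using assms invertible_right_inverse by blast
  then have "matrix_inv A ** (A ** B) = B" by (simp add: matrix_mul_assoc matrix_inv_inverse)
  then show ?thesis by (simp add: assms)
qed

lemma clinear_adjoint: "clinear (adjoint_action A)"
  by (auto intro!: clinearI simp: adjoint_action_def mat_simps)

lemma adjoint_bracket:
  assumes "invertible A"
  shows "adjoint_action A (bracket X Y) = bracket (adjoint_action A X) (adjoint_action A Y)"
proof -
  have "A ** X ** matrix_inv A ** (A ** Y ** matrix_inv A) = A ** (X ** Y) ** matrix_inv A" for X Y
    by (simp add: matrix_mul_assoc matrix_inv_cancel[OF assms])
  then show ?thesis by (simp add: adjoint_action_def bracket_def matrix_diff_distrib)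
qed

lemma adjoint_inv:
  assumes "invertible A"
  shows "adjoint_action (matrix_inv A) (adjoint_action A X) = X"
    "adjoint_action A (adjoint_action (matrix_inv A) X) = X"
proof -
  have inv: "matrix_inv (matrix_inv A) = A"
    by (rule matrix_inv_unique) (rule matrix_inv_inverse[OF assms])
  show "adjoint_action (matrix_inv A) (adjoint_action A X) = X"
    "adjoint_action A (adjoint_action (matrix_inv A) X) = X"
    unfolding adjoint_action_def inv
    by (simp_all add: matrix_mul_assoc matrix_inv_cancel[OF assms] matrix_inv_inverse[OF assms])
qed

lemma adjoint_derivation:
  assumes "invertible A"
  shows "derivation_at_one (adjoint_action A X) f = derivation_at_one X (\<lambda>B. f (A ** B ** matrix_inv A))"
proof -
  have "A ** (mat 1 + mscale t X) ** matrix_inv A = mat 1 + mscale t (adjoint_action A X)" for t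
    by (simp add: adjoint_action_def mat_simps matrix_inv_inverse assms)
  then show ?thesis by (simp add: derivation_at_one_def)
qed

lemma lie_algebra_subspace: "cmat.subspace (lie_algebra G)"
proof -
  have "lderiv 0 f A = 0" if "f \<in> regular_functions" for f and A :: "'a cmat"
    using lderiv_linear(2)[OF that, of 0 0 A] by simp
  then show ?thesis
    by (intro cmat.subspaceI) (auto simp: lie_algebra_def derivation_at_one_lderiv lderiv_linear)
qed

text \<open>For \<open>A\<close> in the group the translate of \<open>f\<close> by \<open>A\<close> vanishes on the group as well, so the defining
  condition of the Lie algebra at the identity spreads to all of the group: the vanishing ideal is
  stable under \<open>lderiv X\<close>.\<close>

lemma lderiv_vanishes:
  assumes "X \<in> lie_algebra G" "f \<in> regular_functions" "\<And>A. A \<in> G \<Longrightarrow> f A = 0"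
    and "\<And>A B. A \<in> G \<Longrightarrow> B \<in> G \<Longrightarrow> A ** B \<in> G" and "A \<in> G"
  shows "lderiv X f A = 0"
proof -
  have "(\<lambda>B. f (A ** B)) \<in> regular_functions"
    using regular_sandwich[OF assms(2), of A "mat 1"] by simp
  then have "derivation_at_one X (\<lambda>B. f (A ** B)) = 0"
    using assms by (auto simp: lie_algebra_def)
  then show ?thesis by (simp add: derivation_at_one_lderiv lderiv_translate)
qed

lemma lie_algebra_bracket:
  assumes G: "linear_algebraic_group G" and X: "X \<in> lie_algebra G" and Y: "Y \<in> lie_algebra G"
  shows "bracket X Y \<in> lie_algebra G"
  unfolding lie_algebra_def
proof (intro CollectI ballI impI)
  fix f :: "'a cmat \<Rightarrow> complex" assume f: "f \<in> regular_functions" "\<forall>A\<in>G. f A = 0"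
  note [simp] = linear_algebraic_groupD(2,3)[OF G]
  have "lderiv Z f A = 0" if "Z \<in> lie_algebra G" "A \<in> G" for Z A
    using that f by (intro lderiv_vanishes[of Z G]) auto
  then have "lderiv Z (lderiv W f) (mat 1) = 0" if "Z \<in> lie_algebra G" "W \<in> lie_algebra G" for Z W
    using that f by (intro lderiv_vanishes[of Z G]) (auto intro: lderiv_regular)
  then show "derivation_at_one (bracket X Y) f = 0"
    using X Y by (simp add: derivation_at_one_lderiv lderiv_bracket f)
qed

lemma lie_algebra_adjoint:
  assumes G: "linear_algebraic_group G" and X: "X \<in> lie_algebra G" and A: "A \<in> G"
  shows "adjoint_action A X \<in> lie_algebra G"
  unfolding lie_algebra_def
proof (intro CollectI ballI impI)
  note D = linear_algebraic_groupD[OF G]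
  have inv: "invertible A" using D(1) A by blast
  fix f :: "'a cmat \<Rightarrow> complex" assume f: "f \<in> regular_functions" "\<forall>A\<in>G. f A = 0"
  have "(\<lambda>B. f (A ** B ** matrix_inv A)) \<in> regular_functions" by (rule regular_sandwich[OF f(1)])
  moreover have "\<forall>B\<in>G. f (A ** B ** matrix_inv A) = 0" using f(2) D(3,4) A by simp
  ultimately have "derivation_at_one X (\<lambda>B. f (A ** B ** matrix_inv A)) = 0"
    using X by (auto simp: lie_algebra_def)
  then show "derivation_at_one (adjoint_action A X) f = 0"
    by (simp only: adjoint_derivation[OF inv])
qed

section \<open>Flags and one-parameter curves of nilpotent matrices\<close>

definition mpow :: "'n::finite cmat \<Rightarrow> nat \<Rightarrow> 'n cmat"
  where "mpow N k = (((**) N) ^^ k) (mat 1)"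

lemma mpow_0 [simp]: "mpow N 0 = mat 1"
  by (simp add: mpow_def)

lemma mpow_Suc: "mpow N (Suc k) = N ** mpow N k"
  by (simp add: mpow_def)

lemma funpow_mult_mpow:
  fixes N Y :: "'n::finite cmat"
  shows "(((**) N) ^^ k) Y = mpow N k ** Y"
  using mult_funpow_mult[of k N "mat 1" Y] by (simp add: mpow_def)

lemma mpow_commute: "mpow N k ** N = N ** mpow N k"
  by (induction k) (simp_all add: mpow_Suc matrix_mul_assoc[symmetric])

lemma nilpotent_mat_mpow: "nilpotent_mat N \<longleftrightarrow> (\<exists>k. mpow N k = 0)"
  by (simp add: nilpotent_mat_def mpow_def)

lemma mpow_zero_mono: "mpow N k = 0 \<Longrightarrow> k \<le> l \<Longrightarrow> mpow N l = 0"
  using funpow_zero_mono[OF clinear_mult_left] by (simp add: mpow_def)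

text \<open>Up to sign \<open>ad x\<close> is left multiplication minus right multiplication by \<open>x\<close>, both nilpotent.\<close>

lemma nilpotent_bracket:
  fixes x y :: "'n::finite cmat"
  assumes "nilpotent_mat x" shows "\<exists>k. (bracket x ^^ k) y = 0"
proof -
  obtain k where k: "mpow x k = 0" using assms nilpotent_mat_mpow by blast
  let ?h = "\<lambda>v. - (v ** x)"
  have "(?h ^^ j) (mat 1) = mscale ((- 1) ^ j) (mpow x j)" for j
    by (induction j) (simp_all add: mat_simps mpow_commute mpow_Suc)
  then have "(?h ^^ k) (mat 1) = 0" by (simp add: k)
  moreover have "(((**) x) ^^ k) y = 0" by (simp add: funpow_mult_mpow k matrix_zero_mult)
  ultimately have "(bracket x ^^ (k + k)) (y ** mat 1) = 0"
    by (intro leibniz_nilpotent[OF clinear_bracket, where g = "(**) x" and h = ?h])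
      (auto simp: mat_simps bracket_def)
  then show ?thesis by auto
qed

text \<open>The flag of iterated common kernels of \<open>n\<close>, in the space of all matrices viewed as a sum of copies of
  the natural representation.\<close>

primrec nil_flag :: "'n::finite cmat set \<Rightarrow> nat \<Rightarrow> 'n cmat set"
  where
    "nil_flag n 0 = {0}"
  | "nil_flag n (Suc i) = {Y. \<forall>x\<in>n. x ** Y \<in> nil_flag n i}"

definition lowers_flag :: "'n::finite cmat set \<Rightarrow> 'n cmat \<Rightarrow> bool"
  where "lowers_flag n N \<longleftrightarrow> (\<forall>i. \<forall>Y\<in>nil_flag n (Suc i). N ** Y \<in> nil_flag n i)"

lemma subspace_nil_flag: "cmat.subspace (nil_flag n i)"
proof (induction i)
  case (Suc i)
  show ?case
    by (rule cmat.subspaceI)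
      (auto simp: mat_simps intro: cmat.subspace_add[OF Suc] cmat.subspace_scale[OF Suc] cmat.subspace_0[OF Suc])
qed (simp add: cmat.subspace_single_0)

lemma nil_flag_mono: "nil_flag n i \<subseteq> nil_flag n (Suc i)"
  by (induction i) (auto simp: matrix_zero_mult)

lemma lowers_flag_member: "x \<in> n \<Longrightarrow> lowers_flag n x"
  by (simp add: lowers_flag_def)

lemma lowers_flag_stable:
  assumes "lowers_flag n N" "Y \<in> nil_flag n i" shows "N ** Y \<in> nil_flag n i"
proof -
  have "Y \<in> nil_flag n (Suc i)" using assms(2) nil_flag_mono by blast
  then show ?thesis using assms(1) unfolding lowers_flag_def by blast
qed

lemma lowers_flag_simps:
  "lowers_flag n 0" "lowers_flag n N \<Longrightarrow> lowers_flag n M \<Longrightarrow> lowers_flag n (N + M)"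
  "lowers_flag n N \<Longrightarrow> lowers_flag n (mscale c N)"
  "lowers_flag n N \<Longrightarrow> lowers_flag n M \<Longrightarrow> lowers_flag n (N ** M)"
proof -
  note s = subspace_nil_flag[of n]
  show "lowers_flag n 0" by (simp add: lowers_flag_def matrix_zero_mult cmat.subspace_0[OF s])
  show "lowers_flag n N \<Longrightarrow> lowers_flag n M \<Longrightarrow> lowers_flag n (N + M)"
    by (simp add: lowers_flag_def mat_simps cmat.subspace_add[OF s] del: nil_flag.simps)
  show "lowers_flag n N \<Longrightarrow> lowers_flag n (mscale c N)"
    by (simp add: lowers_flag_def mat_simps cmat.subspace_scale[OF s] del: nil_flag.simps)
  assume N: "lowers_flag n N" and M: "lowers_flag n M"
  show "lowers_flag n (N ** M)"
    unfolding lowers_flag_def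
  proof (intro allI ballI)
    fix i Y assume "Y \<in> nil_flag n (Suc i)"
    then have "M ** Y \<in> nil_flag n i" using M unfolding lowers_flag_def by blast
    then have "N ** (M ** Y) \<in> nil_flag n i" by (rule lowers_flag_stable[OF N])
    then show "N ** M ** Y \<in> nil_flag n i" by (simp add: matrix_mul_assoc)
  qed
qed

lemma lowers_flag_sum: "(\<And>a. a \<in> I \<Longrightarrow> lowers_flag n (f a)) \<Longrightarrow> lowers_flag n (sum f I)"
  by (induction I rule: infinite_finite_induct) (auto intro: lowers_flag_simps)

lemma lowers_flag_mpow: "lowers_flag n N \<Longrightarrow> lowers_flag n (mpow N (Suc k))"
  by (induction k) (simp add: mpow_Suc, simp add: mpow_Suc[of _ "Suc _"] lowers_flag_simps)

lemma lowers_flag_power_series: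
  assumes "lowers_flag n N"
  shows "lowers_flag n ((\<Sum>k\<le>K. mscale (c k) (mpow N k)) - mscale (c 0) (mat 1))"
proof (cases K)
  case 0
  then show ?thesis by (simp add: lowers_flag_simps)
next
  case (Suc K')
  have "lowers_flag n (\<Sum>k\<le>K'. mscale (c (Suc k)) (mpow N (Suc k)))"
    by (intro lowers_flag_sum lowers_flag_simps lowers_flag_mpow assms)
  then show ?thesis by (simp only: Suc sum.atMost_Suc_shift) simp
qed

lemma nilpotent_if_lowers_flag:
  assumes "nil_flag n K = UNIV" "lowers_flag n N" shows "nilpotent_mat N"
proof -
  have "mpow N k \<in> nil_flag n (K - k)" if "k \<le> K" for k
    using that
  proof (induction k)
    case (Suc k)
    then have "mpow N k \<in> nil_flag n (Suc (K - Suc k))" by (simp add: Suc_diff_Suc del: nil_flag.simps)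
    then show ?case using assms(2) unfolding lowers_flag_def mpow_Suc by blast
  qed (use assms in simp)
  from this[of K] have "mpow N K = 0" by simp
  then show ?thesis using nilpotent_mat_mpow by blast
qed

text \<open>As long as a step of the flag is not everything, Engel's theorem yields a matrix in the next step
  that it does not contain; so the dimensions grow until the whole space is reached.\<close>

lemma nil_flag_exhausts:
  assumes n: "bracket_closed n" and nil: "\<forall>x\<in>n. nilpotent_mat x"
  shows "\<exists>K. nil_flag n K = (UNIV :: 'n::finite cmat set)"
proof (rule ccontr)
  assume no: "\<nexists>K. nil_flag n K = (UNIV :: 'n cmat set)"
  have strict: "nil_flag n i \<subset> nil_flag n (Suc i)" for i
  proof -
    have "\<exists>v\<in>UNIV - nil_flag n i. \<forall>x\<in>n. x ** v \<in> nil_flag n i"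
    proof (rule engel[OF n _ lie_action_mult cmat.subspace_UNIV subspace_nil_flag])
      show "\<forall>x\<in>n. \<forall>y\<in>n. \<exists>k. (bracket x ^^ k) y = 0" using nilpotent_bracket nil by blast
      show "nil_flag n i \<subset> UNIV" using no by blast
      show "\<forall>x\<in>n. (**) x ` nil_flag n i \<subseteq> nil_flag n i"
        using lowers_flag_stable lowers_flag_member by blast
      show "\<forall>x\<in>n. \<forall>v\<in>UNIV. \<exists>k. (((**) x) ^^ k) v \<in> nil_flag n i"
      proof (intro ballI)
        fix x v :: "'n cmat" assume "x \<in> n"
        then obtain k where "\<forall>Y :: 'n cmat. (((**) x) ^^ k) Y = 0" using nil nilpotent_mat_iff by blast
        then show "\<exists>k. (((**) x) ^^ k) v \<in> nil_flag n i"
          using cmat.subspace_0[OF subspace_nil_flag] by (intro exI[of _ k]) simp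
      qed
    qed simp
    then show ?thesis using nil_flag_mono[of n i] by auto
  qed
  have "i \<le> cmat.dim (nil_flag n i)" for i
  proof (induction i)
    case (Suc i)
    have "cmat.dim (nil_flag n i) < cmat.dim (nil_flag n (Suc i))"
      by (rule subspace_psubset_dim[OF subspace_nil_flag subspace_nil_flag strict])
    with Suc show ?case by simp
  qed simp
  moreover have "cmat.dim (nil_flag n i) \<le> cmat.dim (UNIV :: 'n cmat set)" for i
    by (rule cfd.dim_subset) simp
  ultimately show False using not_less_eq_eq order_trans by blast
qed

text \<open>Since \<open>n\<close> is stable under conjugation, \<open>x A = A (A\<^sup>-\<^sup>1 x A)\<close> moves elements of \<open>n\<close> past elements of
  the group.\<close>

lemma nil_flag_group_stable:
  assumes "linear_algebraic_group G" and n: "\<forall>A\<in>G. adjoint_action A ` n \<subseteq> n" and A: "A \<in> G"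
  shows "Y \<in> nil_flag n i \<Longrightarrow> A ** Y \<in> nil_flag n i"
proof (induction i arbitrary: Y)
  case (Suc i)
  note D = linear_algebraic_groupD[OF assms(1)]
  have iA: "invertible A" by (rule bspec[OF D(1) A])
  have inv: "matrix_inv (matrix_inv A) = A"
    by (rule matrix_inv_unique) (rule matrix_inv_inverse[OF iA])
  have "x ** (A ** Y) \<in> nil_flag n i" if x: "x \<in> n" for x
  proof -
    have "matrix_inv A \<in> G" by (rule bspec[OF D(4) A])
    from bspec[OF n this] x have "adjoint_action (matrix_inv A) x \<in> n" by blast
    then have "A ** (adjoint_action (matrix_inv A) x ** Y) \<in> nil_flag n i"
      using Suc.prems by (intro Suc.IH) simp
    then show ?thesis
      by (simp add: adjoint_action_def inv matrix_mul_assoc matrix_inv_inverse[OF iA])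
  qed
  then show ?case by simp
qed (simp add: matrix_zero_mult)

lemma clinear_coord_in:
  assumes "clinear g" shows "(\<lambda>X. g X $ i $ j) \<in> fun_algebra coords"
proof -
  let ?E = "\<lambda>a b. \<chi> i j. if i = a \<and> j = b then 1 else 0"
  have "g X $ i $ j = (\<Sum>ab\<in>UNIV. X $ fst ab $ snd ab * g (?E (fst ab) (snd ab)) $ i $ j)" for X
    by (subst matrix_unit_expansion)
      (simp add: clinear_simps[OF assms] sum_nth2 case_prod_beta)
  then have eq: "(\<lambda>X. g X $ i $ j) = (\<lambda>X. \<Sum>ab\<in>UNIV. X $ fst ab $ snd ab * g (?E (fst ab) (snd ab)) $ i $ j)"
    by (rule ext)
  show ?thesis
    by (subst eq) (intro fun_algebra_sum fun_algebra.mult fun_algebra.const coord_in)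
qed

lemma subspace_separation:
  assumes F: "cmat.subspace F" and "y \<notin> F"
  shows "\<exists>g. clinear g \<and> (\<forall>x\<in>F. g x = 0) \<and> g y \<noteq> 0"
proof -
  obtain B where B: "B \<subseteq> F" "cmat.independent B" "cmat.span B = F"
    using cmat.basis_exists[of F] F by (metis cmat.span_subspace)
  have "cmat.independent (insert y B)" using B \<open>y \<notin> F\<close> by (intro cmat.independent_insertI) auto
  then obtain g where g: "clinear g" "\<forall>x\<in>insert y B. g x = (if x = y then y else 0)"
    using cpair.linear_independent_extend[of "insert y B" "\<lambda>x. if x = y then y else 0"] by blast
  have "y \<notin> B" using B \<open>y \<notin> F\<close> by blast
  then have "g x = 0" if "x \<in> B" for x using g that by auto
  then have "g x = 0" if "x \<in> F" for x
    using cpair.linear_eq_0_on_span[OF g(1), of B] B that by blast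
  moreover have "y \<noteq> 0" using cmat.subspace_0[OF F] \<open>y \<notin> F\<close> by blast
  ultimately show ?thesis using g by auto
qed

lemma polyfun_fun_algebra:
  assumes "f \<in> fun_algebra coords" "\<And>i j. polyfun (\<lambda>t. M t $ i $ j)"
  shows "polyfun (\<lambda>t. f (M t))"
  using assms(1)
  by induction (auto simp: coords_def assms(2) intro: polyfun_add polyfun_mult polyfun_const)

lemma polyfun_gbinomial: "polyfun (\<lambda>t. t gchoose k)"
proof -
  have "polyfun (\<lambda>t. (\<Prod>i=0..<k. t - of_nat i) * (1 / fact k))"
    by (intro polyfun_mult polyfun_prod polyfun_diff polyfun_const polyfun_id)
  then show ?thesis by (simp add: gbinomial_prod_rev)
qed

text \<open>The matrix \<open>(1 + N) ^ t\<close> for nilpotent \<open>N\<close> and complex \<open>t\<close>, by the binomial series. It joins the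
  identity to \<open>1 + N\<close> polynomially and passes through all natural powers of \<open>1 + N\<close>.\<close>

definition binomial_curve :: "nat \<Rightarrow> 'n::finite cmat \<Rightarrow> complex \<Rightarrow> 'n cmat"
  where "binomial_curve K N t = (\<Sum>k\<le>K. mscale (t gchoose k) (mpow N k))"

lemma binomial_curve_of_nat:
  fixes N :: "'n::finite cmat"
  assumes "mpow N (Suc K) = 0"
  shows "binomial_curve K N (of_nat m) = mpow (mat 1 + N) m"
proof (induction m)
  case 0
  show ?case
  proof (cases K)
    case 0
    then show ?thesis by (simp add: binomial_curve_def)
  next
    case (Suc K')
    then show ?thesis
      by (simp only: binomial_curve_def Suc sum.atMost_Suc_shift) simp
  qed
next
  case (Suc m)
  let ?a = "of_nat m :: complex"
  have "N ** binomial_curve K N ?a = (\<Sum>k\<le>K. mscale (?a gchoose k) (mpow N (Suc k)))"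
    by (simp add: binomial_curve_def matrix_sum_distrib(2) mscale_mult mpow_Suc)
  then have "mpow (mat 1 + N) (Suc m) =
      binomial_curve K N ?a + (\<Sum>k\<le>K. mscale (?a gchoose k) (mpow N (Suc k)))"
    by (simp add: mpow_Suc Suc[symmetric] mat_simps)
  also have "\<dots> = binomial_curve K N (?a + 1)"
  proof (cases K)
    case 0
    then show ?thesis using assms by (simp add: binomial_curve_def)
  next
    case (Suc K')
    have z: "mpow N (Suc (Suc K')) = 0" using assms Suc by simp
    have "(\<Sum>k\<le>Suc K'. mscale (?a gchoose k) (mpow N (Suc k)))
        = (\<Sum>k\<le>K'. mscale (?a gchoose k) (mpow N (Suc k)))"
      by (simp add: z)
    then show ?thesis
      unfolding binomial_curve_def Suc
      by (simp add: sum.atMost_Suc_shift gbinomial_Suc_Suc cscale_simps sum.distrib del: sum.atMost_Suc)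
  qed
  finally show ?case by (simp add: add.commute)
qed

lemma polyfun_binomial_curve: "polyfun (\<lambda>t. binomial_curve K N t $ i $ j)"
  unfolding binomial_curve_def sum_nth2 mscale_nth
  by (intro polyfun_sum polyfun_mult polyfun_const polyfun_gbinomial)

text \<open>The exponential \<open>exp (t x)\<close> of a nilpotent \<open>x\<close>; the series is finite, so it is polynomial in \<open>t\<close>.\<close>

definition exp_curve :: "nat \<Rightarrow> 'n::finite cmat \<Rightarrow> complex \<Rightarrow> 'n cmat"
  where "exp_curve K x t = (\<Sum>k\<le>K. mscale (t ^ k / fact k) (mpow x k))"

lemma exp_curve_0: "exp_curve K x 0 = mat 1"
proof (cases K)
  case 0
  then show ?thesis by (simp add: exp_curve_def)
next
  case (Suc K')
  then show ?thesis by (simp only: exp_curve_def Suc sum.atMost_Suc_shift) simp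
qed

lemma polyfun_exp_curve: "polyfun (\<lambda>t. exp_curve K x t $ i $ j)"
proof -
  have "polyfun (\<lambda>t. t ^ k / fact k)" for k
  proof -
    have "polyfun (\<lambda>t. (\<Prod>i<k. t) * (1 / fact k))"
      by (intro polyfun_mult polyfun_prod polyfun_const polyfun_id)
    then show ?thesis by simp
  qed
  then show ?thesis
    unfolding exp_curve_def sum_nth2 mscale_nth by (intro polyfun_sum polyfun_mult polyfun_const)
qed

lemma exp_curve_derivative:
  fixes x :: "'n::finite cmat"
  assumes "mpow x (Suc K) = 0"
  shows "((\<lambda>t. exp_curve K x t $ i $ j) has_field_derivative (exp_curve K x t0 ** x) $ i $ j) (at t0)"
proof -
  have d: "((\<lambda>t. \<Sum>k\<le>K. t ^ k / fact k * mpow x k $ i $ j) has_field_derivative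
      (\<Sum>k\<le>K. of_nat k * t0 ^ (k - 1) / fact k * mpow x k $ i $ j)) (at t0)"
    by (intro DERIV_sum) (auto intro!: derivative_eq_intros)
  have "exp_curve K x t0 ** x = (\<Sum>k\<le>K. mscale (t0 ^ k / fact k) (mpow x (Suc k)))"
    by (simp add: exp_curve_def matrix_sum_distrib(1) mscale_mult mpow_commute mpow_Suc)
  also have "\<dots> = (\<Sum>k\<le>K. mscale (of_nat k * t0 ^ (k - 1) / fact k) (mpow x k))"
  proof (cases K)
    case 0
    then show ?thesis using assms by simp
  next
    case (Suc K')
    have z: "mpow x (Suc (Suc K')) = 0" using assms Suc by simp
    have c: "of_nat (Suc k) * t0 ^ (Suc k - 1) / fact (Suc k) = t0 ^ k / fact k" for k
      by (simp add: field_simps del: of_nat_Suc)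
    show ?thesis
      unfolding Suc by (subst sum.atMost_Suc, subst sum.atMost_Suc_shift) (simp only: c z, simp)
  qed
  finally have "(exp_curve K x t0 ** x) $ i $ j
      = (\<Sum>k\<le>K. of_nat k * t0 ^ (k - 1) / fact k * mpow x k $ i $ j)"
    by (simp add: sum_nth2)
  then show ?thesis using d by (simp add: exp_curve_def sum_nth2)
qed

text \<open>For \<open>f\<close> vanishing on the group, the derivative of \<open>f\<close> along the curve is \<open>lderiv x f\<close> along the curve,
  and \<open>lderiv x f\<close> vanishes on the group too. Iterating, all derivatives at \<open>t = 0\<close> vanish, where the
  curve passes through the identity; hence the polynomial \<open>f (exp (t x))\<close> is zero.\<close>

lemma exp_curve_in_group:
  assumes G: "linear_algebraic_group G" and x: "x \<in> lie_algebra G" and K: "mpow x (Suc K) = 0"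
    and inv: "invertible (exp_curve K x t)"
  shows "exp_curve K x t \<in> G"
proof (rule linear_algebraic_group_closed[OF G inv])
  fix f :: "'a cmat \<Rightarrow> complex" assume f: "f \<in> fun_algebra coords" "\<forall>A\<in>G. f A = 0"
  \<comment> \<open>\<open>coeff p k\<close> is the \<open>k\<close>-th derivative at \<open>0\<close> up to a factor.\<close>
  have van: "\<forall>p. (\<forall>t. f (exp_curve K x t) = poly p t) \<longrightarrow> coeff p k = 0"
    if "f \<in> fun_algebra coords" "\<forall>A\<in>G. f A = 0" for f k
    using that
  proof (induction k arbitrary: f)
    case 0
    have "f (exp_curve K x 0) = 0"
      using 0 linear_algebraic_groupD(2)[OF G] by (simp add: exp_curve_0)
    then show ?case by (metis poly_0_coeff_0)
  next
    case (Suc k)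
    show ?case
    proof (intro allI impI)
      fix p assume p: "\<forall>t. f (exp_curve K x t) = poly p t"
      have f': "lderiv x f \<in> fun_algebra coords" by (rule lderiv_coords[OF Suc.prems(1)])
      have reg: "f \<in> regular_functions" using Suc.prems(1) coords_subset_regular by blast
      have "\<forall>A\<in>G. lderiv x f A = 0"
      proof
        fix A assume "A \<in> G"
        then show "lderiv x f A = 0"
          using Suc.prems(2) linear_algebraic_groupD(3)[OF G]
          by (intro lderiv_vanishes[OF x reg]) auto
      qed
      moreover have "lderiv x f (exp_curve K x t) = poly (pderiv p) t" for t
      proof (rule DERIV_unique)
        show "((\<lambda>t. f (exp_curve K x t)) has_field_derivative lderiv x f (exp_curve K x t)) (at t)"
          by (rule curve_derivative[OF Suc.prems(1) exp_curve_derivative[OF K]])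
        show "((\<lambda>t. f (exp_curve K x t)) has_field_derivative poly (pderiv p) t) (at t)"
          using p by (simp add: poly_DERIV)
      qed
      ultimately have "coeff (pderiv p) k = 0" using Suc.IH[OF f'] by blast
      then show "coeff p (Suc k) = 0" by (simp add: coeff_pderiv del: of_nat_Suc)
    qed
  qed
  obtain p where p: "\<forall>t. f (exp_curve K x t) = poly p t"
    using polyfun_fun_algebra[OF f(1) polyfun_exp_curve] unfolding polyfun_def by blast
  have "p = 0" by (rule poly_eqI) (use van[OF f] p in simp)
  with p show "f (exp_curve K x t) = 0" by simp
qed

section \<open>Ideals of nilpotent matrices in reductive Lie algebras\<close>

text \<open>The elements of the group acting trivially on the successive quotients of the flag of \<open>n\<close>. When
  \<open>n\<close> is a stable ideal of nilpotent matrices, this is a subgroup of the unipotent radical.\<close>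

definition flag_unipotent :: "'n::finite cmat set \<Rightarrow> 'n cmat set \<Rightarrow> 'n cmat set"
  where "flag_unipotent G n = {A \<in> G. lowers_flag n (A - mat 1)}"

locale ad_stable =
  fixes G n :: "'n::finite cmat set"
  assumes G: "linear_algebraic_group G" and ad: "\<forall>A\<in>G. adjoint_action A ` n \<subseteq> n"
    and closed_n: "bracket_closed n" and nil: "\<forall>x\<in>n. nilpotent_mat x"
begin

lemma lowers_flag_group_mult:
  assumes A: "A \<in> G" and N: "lowers_flag n N"
  shows "lowers_flag n (A ** N)" "lowers_flag n (N ** A)"
proof -
  note stable = nil_flag_group_stable[OF G ad A]
  show "lowers_flag n (A ** N)"
    unfolding lowers_flag_def matrix_mul_assoc[symmetric]
    using N stable unfolding lowers_flag_def by blast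
  show "lowers_flag n (N ** A)"
    unfolding lowers_flag_def matrix_mul_assoc[symmetric]
    using N stable unfolding lowers_flag_def by blast
qed

lemma nilpotent_lowers: "lowers_flag n N \<Longrightarrow> nilpotent_mat N"
  using nil_flag_exhausts[OF closed_n nil] nilpotent_if_lowers_flag by blast

lemma flag_unipotentI:
  assumes "lowers_flag n (A - mat 1)"
    and "\<And>f. f \<in> fun_algebra coords \<Longrightarrow> \<forall>B\<in>G. f B = 0 \<Longrightarrow> f A = 0"
  shows "A \<in> flag_unipotent G n"
proof -
  have "invertible (mat 1 + (A - mat 1))"
    by (rule invertible_one_plus_nilpotent[OF nilpotent_lowers[OF assms(1)]])
  then have "A \<in> G" by (intro linear_algebraic_group_closed[OF G] assms(2)) simp_all
  then show ?thesis using assms(1) by (simp add: flag_unipotent_def)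
qed

lemma subgroup_flag_unipotent: "subgroup (flag_unipotent G n) GL"
  unfolding subgroup_GL_iff
proof (intro conjI ballI)
  note D = linear_algebraic_groupD[OF G]
  show "mat 1 \<in> flag_unipotent G n" using D(2) by (simp add: flag_unipotent_def lowers_flag_simps)
  fix A assume "A \<in> flag_unipotent G n"
  then have A: "A \<in> G" "lowers_flag n (A - mat 1)" by (auto simp: flag_unipotent_def)
  show iA: "invertible A" by (rule bspec[OF D(1) A(1)])
  have Ai: "matrix_inv A \<in> G" by (rule bspec[OF D(4) A(1)])
  have "lowers_flag n (matrix_inv A ** mscale (- 1) (A - mat 1))"
    by (intro lowers_flag_group_mult(1)[OF Ai] lowers_flag_simps A)
  moreover have "matrix_inv A ** mscale (- 1) (A - mat 1) = matrix_inv A - mat 1"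
    by (simp add: mat_simps matrix_inv_inverse[OF iA])
  ultimately show "matrix_inv A \<in> flag_unipotent G n" using Ai by (simp add: flag_unipotent_def)
  fix B assume "B \<in> flag_unipotent G n"
  then have B: "B \<in> G" "lowers_flag n (B - mat 1)" by (auto simp: flag_unipotent_def)
  have low: "lowers_flag n ((A - mat 1) ** (B - mat 1) + ((A - mat 1) + (B - mat 1)))"
    by (intro lowers_flag_simps A B)
  have eq: "(A - mat 1) ** (B - mat 1) + ((A - mat 1) + (B - mat 1)) = A ** B - mat 1"
    by (simp add: mat_simps)
  have "A ** B \<in> G" using bspec[OF bspec[OF D(3) A(1)] B(1)] .
  then show "A ** B \<in> flag_unipotent G n" using low unfolding eq flag_unipotent_def by blast
qed

text \<open>A condition of the form \<open>(A - 1) Y \<in> F\<close> for a linear subspace \<open>F\<close> is closed, because a point outside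
  \<open>F\<close> is separated from \<open>F\<close> by a linear form.\<close>

lemma linear_algebraic_flag_unipotent: "linear_algebraic_group (flag_unipotent G n)"
  unfolding linear_algebraic_group_iff
proof (intro conjI subgroup_flag_unipotent allI impI)
  let ?U = "flag_unipotent G n"
  fix B :: "'n cmat" assume B: "invertible B"
    and van: "\<forall>f\<in>fun_algebra coords. (\<forall>A\<in>?U. f A = 0) \<longrightarrow> f B = 0"
  have UG: "?U \<subseteq> G" by (auto simp: flag_unipotent_def)
  have "lowers_flag n (B - mat 1)"
    unfolding lowers_flag_def
  proof (intro allI ballI, rule ccontr)
    fix i Y assume Y: "Y \<in> nil_flag n (Suc i)" and no: "(B - mat 1) ** Y \<notin> nil_flag n i"
    obtain g where g: "clinear g" "\<forall>x\<in>nil_flag n i. g x = 0" "g ((B - mat 1) ** Y) \<noteq> 0"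
      using subspace_separation[OF subspace_nil_flag no] by blast
    then obtain a b where ab: "g ((B - mat 1) ** Y) $ a $ b \<noteq> 0" by (auto simp: vec_eq_iff)
    have lin: "clinear (\<lambda>X. g (X ** Y))"
      using clinear_compose[OF g(1) clinear_mult_right] .
    define f where "f = (\<lambda>X. g (X ** Y) $ a $ b - g Y $ a $ b)"
    have f_eq: "f X = g ((X - mat 1) ** Y) $ a $ b" for X
      by (simp add: f_def mat_simps clinear_simps[OF g(1)])
    have "f \<in> fun_algebra coords"
      unfolding f_def by (intro fun_algebra_diff fun_algebra.const clinear_coord_in lin)
    moreover have "\<forall>A\<in>?U. f A = 0"
    proof
      fix A assume "A \<in> ?U"
      then have "(A - mat 1) ** Y \<in> nil_flag n i"
        using Y unfolding flag_unipotent_def lowers_flag_def by blast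
      then show "f A = 0" using g(2) by (simp add: f_eq)
    qed
    ultimately have "f B = 0" using van by blast
    with ab show False by (simp add: f_eq)
  qed
  then show "B \<in> ?U"
  proof (rule flag_unipotentI)
    fix f :: "'n cmat \<Rightarrow> complex" assume f: "f \<in> fun_algebra coords" "\<forall>A\<in>G. f A = 0"
    have "\<forall>A\<in>?U. f A = 0" using f(2) UG by blast
    then show "f B = 0" using van f(1) by blast
  qed
qed

lemma unipotent_flag_unipotent: "\<forall>A\<in>flag_unipotent G n. unipotent A"
proof
  fix A assume "A \<in> flag_unipotent G n"
  then have "nilpotent_mat (A - mat 1)" by (intro nilpotent_lowers) (simp add: flag_unipotent_def)
  then show "unipotent A" by (simp add: unipotent_def nilpotent_mat_def)
qed

text \<open>A polynomial vanishing on the group vanishes on all natural powers of \<open>A\<close>, hence at infinitely many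
  points of the curve \<open>A ^ t\<close>, hence on the whole curve.\<close>

lemma flag_unipotent_curve:
  assumes A: "A \<in> flag_unipotent G n"
  shows "\<exists>P. (\<forall>t. P t \<in> flag_unipotent G n) \<and> P 0 = mat 1 \<and> P 1 = A \<and> (\<forall>i j. polyfun (\<lambda>t. P t $ i $ j))"
proof -
  note D = linear_algebraic_groupD[OF G]
  define N where "N = A - mat 1"
  have AG: "A \<in> G" and N: "lowers_flag n N" using A by (auto simp: flag_unipotent_def N_def)
  obtain K where K: "mpow N K = 0" using nilpotent_lowers[OF N] nilpotent_mat_mpow by blast
  then have K': "mpow N (Suc K) = 0" by (rule mpow_zero_mono) simp
  let ?P = "binomial_curve K N"
  have one: "mat 1 + N = A" by (simp add: N_def)
  have nat: "?P (of_nat m) = mpow A m" for m using binomial_curve_of_nat[OF K', of m] by (simp add: one)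
  have powG: "mpow A m \<in> G" for m
  proof (induction m)
    case (Suc m)
    then show ?case using bspec[OF bspec[OF D(3) AG]] by (simp add: mpow_Suc)
  qed (simp add: D(2))
  have "?P t \<in> flag_unipotent G n" for t
  proof (rule flag_unipotentI)
    show "lowers_flag n (?P t - mat 1)"
      using lowers_flag_power_series[OF N, where K = K and c = "\<lambda>k. t gchoose k"] by (simp add: binomial_curve_def)
    fix f :: "'n cmat \<Rightarrow> complex" assume f: "f \<in> fun_algebra coords" "\<forall>B\<in>G. f B = 0"
    have "infinite (range (of_nat :: nat \<Rightarrow> complex))"
      by (rule range_inj_infinite) (rule inj_of_nat)
    moreover have "range (of_nat :: nat \<Rightarrow> complex) \<subseteq> {t. f (?P t) = 0}"
      using f(2) powG by (auto simp: nat)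
    ultimately have "infinite {t. f (?P t) = 0}" using infinite_super by blast
    then show "f (?P t) = 0"
      by (rule polyfun_vanishing[OF polyfun_fun_algebra[OF f(1) polyfun_binomial_curve]])
  qed
  moreover have "?P 0 = mat 1" "?P 1 = A" using nat[of 0] nat[of 1] by (simp_all add: mpow_Suc)
  ultimately show ?thesis
    by (intro exI[of _ ?P] conjI allI polyfun_binomial_curve) simp_all
qed

text \<open>Every element lies on a polynomial curve through the identity. Along a curve two nonempty open sets
  meet, since two nonzero polynomials in one variable have a common nonzero.\<close>

lemma connected_flag_unipotent: "connectedin zariski_mat (flag_unipotent G n)"
proof -
  let ?U = "flag_unipotent G n"
  have meet: "E \<inter> E' \<inter> ?U \<noteq> {}"
    if E: "openin zariski_mat E" "openin zariski_mat E'" "mat 1 \<in> E" "A \<in> E'" "A \<in> ?U" for E E' A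
  proof -
    from bspec[OF E(1)[unfolded zariski_mat_def openin_zariski] E(3)]
    obtain f where f: "f \<in> fun_algebra coords" "f (mat 1) \<noteq> 0" "{y. f y \<noteq> 0} \<subseteq> E" by blast
    from bspec[OF E(2)[unfolded zariski_mat_def openin_zariski] E(4)]
    obtain g where g: "g \<in> fun_algebra coords" "g A \<noteq> 0" "{y. g y \<noteq> 0} \<subseteq> E'" by blast
    obtain P where P: "\<forall>t. P t \<in> ?U" "P 0 = mat 1" "P 1 = A" "\<forall>i j. polyfun (\<lambda>t. P t $ i $ j)"
      using flag_unipotent_curve[OF E(5)] by (elim exE conjE)
    have "polyfun (\<lambda>t. f (P t))" "polyfun (\<lambda>t. g (P t))"
      by (rule polyfun_fun_algebra[OF f(1) P(4)[rule_format]],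
          rule polyfun_fun_algebra[OF g(1) P(4)[rule_format]])
    moreover have "f (P 0) \<noteq> 0" "g (P 1) \<noteq> 0" using P f g by simp_all
    ultimately obtain u where "f (P u) \<noteq> 0" "g (P u) \<noteq> 0"
      using polyfun_both_nonzero[of "\<lambda>t. f (P t)" "\<lambda>t. g (P t)" 0 1] by blast
    then show ?thesis using f(3) g(3) P(1) by blast
  qed
  have one: "mat 1 \<in> ?U"
    using linear_algebraic_groupD(2)[OF linear_algebraic_flag_unipotent] .
  show ?thesis
    unfolding connectedin
  proof (intro conjI)
    show "?U \<subseteq> topspace zariski_mat" by (simp add: zariski_mat_def)
    show "\<nexists>E1 E2. openin zariski_mat E1 \<and> openin zariski_mat E2 \<and> ?U \<subseteq> E1 \<union> E2 \<and>
      E1 \<inter> E2 \<inter> ?U = {} \<and> E1 \<inter> ?U \<noteq> {} \<and> E2 \<inter> ?U \<noteq> {}"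
    proof clarify
      fix E1 E2 assume E: "openin zariski_mat E1" "openin zariski_mat E2" "?U \<subseteq> E1 \<union> E2"
        "E1 \<inter> E2 \<inter> ?U = {}" "E1 \<inter> ?U \<noteq> {}" "E2 \<inter> ?U \<noteq> {}"
      obtain A1 A2 where A: "A1 \<in> E1" "A1 \<in> ?U" "A2 \<in> E2" "A2 \<in> ?U" using E by blast
      from one E(3) consider "mat 1 \<in> E1" | "mat 1 \<in> E2" by blast
      then show False
      proof cases
        case 1
        from meet[OF E(1,2) 1 A(3,4)] E(4) show False by blast
      next
        case 2
        from meet[OF E(2,1) 2 A(1,2)] E(4) show False by blast
      qed
    qed
  qed
qed

lemma normal_flag_unipotent: "flag_unipotent G n \<lhd> subgroup_of_GL G"
proof -
  let ?U = "flag_unipotent G n"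
  note D = linear_algebraic_groupD[OF G]
  interpret GL: group "GL :: 'n cmat monoid" by (rule group_GL)
  have sG: "subgroup G GL" using G unfolding linear_algebraic_group_iff by (rule conjunct1)
  interpret H: group "subgroup_of_GL G" by (rule subgroup.subgroup_is_group[OF sG group_GL])
  have UG: "?U \<subseteq> G" by (auto simp: flag_unipotent_def)
  have "subgroup ?U (subgroup_of_GL G)"
    by (rule GL.subgroup_incl[OF subgroup_flag_unipotent sG UG])
  moreover have "x ** A ** matrix_inv x \<in> ?U" if x: "x \<in> G" and A: "A \<in> ?U" for x A
  proof -
    have ix: "invertible x" by (rule bspec[OF D(1) x])
    have xi: "matrix_inv x \<in> G" by (rule bspec[OF D(4) x])
    have A': "A \<in> G" "lowers_flag n (A - mat 1)" using A by (auto simp: flag_unipotent_def)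
    have "lowers_flag n (x ** (A - mat 1) ** matrix_inv x)"
      by (intro lowers_flag_group_mult x xi A')
    moreover have "x ** (A - mat 1) ** matrix_inv x = x ** A ** matrix_inv x - mat 1"
      by (simp add: mat_simps matrix_inv_inverse[OF ix])
    moreover have "x ** A ** matrix_inv x \<in> G"
      by (rule bspec[OF bspec[OF D(3) bspec[OF bspec[OF D(3) x] A'(1)]] xi])
    ultimately show ?thesis by (simp add: flag_unipotent_def)
  qed
  moreover have "inv\<^bsub>subgroup_of_GL G\<^esub> x = matrix_inv x" if x: "x \<in> G" for x
    using GL.m_inv_consistent[OF sG x] inv_GL[OF bspec[OF D(1) x]] by simp
  ultimately show ?thesis
    unfolding H.normal_inv_iff by (simp add: GL_def)
qed

end

text \<open>For \<open>x \<in> n\<close> the exponentials \<open>exp (t x)\<close> lie in the group of elements that are unipotent along the flag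
  of \<open>n\<close>. That group is normal, unipotent, closed and connected, hence trivial, and the derivative of
  the constant curve \<open>exp (t x)\<close> is \<open>x = 0\<close>.\<close>

theorem reductive_no_nilpotent_ideal:
  assumes R: "reductive_group G" and nG: "n \<subseteq> lie_algebra G" and "bracket_closed n"
    and "\<forall>A\<in>G. adjoint_action A ` n \<subseteq> n" and "\<forall>x\<in>n. nilpotent_mat x"
  shows "n \<subseteq> {0}"
proof
  fix x assume x: "x \<in> n"
  have G: "linear_algebraic_group G" using R by (simp add: reductive_group_def)
  interpret ad_stable G n using assms G by unfold_locales
  have "flag_unipotent G n = {mat 1}"
    using R normal_flag_unipotent linear_algebraic_flag_unipotent connected_flag_unipotent
      unipotent_flag_unipotent
    unfolding reductive_group_def by blast
  obtain K where K: "mpow x K = 0" using assms(5) x nilpotent_mat_mpow by blast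
  then have K': "mpow x (Suc K) = 0" by (rule mpow_zero_mono) simp
  have "exp_curve K x t = mat 1" for t
  proof -
    have low: "lowers_flag n (exp_curve K x t - mat 1)"
      using lowers_flag_power_series[OF lowers_flag_member[OF x], where K = K and c = "\<lambda>k. t ^ k / fact k"]
      by (simp add: exp_curve_def)
    have "invertible (mat 1 + (exp_curve K x t - mat 1))"
      by (rule invertible_one_plus_nilpotent[OF nilpotent_lowers[OF low]])
    then have "exp_curve K x t \<in> G"
      using nG x by (intro exp_curve_in_group[OF G _ K']) auto
    with low have "exp_curve K x t \<in> flag_unipotent G n" by (simp add: flag_unipotent_def)
    then show ?thesis using \<open>flag_unipotent G n = {mat 1}\<close> by blast
  qed
  then have const: "exp_curve K x = (\<lambda>t. mat 1)" by blast
  have "x $ i $ j = 0" for i j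
    using exp_curve_derivative[OF K', of i j 0] unfolding const
    by (simp add: DERIV_unique[OF _ DERIV_const])
  then show "x \<in> {0}" by (simp add: vec_eq_iff)
qed

section \<open>Cartan subalgebras of reductive Lie algebras\<close>

lemma gen_eigenspace_zero: "gen_eigenspace f 0 = {v. \<exists>k. (f ^^ k) v = 0}"
  by (simp add: gen_eigenspace_def)

lemma mpow_conj:
  assumes "invertible A"
  shows "mpow (adjoint_action A x) k = A ** mpow x k ** matrix_inv A"
proof (induction k)
  case 0
  show ?case by (simp add: matrix_inv_inverse[OF assms])
next
  case (Suc k)
  then show ?case
    by (simp add: mpow_Suc adjoint_action_def matrix_mul_assoc matrix_inv_cancel[OF assms])
qed

lemma nilpotent_adjoint: "invertible A \<Longrightarrow> nilpotent_mat x \<Longrightarrow> nilpotent_mat (adjoint_action A x)"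
  unfolding nilpotent_mat_mpow using mpow_conj[of A x] by (metis matrix_zero_mult)

lemma mpow_commute_other:
  assumes "z ** y = y ** z" shows "mpow z k ** y = y ** mpow z k"
proof (induction k)
  case (Suc k)
  have "z ** mpow z k ** y = z ** (y ** mpow z k)" by (simp only: matrix_mul_assoc[symmetric] Suc)
  also have "\<dots> = y ** (z ** mpow z k)" by (simp only: matrix_mul_assoc assms)
  finally show ?case by (simp only: mpow_Suc)
qed simp

lemma nilpotent_commuting_mult:
  assumes "nilpotent_mat z" and zy: "z ** y = y ** z" shows "nilpotent_mat (z ** y)"
proof -
  have "mpow (z ** y) k = mpow z k ** mpow y k" for k
  proof (induction k)
    case (Suc k)
    have "z ** y ** (mpow z k ** mpow y k) = z ** (y ** mpow z k) ** mpow y k"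
      by (simp only: matrix_mul_assoc)
    also have "\<dots> = z ** (mpow z k ** y) ** mpow y k" by (simp only: mpow_commute_other[OF zy])
    finally show ?case by (simp only: mpow_Suc Suc matrix_mul_assoc)
  qed simp
  then show ?thesis using assms(1) unfolding nilpotent_mat_mpow by (metis matrix_zero_mult(1))
qed

text \<open>The binomial formula for commuting matrices, in the form of a count: each factor \<open>x + y\<close> uses up one
  power of \<open>x\<close> or one power of \<open>y\<close>.\<close>

lemma nilpotent_commuting_add:
  fixes x y :: "'n::finite cmat"
  assumes "nilpotent_mat x" "nilpotent_mat y" and xy: "x ** y = y ** x"
  shows "nilpotent_mat (x + y)"
proof -
  obtain k l where kl: "mpow x k = 0" "mpow y l = 0" using assms nilpotent_mat_mpow by metis
  have "(((**) (x + y)) ^^ m) Y = 0"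
    if "(((**) x) ^^ k) Y = 0" "(((**) y) ^^ l) Y = 0" "k + l \<le> m" for k l m and Y :: "'n cmat"
    using that
  proof (induction m arbitrary: k l Y)
    case 0
    then show ?case by simp
  next
    case (Suc m)
    note lin = clinear_simps[OF clinear_funpow[OF clinear_mult_left]]
    have com: "(((**) y) ^^ j) (x ** Y) = x ** (((**) y) ^^ j) Y"
         "(((**) x) ^^ j) (y ** Y) = y ** (((**) x) ^^ j) Y" for j
      using mpow_commute_other[OF xy] mpow_commute_other[OF xy[symmetric]]
      by (simp_all add: funpow_mult_mpow matrix_mul_assoc)
    show ?case
    proof (cases "k = 0 \<or> l = 0")
      case True
      then have "Y = 0" using Suc.prems by auto
      then show ?thesis by (simp add: lin)
    next
      case False
      then obtain k' l' where kl': "k = Suc k'" "l = Suc l'" by (meson not0_implies_Suc)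
      \<comment> \<open>\<open>x Y\<close> needs one power of \<open>x\<close> less, \<open>y Y\<close> one power of \<open>y\<close> less.\<close>
      have x1: "(((**) x) ^^ k') (x ** Y) = 0" and y1: "(((**) y) ^^ l') (y ** Y) = 0"
        using Suc.prems(1,2) unfolding kl' funpow_Suc_zero_iff by simp_all
      have x2: "(((**) x) ^^ k) (y ** Y) = 0" and y2: "(((**) y) ^^ l) (x ** Y) = 0"
        by (simp_all only: com Suc.prems(1,2) matrix_zero_mult)
      have "(((**) (x + y)) ^^ m) (x ** Y) = 0"
        by (rule Suc.IH[OF x1 y2]) (use Suc.prems(3) kl' in simp)
      moreover have "(((**) (x + y)) ^^ m) (y ** Y) = 0"
        by (rule Suc.IH[OF x2 y1]) (use Suc.prems(3) kl' in simp)
      ultimately show ?thesis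
        unfolding funpow_Suc_zero_iff by (simp add: matrix_add_rdistrib lin)
    qed
  qed
  from this[of k "mat 1" l "k + l"] show ?thesis
    using kl unfolding nilpotent_mat_mpow by (auto simp: funpow_mult_mpow)
qed

definition trace_radical :: "'n::finite cmat set \<Rightarrow> 'n cmat set"
  where "trace_radical g = {x \<in> g. \<forall>y\<in>g. trace (x ** y) = 0}"

lemma trace_radical_subspace:
  assumes "cmat.subspace g" shows "cmat.subspace (trace_radical g)"
  using assms
  by (intro cmat.subspaceI)
    (auto simp: trace_radical_def mat_simps trace_simps
      intro: cmat.subspace_0 cmat.subspace_add cmat.subspace_scale)

lemma trace_radical_ideal:
  assumes "\<And>x y. x \<in> g \<Longrightarrow> y \<in> g \<Longrightarrow> bracket x y \<in> g" "x \<in> trace_radical g" "y \<in> g"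
  shows "bracket x y \<in> trace_radical g"
  using assms by (auto simp: trace_radical_def trace_bracket(2))

text \<open>Cartan's criterion. With \<open>D\<close> as in \<open>nilpotency_test_element\<close>, \<open>trace ([a, b] D) = trace (b [D, a])\<close>
  vanishes because \<open>[D, a]\<close> is again in \<open>r\<close>; by linearity \<open>trace (x D) = 0\<close>.\<close>

lemma span_brackets_nilpotent:
  assumes r: "cmat.subspace r" and cl: "\<And>a b. a \<in> r \<Longrightarrow> b \<in> r \<Longrightarrow> bracket a b \<in> r"
    and tr: "\<And>a b. a \<in> r \<Longrightarrow> b \<in> r \<Longrightarrow> trace (a ** b) = 0"
    and x: "x \<in> cmat.span {bracket a b | a b. a \<in> r \<and> b \<in> r}"
  shows "nilpotent_mat x"
proof -
  obtain D where D: "\<And>\<mu> a. a \<in> gen_eigenspace (bracket x) \<mu> \<Longrightarrow> bracket D a = mscale (cnj \<mu>) a"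
    "trace (x ** D) = 0 \<Longrightarrow> nilpotent_mat x"
    using nilpotency_test_element[of x] by blast
  have xr: "x \<in> r"
    using x cmat.span_minimal[of "{bracket a b | a b. a \<in> r \<and> b \<in> r}" r] r cl by blast
  have Dr: "bracket D a \<in> r" if a: "a \<in> r" for a
  proof -
    have st: "bracket x ` r \<subseteq> r" using cl xr by blast
    obtain \<Lambda> c where c: "\<forall>\<mu>. c \<mu> \<in> r \<inter> gen_eigenspace (bracket x) \<mu>" "a = (\<Sum>\<mu>\<in>\<Lambda>. c \<mu>)"
      using primary_decomposition_sum[OF clinear_bracket r st a] by blast
    have "bracket D a = (\<Sum>\<mu>\<in>\<Lambda>. bracket D (c \<mu>))"
      unfolding c(2) by (rule clinear_simps(6)[OF clinear_bracket])
    also have "\<dots> = (\<Sum>\<mu>\<in>\<Lambda>. mscale (cnj \<mu>) (c \<mu>))"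
      using c(1) by (intro sum.cong refl D(1)) blast
    also have "\<dots> \<in> r" using c(1) by (intro cmat.subspace_sum[OF r] cmat.subspace_scale[OF r]) blast
    finally show ?thesis .
  qed
  have "trace (y ** D) = 0" if "y \<in> cmat.span {bracket a b | a b. a \<in> r \<and> b \<in> r}" for y
    using that
  proof (induction rule: cmat.span_induct_alt)
    case (step c y z)
    then obtain a b where "y = bracket a b" "a \<in> r" "b \<in> r" by blast
    then have "trace (y ** D) = 0" using tr Dr by (simp add: trace_bracket(1))
    then show ?case using step by (simp add: mat_simps trace_simps)
  qed (simp add: matrix_zero_mult trace_simps)
  then show ?thesis using D(2) x by blast
qed

text \<open>The radical \<open>r\<close> of the trace form is an ideal stable under the group. By Cartan's criterion its derived
  algebra consists of nilpotent matrices, hence is zero. So \<open>r\<close> is abelian, its nilpotent elements form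
  a subspace, and this subspace is again a stable ideal of nilpotent matrices.\<close>

lemma reductive_trace_radical_no_nilpotent:
  assumes R: "reductive_group G" and z: "z \<in> trace_radical (lie_algebra G)" "nilpotent_mat z"
  shows "z = 0"
proof -
  define g where "g = lie_algebra G"
  define r where "r = trace_radical g"
  have G: "linear_algebraic_group G" using R by (simp add: reductive_group_def)
  have sg: "cmat.subspace g" and cg: "\<And>x y. x \<in> g \<Longrightarrow> y \<in> g \<Longrightarrow> bracket x y \<in> g"
    unfolding g_def by (rule lie_algebra_subspace, rule lie_algebra_bracket[OF G])
  have sr: "cmat.subspace r" unfolding r_def by (rule trace_radical_subspace[OF sg])
  have rg: "r \<subseteq> g" by (auto simp: r_def trace_radical_def)
  have cr: "bracket a b \<in> r" if "a \<in> r" "b \<in> r" for a b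
    using trace_radical_ideal[of g a b] cg that rg by (auto simp: r_def)
  have tr: "trace (a ** b) = 0" if "a \<in> r" "b \<in> r" for a b
    using that rg by (auto simp: r_def trace_radical_def)
  have inv: "invertible A" if "A \<in> G" for A by (rule bspec[OF linear_algebraic_groupD(1)[OF G] that])
  have adr: "adjoint_action A x \<in> r" if A: "A \<in> G" and x: "x \<in> r" for A x
  proof -
    have Ai: "matrix_inv A \<in> G" by (rule bspec[OF linear_algebraic_groupD(4)[OF G] A])
    have "trace (adjoint_action A x ** y) = 0" if y: "y \<in> g" for y
    proof -
      have "adjoint_action (matrix_inv A) y \<in> g"
        unfolding g_def by (rule lie_algebra_adjoint[OF G y[unfolded g_def] Ai])
      then have "trace (x ** adjoint_action (matrix_inv A) y) = 0"
        using x by (auto simp: r_def trace_radical_def)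
      moreover have "adjoint_action A x ** y = A ** (x ** (matrix_inv A ** y))"
        by (simp only: adjoint_action_def matrix_mul_assoc)
      moreover have "matrix_inv (matrix_inv A) = A"
        by (rule matrix_inv_unique) (rule matrix_inv_inverse[OF inv[OF A]])
      then have "x ** adjoint_action (matrix_inv A) y = x ** (matrix_inv A ** y) ** A"
        by (simp only: adjoint_action_def matrix_mul_assoc)
      ultimately show ?thesis by (simp only: trace_mul_sym[of A])
    qed
    moreover have "adjoint_action A x \<in> g"
      using lie_algebra_adjoint[OF G _ A] x rg unfolding g_def by blast
    ultimately show ?thesis by (simp add: r_def trace_radical_def)
  qed
  define d where "d = cmat.span {bracket a b | a b. a \<in> r \<and> b \<in> r}"
  have dr: "d \<subseteq> r" unfolding d_def by (rule cmat.span_minimal[OF _ sr]) (use cr in blast)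
  have "d \<subseteq> {0}"
  proof (rule reductive_no_nilpotent_ideal[OF R])
    show "d \<subseteq> lie_algebra G" using dr rg by (simp add: g_def)
    have "bracket x y \<in> d" if "x \<in> d" "y \<in> d" for x y
      using that dr unfolding d_def by (blast intro: cmat.span_base)
    then show "bracket_closed d" by (simp add: bracket_closed_def d_def)
    show "\<forall>A\<in>G. adjoint_action A ` d \<subseteq> d"
    proof (intro ballI subsetI)
      fix A y assume A: "A \<in> G" and "y \<in> adjoint_action A ` d"
      then obtain x where "x \<in> d" and y: "y = adjoint_action A x" by blast
      from \<open>x \<in> d\<close> have "adjoint_action A x \<in> d"
        unfolding d_def
      proof (induction rule: cmat.span_induct_alt)
        case base
        then show ?case by (simp add: clinear_simps[OF clinear_adjoint] cmat.span_zero)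
      next
        case (step c x w)
        then obtain a b where ab: "x = bracket a b" "a \<in> r" "b \<in> r" by blast
        have "adjoint_action A x = bracket (adjoint_action A a) (adjoint_action A b)"
          unfolding ab by (rule adjoint_bracket[OF inv[OF A]])
        then have "adjoint_action A x \<in> {bracket a b | a b. a \<in> r \<and> b \<in> r}"
          using adr[OF A] ab by blast
        then show ?case using step
          by (simp add: clinear_simps[OF clinear_adjoint] cmat.span_add cmat.span_scale cmat.span_base)
      qed
      then show "y \<in> d" by (simp only: y)
    qed
    show "\<forall>x\<in>d. nilpotent_mat x"
      unfolding d_def by (intro ballI span_brackets_nilpotent[OF sr cr tr])
  qed
  then have abel: "bracket a b = 0" if "a \<in> r" "b \<in> r" for a b
    using that unfolding d_def by (blast intro: cmat.span_base)
  then have com: "a ** b = b ** a" if "a \<in> r" "b \<in> r" for a b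
    using that by (simp add: bracket_def)
  define n where "n = {x \<in> r. nilpotent_mat x}"
  have "n \<subseteq> {0}"
  proof (rule reductive_no_nilpotent_ideal[OF R])
    show "n \<subseteq> lie_algebra G" using rg by (auto simp: n_def g_def)
    have "nilpotent_mat (0 :: 'a cmat)" unfolding nilpotent_mat_mpow
      by (rule exI[of _ 1]) (simp add: mpow_Suc matrix_zero_mult)
    then have n0: "0 \<in> n" using cmat.subspace_0[OF sr] by (simp add: n_def)
    have "cmat.subspace n"
    proof (rule cmat.subspaceI[OF n0])
      show "x + y \<in> n" if "x \<in> n" "y \<in> n" for x y
        using that cmat.subspace_add[OF sr] nilpotent_commuting_add[of x y] com[of x y] by (simp add: n_def)
      show "mscale c x \<in> n" if "x \<in> n" for c x
        using that cmat.subspace_scale[OF sr] nilpotent_mscale[of x c] by (simp add: n_def)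
    qed
    moreover have "bracket x y \<in> n" if "x \<in> n" "y \<in> n" for x y
      using that abel n0 by (simp add: n_def)
    ultimately show "bracket_closed n" by (simp add: bracket_closed_def)
    show "\<forall>A\<in>G. adjoint_action A ` n \<subseteq> n"
      using adr inv by (auto simp: n_def nilpotent_adjoint)
    show "\<forall>x\<in>n. nilpotent_mat x" by (simp add: n_def)
  qed
  then show ?thesis using z by (auto simp: n_def r_def g_def)
qed

lemma nilpotent_lie_ad_nilpotent:
  assumes "nilpotent_lie h" "x \<in> h" "y \<in> h" shows "\<exists>k. (bracket x ^^ k) y = 0"
proof -
  obtain k where k: "lower_central h k = {0}" using assms(1) by (auto simp: nilpotent_lie_def)
  have "(bracket x ^^ j) y \<in> lower_central h j" for j
  proof (induction j)
    case (Suc j)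
    then show ?case using assms(2) by (auto intro!: cmat.span_base)
  qed (use assms in simp)
  from this[of k] k show ?thesis by auto
qed

lemma lower_central_subset:
  assumes "cmat.subspace h" "\<forall>x\<in>h. \<forall>y\<in>h. bracket x y \<in> h"
  shows "lower_central h k \<subseteq> h"
proof (induction k)
  case (Suc k)
  show ?case unfolding lower_central.simps
    by (rule cmat.span_minimal[OF _ assms(1)]) (use Suc assms(2) in blast)
qed simp

text \<open>The last nonzero term of the lower central series is central, and it is spanned by brackets because
  the algebra is not abelian.\<close>

lemma nonabelian_nilpotent_center:
  assumes nil: "nilpotent_lie h" and sub: "cmat.subspace h" and cl: "\<forall>x\<in>h. \<forall>y\<in>h. bracket x y \<in> h"
    and ab: "a \<in> h" "b \<in> h" "bracket a b \<noteq> 0"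
  shows "\<exists>z\<in>h. z \<noteq> 0 \<and> (\<forall>x\<in>h. bracket x z = 0) \<and> z \<in> cmat.span {bracket x y | x y. x \<in> h \<and> y \<in> h}"
proof -
  obtain k where k: "lower_central h k = {0}" using nil by (auto simp: nilpotent_lie_def)
  have one: "bracket a b \<in> lower_central h (Suc 0)" using ab by (auto intro: cmat.span_base)
  have "\<exists>m. lower_central h (Suc m) \<noteq> {0} \<and> lower_central h (Suc (Suc m)) = {0}"
  proof (rule ccontr)
    assume no: "\<nexists>m. lower_central h (Suc m) \<noteq> {0} \<and> lower_central h (Suc (Suc m)) = {0}"
    have "lower_central h (Suc m) \<noteq> {0}" for m
    proof (induction m)
      case 0
      show ?case using one ab(3) by blast
    next
      case (Suc m)
      with no show ?case by blast
    qed
    moreover have "lower_central h (Suc k) = {0}"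
    proof -
      have "{bracket x y | x y. x \<in> h \<and> y \<in> lower_central h k} \<subseteq> {0}"
        using k by (auto simp: bracket_simps)
      then show ?thesis using cmat.span_minimal[OF _ cmat.subspace_single_0] cmat.span_zero
        unfolding lower_central.simps by blast
    qed
    ultimately show False by blast
  qed
  then obtain m where m: "lower_central h (Suc m) \<noteq> {0}" "lower_central h (Suc (Suc m)) = {0}" by blast
  then obtain z where z: "z \<in> lower_central h (Suc m)" "z \<noteq> 0"
    using cmat.span_zero unfolding lower_central.simps by blast
  have "bracket x z \<in> lower_central h (Suc (Suc m))" if "x \<in> h" for x
    unfolding lower_central.simps(2)[of h "Suc m"] using that z(1) by (intro cmat.span_base) blast
  then have "\<forall>x\<in>h. bracket x z = 0" using m(2) by blast
  moreover have "z \<in> h" using lower_central_subset[OF sub cl] z(1) by blast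
  moreover have "z \<in> cmat.span {bracket x y | x y. x \<in> h \<and> y \<in> h}"
  proof -
    have "{bracket x y | x y. x \<in> h \<and> y \<in> lower_central h m} \<subseteq> {bracket x y | x y. x \<in> h \<and> y \<in> h}"
      using lower_central_subset[OF sub cl] by blast
    from cmat.span_mono[OF this] z(1) show ?thesis unfolding lower_central.simps by blast
  qed
  ultimately show ?thesis using z(2) by blast
qed

text \<open>Take an \<open>h\<close>-stable subspace \<open>S\<close> of least dimension on which \<open>\<phi>\<close> is not zero, and decompose it under
  \<open>ad x\<close> for \<open>x \<in> h\<close>. On components with nonzero eigenvalue \<open>ad x\<close> is onto, so \<open>\<phi>\<close> vanishes there; the
  component for \<open>0\<close> is \<open>h\<close>-stable, so it is all of \<open>S\<close>. Thus \<open>S\<close> lies in the space \<open>M\<close> on which \<open>h\<close>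
  acts nilpotently. If \<open>M\<close> were larger than \<open>h\<close>, Engel's theorem would give an element of \<open>M\<close> outside
  \<open>h\<close> normalizing \<open>h\<close>. Hence \<open>S \<subseteq> h\<close>, where \<open>\<phi>\<close> vanishes.\<close>

lemma cartan_functional_zero:
  fixes \<phi> :: "'n::finite cmat \<Rightarrow> complex"
  assumes h: "cartan_subalgebra h g" and sg: "cmat.subspace g"
    and cg: "\<And>x y. x \<in> g \<Longrightarrow> y \<in> g \<Longrightarrow> bracket x y \<in> g"
    and \<phi>_sum: "\<And>A c. \<phi> (\<Sum>a\<in>A. c a) = (\<Sum>a\<in>A. \<phi> (c (a :: complex)))"
    and \<phi>_h: "\<And>x. x \<in> h \<Longrightarrow> \<phi> x = 0"
    and \<phi>_bracket: "\<And>x v. x \<in> h \<Longrightarrow> v \<in> g \<Longrightarrow> \<phi> (bracket x v) = 0"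
    and v: "v \<in> g"
  shows "\<phi> v = 0"
proof (rule ccontr)
  assume nz: "\<phi> v \<noteq> 0"
  have sh: "cmat.subspace h" and hg: "h \<subseteq> g" and ch: "\<forall>x\<in>h. \<forall>y\<in>h. bracket x y \<in> h"
    and nil: "nilpotent_lie h" and norm: "{x \<in> g. \<forall>y\<in>h. bracket x y \<in> h} = h"
    using h by (auto simp: cartan_subalgebra_def lie_subalgebra_def)
  have stable: "bracket y w \<in> gen_eigenspace (bracket x) 0"
    if xyw: "x \<in> h" "y \<in> h" "w \<in> gen_eigenspace (bracket x) 0" for x y w
  proof -
    obtain m where "(bracket x ^^ m) y = 0" using nilpotent_lie_ad_nilpotent[OF nil xyw(1,2)] by blast
    moreover obtain k where "(bracket x ^^ k) w = 0" using xyw(3) by (auto simp: gen_eigenspace_zero)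
    ultimately have "(bracket x ^^ (m + k)) (bracket y w) = 0"
      by (intro leibniz_nilpotent[OF clinear_bracket, where g = "bracket x" and h = "bracket x"])
        (auto simp: bracket_simps bracket_jacobi[of x])
    then show ?thesis by (auto simp: gen_eigenspace_zero)
  qed
  define Pr where "Pr S \<longleftrightarrow> cmat.subspace S \<and> S \<subseteq> g \<and> (\<forall>x\<in>h. bracket x ` S \<subseteq> S) \<and> (\<exists>v\<in>S. \<phi> v \<noteq> 0)" for S
  have "Pr g" using sg cg hg v nz by (auto simp: Pr_def)
  then have "\<exists>S. Pr S \<and> (\<forall>S'. Pr S' \<longrightarrow> cmat.dim S \<le> cmat.dim S')"
    by (rule ex_has_least_nat)
  then obtain S where S: "Pr S" and min: "\<And>S'. Pr S' \<Longrightarrow> cmat.dim S \<le> cmat.dim S'" by blast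
  have sS: "cmat.subspace S" and Sg: "S \<subseteq> g" and hS: "\<forall>x\<in>h. bracket x ` S \<subseteq> S"
    using S by (auto simp: Pr_def)
  obtain w where w: "w \<in> S" "\<phi> w \<noteq> 0" using S by (auto simp: Pr_def)
  define M where "M = g \<inter> (\<Inter>x\<in>h. gen_eigenspace (bracket x) 0)"
  have "S \<subseteq> gen_eigenspace (bracket x) 0" if x: "x \<in> h" for x
  proof -
    let ?S' = "S \<inter> gen_eigenspace (bracket x) 0"
    have st: "bracket x ` S \<subseteq> S" using hS x by blast
    obtain \<Lambda> c where c: "\<forall>\<mu>. c \<mu> \<in> S \<inter> gen_eigenspace (bracket x) \<mu>" "w = (\<Sum>\<mu>\<in>\<Lambda>. c \<mu>)"
      using primary_decomposition_sum[OF clinear_bracket sS st w(1)] by blast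
    have "(\<Sum>\<mu>\<in>\<Lambda>. \<phi> (c \<mu>)) \<noteq> 0" using w(2) unfolding c(2) \<phi>_sum .
    then obtain \<mu> where \<mu>: "\<phi> (c \<mu>) \<noteq> 0" by (meson sum.neutral)
    have "\<mu> = 0"
    proof (rule ccontr)
      assume "\<mu> \<noteq> 0"
      then obtain u where "u \<in> S" "bracket x u - mscale 0 u = c \<mu>"
        using gen_eigenspace_shift_onto[OF clinear_bracket sS st, of "c \<mu>" \<mu> 0] c(1) by blast
      then have "\<phi> (c \<mu>) = 0" using \<phi>_bracket[OF x] Sg by force
      with \<mu> show False by blast
    qed
    have "Pr ?S'"
      unfolding Pr_def
    proof (intro conjI)
      show "cmat.subspace ?S'"
        by (rule cmat.subspace_inter[OF sS subspace_gen_eigenspace[OF clinear_bracket]])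
      show "\<forall>y\<in>h. bracket y ` ?S' \<subseteq> ?S'" using hS stable[OF x] by blast
      show "\<exists>v\<in>?S'. \<phi> v \<noteq> 0" using c(1) \<mu> \<open>\<mu> = 0\<close> by blast
    qed (use Sg in blast)
    then have "?S' = S"
      using cfd.subspace_dim_equal[of ?S' S] min sS by (simp add: Pr_def)
    then show ?thesis by blast
  qed
  then have SM: "S \<subseteq> M" using Sg by (auto simp: M_def)
  have sM: "cmat.subspace M"
    unfolding M_def
    by (intro cmat.subspace_inter sg cmat.subspace_Inter) (auto intro: subspace_gen_eigenspace[OF clinear_bracket])
  have hM: "h \<subseteq> M"
    using hg nilpotent_lie_ad_nilpotent[OF nil] by (auto simp: M_def gen_eigenspace_zero)
  have "M = h"
  proof (rule ccontr)
    assume "M \<noteq> h"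
    have "\<exists>v\<in>M - h. \<forall>x\<in>h. bracket x v \<in> h"
    proof (rule engel[OF _ _ lie_action_bracket sM sh])
      show "bracket_closed h" using sh ch by (simp add: bracket_closed_def)
      show "\<forall>x\<in>h. \<forall>y\<in>h. \<exists>k. (bracket x ^^ k) y = 0" using nilpotent_lie_ad_nilpotent[OF nil] by blast
      show "h \<subset> M" using hM \<open>M \<noteq> h\<close> by blast
      show "\<forall>x\<in>h. bracket x ` M \<subseteq> M" using stable cg hg by (fastforce simp: M_def)
      show "\<forall>x\<in>h. bracket x ` h \<subseteq> h" using ch by blast
      show "\<forall>x\<in>h. \<forall>v\<in>M. \<exists>k. (bracket x ^^ k) v \<in> h"
      proof (intro ballI)
        fix x v assume "x \<in> h" "v \<in> M"
        then obtain k where "(bracket x ^^ k) v = 0" by (auto simp: M_def gen_eigenspace_zero)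
        then show "\<exists>k. (bracket x ^^ k) v \<in> h" using cmat.subspace_0[OF sh] by (intro exI[of _ k]) simp
      qed
    qed
    then obtain v where v: "v \<in> M" "v \<notin> h" "\<forall>x\<in>h. bracket x v \<in> h" by blast
    have "bracket v x \<in> h" if "x \<in> h" for x
      using v(3) that cmat.subspace_neg[OF sh] by (subst bracket_anti) blast
    then have "v \<in> {x \<in> g. \<forall>y\<in>h. bracket x y \<in> h}" using v(1) by (auto simp: M_def)
    with norm v(2) show False by blast
  qed
  with SM w \<phi>_h show False by blast
qed

text \<open>Otherwise there is a nonzero central \<open>z\<close> in the derived algebra of \<open>h\<close>. It is nilpotent: the test
  element \<open>D\<close> commutes with \<open>h\<close> since \<open>z\<close> does, and then \<open>trace (z D) = 0\<close>. For \<open>y \<in> h\<close> the product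
  \<open>z y\<close> is nilpotent, and \<open>trace (z [x, v]) = trace ([z, x] v) = 0\<close> for \<open>x \<in> h\<close>; so the linear form
  \<open>trace (z y)\<close> vanishes on the whole Lie algebra. A reductive group has no nonzero nilpotent element
  in the radical of the trace form.\<close>

theorem cartan_subalgebra_abelian:
  assumes R: "reductive_group G" and h: "cartan_subalgebra h (lie_algebra G)" and ab: "a \<in> h" "b \<in> h"
  shows "bracket a b = 0"
proof (rule ccontr)
  assume nz: "bracket a b \<noteq> 0"
  define g where "g = lie_algebra G"
  have G: "linear_algebraic_group G" using R by (simp add: reductive_group_def)
  have sg: "cmat.subspace g" and cg: "\<And>x y. x \<in> g \<Longrightarrow> y \<in> g \<Longrightarrow> bracket x y \<in> g"
    unfolding g_def by (rule lie_algebra_subspace, rule lie_algebra_bracket[OF G])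
  have sh: "cmat.subspace h" and hg: "h \<subseteq> g" and ch: "\<forall>x\<in>h. \<forall>y\<in>h. bracket x y \<in> h"
    and nil: "nilpotent_lie h"
    using h by (auto simp: cartan_subalgebra_def lie_subalgebra_def g_def)
  obtain z where z: "z \<in> h" "z \<noteq> 0" and cent: "\<forall>x\<in>h. bracket x z = 0"
    and zspan: "z \<in> cmat.span {bracket x y | x y. x \<in> h \<and> y \<in> h}"
    using nonabelian_nilpotent_center[OF nil sh ch ab nz] by blast
  have zx: "bracket z x = 0" if "x \<in> h" for x
    using cent that bracket_anti[of z x] by simp
  have znil: "nilpotent_mat z"
  proof -
    obtain D where D: "\<And>\<mu> a. a \<in> gen_eigenspace (bracket z) \<mu> \<Longrightarrow> bracket D a = mscale (cnj \<mu>) a"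
      "trace (z ** D) = 0 \<Longrightarrow> nilpotent_mat z"
      using nilpotency_test_element[of z] by blast
    have D0: "bracket D a = 0" if "a \<in> h" for a
    proof -
      have "(bracket z ^^ 1) a = 0" using zx[OF that] by simp
      then have "a \<in> gen_eigenspace (bracket z) 0" unfolding gen_eigenspace_zero by blast
      then show ?thesis using D(1) by fastforce
    qed
    have "trace (y ** D) = 0" if "y \<in> cmat.span {bracket x y | x y. x \<in> h \<and> y \<in> h}" for y
      using that
    proof (induction rule: cmat.span_induct_alt)
      case (step c y w)
      then obtain a b where "y = bracket a b" "a \<in> h" "b \<in> h" by blast
      then have "trace (y ** D) = 0" using D0 by (simp add: trace_bracket(1) matrix_zero_mult trace_simps)
      then show ?case using step by (simp add: mat_simps trace_simps)
    qed (simp add: matrix_zero_mult trace_simps)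
    then show ?thesis using D(2) zspan by blast
  qed
  have "trace (z ** y) = 0" if y: "y \<in> g" for y
  proof (rule cartan_functional_zero[of h g "\<lambda>y. trace (z ** y)", OF _ sg cg])
    show "cartan_subalgebra h g" using h by (simp add: g_def)
    show "trace (z ** (\<Sum>a\<in>A. c a)) = (\<Sum>a\<in>A. trace (z ** c a))" for A and c :: "complex \<Rightarrow> _"
      by (simp add: matrix_sum_distrib trace_simps)
    show "trace (z ** x) = 0" if "x \<in> h" for x
      using zx[OF that] by (intro trace_nilpotent nilpotent_commuting_mult[OF znil]) (simp add: bracket_def)
    show "trace (z ** bracket x v) = 0" if "x \<in> h" for x v
      using trace_bracket(2)[of z x v] zx[OF that] by (simp add: matrix_zero_mult trace_simps)
  qed (use y in auto)
  then have "z \<in> trace_radical g" using z hg by (auto simp: trace_radical_def)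
  then have "z = 0" using reductive_trace_radical_no_nilpotent[OF R _ znil] by (simp add: g_def)
  with z show False by blast
qed

section \<open>Equivariance under the fixed-point group\<close>

global_interpretation cfpair: finite_dimensional_vector_space_pair_1 mscale unit_mats mscale
  by unfold_locales

text \<open>The difference of the two functions lies in the vanishing ideal of the group. This is why the
  differential of an involution is independent of the chosen extensions of its entries.\<close>

lemma derivation_cong:
  assumes "X \<in> lie_algebra G" "f \<in> regular_functions" "f' \<in> regular_functions" "\<And>A. A \<in> G \<Longrightarrow> f A = f' A"
  shows "derivation_at_one X f = derivation_at_one X f'"
proof -
  have "(\<lambda>x. f x - f' x) \<in> regular_functions" by (intro regular_intros assms)
  then have "derivation_at_one X (\<lambda>x. f x - f' x) = 0"
    using assms(1,4) unfolding lie_algebra_def by simp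
  then show ?thesis using assms by (simp add: derivation_at_one_lderiv lderiv_diff)
qed

lemma dim_adjoint:
  assumes "invertible A" shows "cmat.dim (adjoint_action A ` S) = cmat.dim S"
proof (rule cfpair.dim_image_eq[OF clinear_adjoint])
  show "inj_on (adjoint_action A) (cmat.span S)"
    by (rule inj_on_inverseI[of _ "adjoint_action (matrix_inv A)"]) (rule adjoint_inv[OF assms])
qed

lemma adjoint_image_inv:
  assumes "invertible A"
  shows "adjoint_action (matrix_inv A) ` adjoint_action A ` S = S"
    "adjoint_action A ` adjoint_action (matrix_inv A) ` S = S"
  by (simp_all add: image_image adjoint_inv[OF assms])

lemma lower_central_adjoint:
  assumes "invertible A"
  shows "lower_central (adjoint_action A ` h) k = adjoint_action A ` lower_central h k"
proof (induction k)
  case (Suc k)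
  have "{bracket x y | x y. x \<in> adjoint_action A ` h \<and> y \<in> adjoint_action A ` lower_central h k}
      = adjoint_action A ` {bracket x y | x y. x \<in> h \<and> y \<in> lower_central h k}"
  proof (intro equalityI subsetI)
    fix w assume "w \<in> {bracket x y | x y. x \<in> adjoint_action A ` h \<and> y \<in> adjoint_action A ` lower_central h k}"
    then obtain x y where "w = bracket (adjoint_action A x) (adjoint_action A y)" "x \<in> h" "y \<in> lower_central h k"
      by blast
    then have "w = adjoint_action A (bracket x y)"
      "bracket x y \<in> {bracket x y | x y. x \<in> h \<and> y \<in> lower_central h k}"
      using adjoint_bracket[OF assms, of x y] by auto
    then show "w \<in> adjoint_action A ` {bracket x y | x y. x \<in> h \<and> y \<in> lower_central h k}"
      by (rule image_eqI)
  next
    fix w assume "w \<in> adjoint_action A ` {bracket x y | x y. x \<in> h \<and> y \<in> lower_central h k}"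
    then obtain x y where "w = adjoint_action A (bracket x y)" "x \<in> h" "y \<in> lower_central h k"
      by blast
    then show "w \<in> {bracket x y | x y. x \<in> adjoint_action A ` h \<and> y \<in> adjoint_action A ` lower_central h k}"
      using adjoint_bracket[OF assms, of x y] by auto
  qed
  then show ?case
    unfolding lower_central.simps Suc by (simp add: cpair.linear_span_image[OF clinear_adjoint])
qed simp

lemma cartan_subalgebra_adjoint:
  assumes G: "linear_algebraic_group G" and A: "A \<in> G" and h: "cartan_subalgebra h (lie_algebra G)"
  shows "cartan_subalgebra (adjoint_action A ` h) (lie_algebra G)"
proof -
  let ?\<phi> = "adjoint_action A" and ?\<psi> = "adjoint_action (matrix_inv A)"
  have inv: "invertible A" by (rule bspec[OF linear_algebraic_groupD(1)[OF G] A])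
  have Ai: "matrix_inv A \<in> G" by (rule bspec[OF linear_algebraic_groupD(4)[OF G] A])
  have inv': "invertible (matrix_inv A)" by (rule bspec[OF linear_algebraic_groupD(1)[OF G] Ai])
  have sh: "cmat.subspace h" and hg: "h \<subseteq> lie_algebra G" and ch: "\<forall>x\<in>h. \<forall>y\<in>h. bracket x y \<in> h"
    and nil: "nilpotent_lie h" and norm: "{x \<in> lie_algebra G. \<forall>y\<in>h. bracket x y \<in> h} = h"
    using h by (auto simp: cartan_subalgebra_def lie_subalgebra_def)
  have br: "bracket (?\<phi> x) (?\<phi> y) = ?\<phi> (bracket x y)" for x y using adjoint_bracket[OF inv] by simp
  have "lie_subalgebra (?\<phi> ` h) (lie_algebra G)"
    unfolding lie_subalgebra_def
  proof (intro conjI)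
    show "cmat.subspace (?\<phi> ` h)" by (rule cpair.linear_subspace_image[OF clinear_adjoint sh])
    show "?\<phi> ` h \<subseteq> lie_algebra G" using lie_algebra_adjoint[OF G _ A] hg by blast
    show "\<forall>x\<in>?\<phi> ` h. \<forall>y\<in>?\<phi> ` h. bracket x y \<in> ?\<phi> ` h" using ch by (auto simp: br)
  qed
  moreover have "nilpotent_lie (?\<phi> ` h)"
  proof -
    obtain k where "lower_central h k = {0}" using nil by (auto simp: nilpotent_lie_def)
    then have "lower_central (?\<phi> ` h) k = {0}"
      by (simp add: lower_central_adjoint[OF inv] clinear_simps[OF clinear_adjoint])
    then show ?thesis by (auto simp: nilpotent_lie_def)
  qed
  moreover have "{x \<in> lie_algebra G. \<forall>y\<in>?\<phi> ` h. bracket x y \<in> ?\<phi> ` h} = ?\<phi> ` h"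
  proof (intro equalityI subsetI)
    fix x assume x: "x \<in> {x \<in> lie_algebra G. \<forall>y\<in>?\<phi> ` h. bracket x y \<in> ?\<phi> ` h}"
    have "bracket (?\<psi> x) y \<in> h" if "y \<in> h" for y
    proof -
      have "bracket (?\<psi> x) y = ?\<psi> (bracket x (?\<phi> y))"
        by (simp add: adjoint_bracket[OF inv'] adjoint_inv[OF inv])
      moreover have "?\<psi> (bracket x (?\<phi> y)) \<in> ?\<psi> ` ?\<phi> ` h" using x that by blast
      ultimately show ?thesis by (simp only: adjoint_image_inv[OF inv])
    qed
    moreover have "?\<psi> x \<in> lie_algebra G" using lie_algebra_adjoint[OF G _ Ai] x by blast
    ultimately have "?\<psi> x \<in> h" using norm by blast
    then have "?\<phi> (?\<psi> x) \<in> ?\<phi> ` h" by blast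
    then show "x \<in> ?\<phi> ` h" by (simp only: adjoint_inv[OF inv])
  next
    fix x assume "x \<in> ?\<phi> ` h"
    then show "x \<in> {x \<in> lie_algebra G. \<forall>y\<in>?\<phi> ` h. bracket x y \<in> ?\<phi> ` h}"
      using ch hg lie_algebra_adjoint[OF G _ A] by (auto simp: br)
  qed
  ultimately show ?thesis by (simp add: cartan_subalgebra_def)
qed

locale symmetric_pair =
  fixes G :: "'n::finite cmat set" and \<theta> :: "'n cmat \<Rightarrow> 'n cmat"
  assumes pair: "reductive_symmetric_pair G \<theta>"
begin

lemma reductive: "reductive_group G" and G: "linear_algebraic_group G"
  using pair by (auto simp: reductive_symmetric_pair_def reductive_group_def)

lemma G_simps:
  "A \<in> G \<Longrightarrow> invertible A" "mat 1 \<in> G" "A \<in> G \<Longrightarrow> B \<in> G \<Longrightarrow> A ** B \<in> G" "A \<in> G \<Longrightarrow> matrix_inv A \<in> G"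
  by (fact bspec[OF linear_algebraic_groupD(1)[OF G]], fact linear_algebraic_groupD(2)[OF G],
      fact bspec[OF bspec[OF linear_algebraic_groupD(3)[OF G]]], fact bspec[OF linear_algebraic_groupD(4)[OF G]])

lemma \<theta>_mult: "A \<in> G \<Longrightarrow> B \<in> G \<Longrightarrow> \<theta> (A ** B) = \<theta> A ** \<theta> B"
  using pair by (auto simp: reductive_symmetric_pair_def involution_of_def hom_def GL_def)

lemma \<theta>_regular: "\<exists>f\<in>regular_functions. \<forall>A\<in>G. \<theta> A $ i $ j = f A"
proof -
  have "\<forall>i j. \<exists>f\<in>regular_functions. \<forall>A\<in>G. \<theta> A $ i $ j = f A"
    using pair unfolding reductive_symmetric_pair_def involution_of_def by (elim conjE)
  from this[THEN spec, THEN spec] show ?thesis .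
qed

definition entry_ext :: "'n \<Rightarrow> 'n \<Rightarrow> 'n cmat \<Rightarrow> complex"
  where "entry_ext i j = (SOME f. f \<in> regular_functions \<and> (\<forall>A\<in>G. \<theta> A $ i $ j = f A))"

lemma entry_ext: "entry_ext i j \<in> regular_functions" "A \<in> G \<Longrightarrow> \<theta> A $ i $ j = entry_ext i j A"
proof -
  have "\<exists>f. f \<in> regular_functions \<and> (\<forall>A\<in>G. \<theta> A $ i $ j = f A)" using \<theta>_regular[of i j] unfolding Bex_def .
  from someI_ex[OF this] have *: "entry_ext i j \<in> regular_functions \<and> (\<forall>A\<in>G. \<theta> A $ i $ j = entry_ext i j A)"
    unfolding entry_ext_def .
  then show "entry_ext i j \<in> regular_functions" by (rule conjunct1)
  show "A \<in> G \<Longrightarrow> \<theta> A $ i $ j = entry_ext i j A" by (rule bspec[OF *[THEN conjunct2]])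
qed

lemma differential_nth: "differential G \<theta> X $ i $ j = derivation_at_one X (entry_ext i j)"
  by (simp add: differential_def entry_ext_def)

lemma differential_linear:
  "differential G \<theta> (X + Y) = differential G \<theta> X + differential G \<theta> Y"
  "differential G \<theta> (mscale c X) = mscale c (differential G \<theta> X)"
  by (simp_all add: vec_eq_iff differential_nth derivation_at_one_lderiv lderiv_linear[OF entry_ext(1)])

abbreviation "\<pp> \<equiv> p_space G \<theta>"
abbreviation "\<cc> \<equiv> centralizer_p G \<theta>"

lemma p_subspace: "cmat.subspace \<pp>"
proof -
  have "differential G \<theta> 0 = 0" using differential_linear(2)[of 0 0] by simp
  then show ?thesis
    using lie_algebra_subspace[of G]
    by (intro cmat.subspaceI)
      (auto simp: p_space_def differential_linear cmat.subspace_0 cmat.subspace_add cmat.subspace_scale)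
qed

lemma centralizer_subspace: "cmat.subspace (\<cc> u)"
  using p_subspace
  by (intro cmat.subspaceI)
    (auto simp: centralizer_p_def bracket_simps cmat.subspace_0 cmat.subspace_add cmat.subspace_scale)

lemma centralizer_self: "u \<in> \<pp> \<Longrightarrow> u \<in> \<cc> u"
  by (simp add: centralizer_p_def bracket_simps)

text \<open>Equivariance is proved for the full fixed-point group, which contains \<open>K\<close> and is visibly closed
  under inverses.\<close>

definition fixed_group :: "'n cmat set"
  where "fixed_group = {A \<in> G. \<theta> A = A}"

lemma K_group_subset: "K_group G \<theta> \<subseteq> fixed_group"
  unfolding K_group_def fixed_group_def
  by (rule order_trans[OF connected_component_of_subset_topspace]) simp

lemma fixed_group_inv:
  assumes "k \<in> fixed_group" shows "matrix_inv k \<in> fixed_group"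
proof -
  have k: "k \<in> G" "\<theta> k = k" using assms by (auto simp: fixed_group_def)
  note inv = matrix_inv_inverse[OF G_simps(1)[OF k(1)]]
  have "k ** \<theta> (mat 1) = k" using \<theta>_mult[OF k(1) G_simps(2)] k(2) by simp
  then have "matrix_inv k ** (k ** \<theta> (mat 1)) = mat 1" by (simp add: inv)
  then have "\<theta> (mat 1) = mat 1" by (simp add: matrix_mul_assoc inv)
  then have "k ** \<theta> (matrix_inv k) = mat 1"
    using \<theta>_mult[OF k(1) G_simps(4)[OF k(1)]] k(2) by (simp add: inv)
  from matrix_inv_unique[OF this] show ?thesis using G_simps(4)[OF k(1)] by (simp add: fixed_group_def)
qed

text \<open>On the group \<open>\<theta> (k B k\<^sup>-\<^sup>1) = k (\<theta> B) k\<^sup>-\<^sup>1\<close> holds entrywise between regular functions; comparing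
  derivations at the identity gives the claim.\<close>

lemma differential_adjoint:
  assumes k: "k \<in> fixed_group" and X: "X \<in> lie_algebra G"
  shows "differential G \<theta> (adjoint_action k X) = adjoint_action k (differential G \<theta> X)"
proof -
  have kG: "k \<in> G" "\<theta> k = k" and kiG: "matrix_inv k \<in> G" "\<theta> (matrix_inv k) = matrix_inv k"
    using k fixed_group_inv[OF k] by (auto simp: fixed_group_def)
  have "differential G \<theta> (adjoint_action k X) $ i $ j = adjoint_action k (differential G \<theta> X) $ i $ j" for i j
  proof -
    let ?f = "\<lambda>B. \<Sum>b\<in>UNIV. (\<Sum>a\<in>UNIV. k $ i $ a * entry_ext a b B) * matrix_inv k $ b $ j"
    have reg: "(\<lambda>B. \<Sum>a\<in>UNIV. k $ i $ a * entry_ext a b B) \<in> regular_functions" for b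
      by (intro regular_intros entry_ext)
    have eq: "entry_ext i j (k ** B ** matrix_inv k) = ?f B" if B: "B \<in> G" for B
    proof -
      have "entry_ext i j (k ** B ** matrix_inv k) = \<theta> (k ** B ** matrix_inv k) $ i $ j"
        by (rule entry_ext(2)[symmetric]) (intro G_simps kG kiG B)
      also have "\<dots> = (k ** \<theta> B ** matrix_inv k) $ i $ j"
        by (simp add: \<theta>_mult G_simps kG kiG B)
      also have "\<dots> = ?f B"
        by (simp add: matrix_matrix_mult_def entry_ext(2)[OF B])
      finally show ?thesis .
    qed
    have "differential G \<theta> (adjoint_action k X) $ i $ j
        = derivation_at_one X (\<lambda>B. entry_ext i j (k ** B ** matrix_inv k))"
      by (simp add: differential_nth adjoint_derivation[OF G_simps(1)[OF kG(1)]])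
    also have "\<dots> = derivation_at_one X ?f"
      by (rule derivation_cong[OF X regular_sandwich[OF entry_ext(1)] _ eq])
        (intro regular_intros entry_ext)
    also have "\<dots> = (\<Sum>b\<in>UNIV. (\<Sum>a\<in>UNIV. k $ i $ a * derivation_at_one X (entry_ext a b)) * matrix_inv k $ b $ j)"
      by (simp add: derivation_at_one_lderiv lderiv_sum lderiv_mult lderiv_const reg regular_intros entry_ext(1))
    also have "\<dots> = adjoint_action k (differential G \<theta> X) $ i $ j"
      by (simp add: adjoint_action_def matrix_matrix_mult_def differential_nth)
    finally show ?thesis .
  qed
  then show ?thesis by (simp add: vec_eq_iff)
qed

context
  fixes k assumes k: "k \<in> fixed_group"
begin

lemma kG: "k \<in> G" and k_inv: "invertible k"
  using k G_simps(1) by (auto simp: fixed_group_def)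

lemma p_adjoint:
  assumes "X \<in> \<pp>" shows "adjoint_action k X \<in> \<pp>"
proof -
  have X: "X \<in> lie_algebra G" "differential G \<theta> X = - X" using assms by (auto simp: p_space_def)
  then have "differential G \<theta> (adjoint_action k X) = - adjoint_action k X"
    by (simp add: differential_adjoint[OF k] clinear_simps[OF clinear_adjoint])
  then show ?thesis using lie_algebra_adjoint[OF G X(1) kG] by (simp add: p_space_def)
qed

lemma centralizer_adjoint_subset: "adjoint_action k ` \<cc> u \<subseteq> \<cc> (adjoint_action k u)"
proof
  fix w assume "w \<in> adjoint_action k ` \<cc> u"
  then obtain v where v: "w = adjoint_action k v" "v \<in> \<pp>" "bracket u v = 0"
    by (auto simp: centralizer_p_def)
  then have "bracket (adjoint_action k u) w = 0"
    using adjoint_bracket[OF k_inv, of u v] by (simp add: clinear_simps[OF clinear_adjoint])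
  then show "w \<in> \<cc> (adjoint_action k u)" using v p_adjoint by (simp add: centralizer_p_def)
qed

end

lemma p_adjoint_image: assumes k: "k \<in> fixed_group" shows "adjoint_action k ` \<pp> = \<pp>"
proof
  show "adjoint_action k ` \<pp> \<subseteq> \<pp>" using p_adjoint[OF k] by blast
  have "adjoint_action k ` adjoint_action (matrix_inv k) ` \<pp> \<subseteq> adjoint_action k ` \<pp>"
    using p_adjoint[OF fixed_group_inv[OF k]] by blast
  then show "\<pp> \<subseteq> adjoint_action k ` \<pp>" by (simp only: adjoint_image_inv[OF k_inv[OF k]])
qed

lemma centralizer_adjoint:
  assumes k: "k \<in> fixed_group" shows "\<cc> (adjoint_action k u) = adjoint_action k ` \<cc> u"
proof
  show "adjoint_action k ` \<cc> u \<subseteq> \<cc> (adjoint_action k u)" by (rule centralizer_adjoint_subset[OF k])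
  have "adjoint_action (matrix_inv k) ` \<cc> (adjoint_action k u) \<subseteq> \<cc> u"
    using centralizer_adjoint_subset[OF fixed_group_inv[OF k], of "adjoint_action k u"]
    by (simp only: adjoint_inv[OF k_inv[OF k]])
  then have "adjoint_action k ` adjoint_action (matrix_inv k) ` \<cc> (adjoint_action k u) \<subseteq> adjoint_action k ` \<cc> u"
    by blast
  then show "\<cc> (adjoint_action k u) \<subseteq> adjoint_action k ` \<cc> u"
    by (simp only: adjoint_image_inv[OF k_inv[OF k]])
qed

lemma regular_adjoint:
  assumes k: "k \<in> fixed_group" and u: "u \<in> regular_elements G \<theta>"
  shows "adjoint_action k u \<in> regular_elements G \<theta>"
  using u p_adjoint[OF k]
  by (simp add: regular_elements_def centralizer_adjoint[OF k] dim_adjoint[OF k_inv[OF k]])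

lemma precartan_adjoint:
  assumes k: "k \<in> fixed_group" and a: "precartan G \<theta> a"
  shows "precartan G \<theta> (adjoint_action k ` a)"
proof -
  obtain h where h: "cartan_subalgebra h (lie_algebra G)" "a \<subseteq> h" using a by (auto simp: precartan_def)
  have "cmat.subspace (adjoint_action k ` a)"
    using a by (intro cpair.linear_subspace_image[OF clinear_adjoint]) (simp add: precartan_def)
  moreover have "adjoint_action k ` a \<subseteq> \<pp>" using a p_adjoint[OF k] by (auto simp: precartan_def)
  moreover have "adjoint_action k ` a \<subseteq> adjoint_action k ` h" using h(2) by blast
  ultimately show ?thesis
    using cartan_subalgebra_adjoint[OF G kG[OF k] h(1)] unfolding precartan_def by blast
qed

lemma cartan_subspace_adjoint:
  assumes k: "k \<in> fixed_group" and a: "a \<in> cartan_subspaces G \<theta>"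
  shows "adjoint_action k ` a \<in> cartan_subspaces G \<theta>"
proof -
  have pa: "precartan G \<theta> a" and max: "\<And>b. precartan G \<theta> b \<Longrightarrow> a \<subseteq> b \<Longrightarrow> b = a"
    using a by (auto simp: cartan_subspaces_def)
  have "b = adjoint_action k ` a" if b: "precartan G \<theta> b" "adjoint_action k ` a \<subseteq> b" for b
  proof -
    have "adjoint_action (matrix_inv k) ` adjoint_action k ` a \<subseteq> adjoint_action (matrix_inv k) ` b"
      using b(2) by (rule image_mono)
    then have "a \<subseteq> adjoint_action (matrix_inv k) ` b" by (simp only: adjoint_image_inv[OF k_inv[OF k]])
    from max[OF precartan_adjoint[OF fixed_group_inv[OF k] b(1)] this]
    have "adjoint_action k ` adjoint_action (matrix_inv k) ` b = adjoint_action k ` a" by simp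
    then show ?thesis by (simp only: adjoint_image_inv[OF k_inv[OF k]])
  qed
  then show ?thesis using precartan_adjoint[OF k pa] by (auto simp: cartan_subspaces_def)
qed

lemma cartan_subspace_abelian:
  assumes "a \<in> cartan_subspaces G \<theta>" "x \<in> a" "y \<in> a" shows "bracket x y = 0"
proof -
  obtain h where "cartan_subalgebra h (lie_algebra G)" "a \<subseteq> h"
    using assms(1) by (auto simp: cartan_subspaces_def precartan_def)
  then show ?thesis using cartan_subalgebra_abelian[OF reductive] assms(2,3) by blast
qed

end

section \<open>Open subsets of the Grassmannian\<close>

lemma tuple_linear_in:
  assumes "clinear g" "k < r" shows "(\<lambda>v. g (v k) $ i $ j) \<in> fun_algebra (tuple_coords r)"
  using clinear_coord_in[OF assms(1)]
proof (rule fun_algebra_compose)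
  fix f :: "'a cmat \<Rightarrow> complex" assume "f \<in> coords"
  then obtain i j where f: "f = (\<lambda>X. X $ i $ j)" by (auto simp: coords_def)
  show "(\<lambda>v. f (v k)) \<in> fun_algebra (tuple_coords r)"
    unfolding f by (rule fun_algebra.gen) (use assms(2) in \<open>auto simp: tuple_coords_def\<close>)
qed

lemma tuple_coord_in: "k < r \<Longrightarrow> (\<lambda>v. v k $ i $ j) \<in> fun_algebra (tuple_coords r)"
  by (rule fun_algebra.gen) (auto simp: tuple_coords_def)

text \<open>Openness tested on frames: around every frame of a member of \<open>U\<close> there is a basic open set of frames
  whose spans are in \<open>U\<close>.\<close>

lemma grassmannian_open_iff:
  "grassmannian_open r V U \<longleftrightarrow> U \<subseteq> grassmannian r V \<and>
    (\<forall>v\<in>frames r V. cmat.span (v ` {..<r}) \<in> U \<longrightarrow> (\<exists>f\<in>fun_algebra (tuple_coords r). f v \<noteq> 0 \<and>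
      (\<forall>w\<in>frames r V. f w \<noteq> 0 \<longrightarrow> cmat.span (w ` {..<r}) \<in> U)))"
proof -
  let ?F = "frames r V" and ?pre = "{v \<in> frames r V. cmat.span (v ` {..<r}) \<in> U}"
  have "openin (subtopology (zariski_tuples r) ?F) ?pre \<longleftrightarrow>
    (\<forall>v\<in>?F. cmat.span (v ` {..<r}) \<in> U \<longrightarrow> (\<exists>f\<in>fun_algebra (tuple_coords r). f v \<noteq> 0 \<and>
      (\<forall>w\<in>?F. f w \<noteq> 0 \<longrightarrow> cmat.span (w ` {..<r}) \<in> U)))" (is "?L \<longleftrightarrow> ?R")
  proof
    assume ?L
    then obtain T where T: "openin (zariski_tuples r) T" "?pre = T \<inter> ?F"
      unfolding openin_subtopology by (elim exE conjE)
    show ?R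
    proof (intro ballI impI)
      fix v assume v: "v \<in> ?F" "cmat.span (v ` {..<r}) \<in> U"
      then have "v \<in> T" using T(2) by blast
      from bspec[OF T(1)[unfolded zariski_tuples_def openin_zariski] this]
      obtain f where f: "f \<in> fun_algebra (tuple_coords r)" "f v \<noteq> 0" "{y. f y \<noteq> 0} \<subseteq> T" by blast
      have "\<forall>w\<in>?F. f w \<noteq> 0 \<longrightarrow> cmat.span (w ` {..<r}) \<in> U"
      proof (intro ballI impI)
        fix w assume "w \<in> ?F" "f w \<noteq> 0"
        then have "w \<in> ?pre" unfolding T(2) using f(3) by blast
        then show "cmat.span (w ` {..<r}) \<in> U" by blast
      qed
      with f(2) show "\<exists>f\<in>fun_algebra (tuple_coords r). f v \<noteq> 0 \<and>
        (\<forall>w\<in>?F. f w \<noteq> 0 \<longrightarrow> cmat.span (w ` {..<r}) \<in> U)" by (intro bexI[OF _ f(1)] conjI)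
    qed
  next
    assume R: ?R
    let ?T = "\<Union>f\<in>{f \<in> fun_algebra (tuple_coords r). \<forall>w\<in>?F. f w \<noteq> 0 \<longrightarrow> cmat.span (w ` {..<r}) \<in> U}. {y. f y \<noteq> 0}"
    have opT: "openin (zariski_tuples r) ?T" unfolding zariski_tuples_def openin_zariski by blast
    have pre: "?pre = ?F \<inter> ?T"
    proof (intro equalityI subsetI)
      fix v assume v: "v \<in> ?pre"
      then have "v \<in> ?F" "cmat.span (v ` {..<r}) \<in> U" by simp_all
      from R[THEN bspec, OF this(1), THEN mp, OF this(2)]
      obtain f where "f \<in> fun_algebra (tuple_coords r)" "f v \<noteq> 0"
        "\<forall>w\<in>?F. f w \<noteq> 0 \<longrightarrow> cmat.span (w ` {..<r}) \<in> U" by (elim bexE conjE)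
      then have "v \<in> ?T" by (intro UN_I[of f]) simp_all
      with \<open>v \<in> ?F\<close> show "v \<in> ?F \<inter> ?T" by (rule IntI)
    next
      fix v assume v: "v \<in> ?F \<inter> ?T"
      then have "v \<in> ?F" "v \<in> ?T" by (rule IntD1, rule IntD2)
      from \<open>v \<in> ?T\<close> obtain f where f: "f \<in> {f \<in> fun_algebra (tuple_coords r).
          \<forall>w\<in>?F. f w \<noteq> 0 \<longrightarrow> cmat.span (w ` {..<r}) \<in> U}" "v \<in> {y. f y \<noteq> 0}" by (rule UN_E)
      from f(1) have "\<forall>w\<in>?F. f w \<noteq> 0 \<longrightarrow> cmat.span (w ` {..<r}) \<in> U" by simp
      from this[THEN bspec, OF \<open>v \<in> ?F\<close>] f(2) show "v \<in> ?pre" using \<open>v \<in> ?F\<close> by simp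
    qed
    show ?L unfolding pre by (rule openin_subtopology_Int2[OF opT])
  qed
  then show ?thesis unfolding grassmannian_open_def by simp
qed

lemma frame_span:
  assumes V: "cmat.subspace V" and v: "v \<in> frames r V"
  shows "cmat.span (v ` {..<r}) \<in> grassmannian r V"
proof -
  have "v ` {..<r} \<subseteq> V" using v by (auto simp: frames_def)
  then have "cmat.span (v ` {..<r}) \<subseteq> V" by (rule cmat.span_minimal[OF _ V])
  then show ?thesis using v by (simp add: grassmannian_def frames_def)
qed

lemma frame_in: "v \<in> frames r V \<Longrightarrow> k < r \<Longrightarrow> v k \<in> V"
  by (auto simp: frames_def)

lemma frame_of_subspace:
  assumes "a \<in> grassmannian r V" shows "\<exists>v\<in>frames r V. cmat.span (v ` {..<r}) = a"
proof -
  have a: "cmat.subspace a" "a \<subseteq> V" "cmat.dim a = r" using assms by (auto simp: grassmannian_def)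
  obtain B where B: "B \<subseteq> a" "cmat.independent B" "a \<subseteq> cmat.span B" "card B = cmat.dim a"
    using cmat.basis_exists by blast
  have "finite B" by (rule cfd.finiteI_independent[OF B(2)])
  then obtain h where h: "bij_betw h {0..<card B} B" using ex_bij_betw_nat_finite by blast
  then have h': "h ` {..<r} = B" using B(4) a(3) by (simp add: bij_betw_def lessThan_atLeast0)
  let ?v = "restrict h {..<r}"
  have im: "?v ` {..<r} = B" using h' by auto
  have sp: "cmat.span B = a" using B(1,3) a(1) by (intro cmat.span_subspace)
  have "cmat.dim B = r" using B(4) a(3) cmat.dim_eq_card_independent[OF B(2)] by simp
  then have "?v \<in> frames r V" unfolding frames_def mem_Collect_eq im using h' B(1) a(2) by auto
  then show ?thesis using im sp by blast
qed

lemma topspace_grassmannian: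
  assumes "cmat.subspace V" shows "topspace (grassmannian_topology r V) = grassmannian r V"
proof
  show "topspace (grassmannian_topology r V) \<subseteq> grassmannian r V"
    unfolding topspace_def openin_grassmannian_topology grassmannian_open_def by blast
  have "grassmannian_open r V (grassmannian r V)"
    unfolding grassmannian_open_iff
    using frame_span[OF assms] by (auto intro!: bexI[of _ "\<lambda>x. 1"] fun_algebra.const)
  then show "grassmannian r V \<subseteq> topspace (grassmannian_topology r V)"
    by (intro openin_subset) (simp add: openin_grassmannian_topology)
qed

lemma grassmannian_open_action:
  assumes V: "cmat.subspace V" and A: "invertible A" "adjoint_action A ` V = V"
    and U: "grassmannian_open r V U"
  shows "grassmannian_open r V {a \<in> grassmannian r V. adjoint_action A ` a \<in> U}"
  unfolding grassmannian_open_iff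
proof (intro conjI ballI impI)
  let ?\<phi> = "adjoint_action A"
  define m where "m v = restrict (\<lambda>k. ?\<phi> (v k)) {..<r}" for v
  have im: "m v ` {..<r} = ?\<phi> ` v ` {..<r}" for v by (auto simp: m_def image_image)
  have sp: "cmat.span (m v ` {..<r}) = ?\<phi> ` cmat.span (v ` {..<r})" for v
    unfolding im by (rule cpair.linear_span_image[OF clinear_adjoint])
  have mF: "m v \<in> frames r V" if "v \<in> frames r V" for v
  proof -
    have "m v \<in> {..<r} \<rightarrow>\<^sub>E V" using frame_in[OF that] A(2) by (auto simp: m_def)
    moreover have "cmat.dim (m v ` {..<r}) = r"
      unfolding im dim_adjoint[OF A(1)] using that by (simp add: frames_def)
    ultimately show ?thesis by (simp add: frames_def)
  qed
  fix v assume v: "v \<in> frames r V" "cmat.span (v ` {..<r}) \<in> {a \<in> grassmannian r V. ?\<phi> ` a \<in> U}"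
  then have "cmat.span (m v ` {..<r}) \<in> U" by (simp add: sp)
  with U mF[OF v(1)] obtain f where f: "f \<in> fun_algebra (tuple_coords r)" "f (m v) \<noteq> 0"
    "\<forall>w\<in>frames r V. f w \<noteq> 0 \<longrightarrow> cmat.span (w ` {..<r}) \<in> U"
    unfolding grassmannian_open_iff by blast
  have "(\<lambda>v. f (m v)) \<in> fun_algebra (tuple_coords r)"
    using f(1)
  proof (rule fun_algebra_compose)
    fix f :: "(nat \<Rightarrow> 'a cmat) \<Rightarrow> complex" assume "f \<in> tuple_coords r"
    then obtain k i j where "f = (\<lambda>v. v k $ i $ j)" and k: "k < r" by (auto simp: tuple_coords_def)
    then have "(\<lambda>v. f (m v)) = (\<lambda>v. ?\<phi> (v k) $ i $ j)" by (simp add: m_def)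
    then show "(\<lambda>v. f (m v)) \<in> fun_algebra (tuple_coords r)"
      using tuple_linear_in[OF clinear_adjoint k] by simp
  qed
  moreover have "cmat.span (w ` {..<r}) \<in> {a \<in> grassmannian r V. ?\<phi> ` a \<in> U}"
    if "w \<in> frames r V" "f (m w) \<noteq> 0" for w
    using f(3) mF[OF that(1)] that sp[of w] frame_span[OF V that(1)] by auto
  ultimately show "\<exists>f\<in>fun_algebra (tuple_coords r). f v \<noteq> 0 \<and> (\<forall>w\<in>frames r V. f w \<noteq> 0 \<longrightarrow>
      cmat.span (w ` {..<r}) \<in> {a \<in> grassmannian r V. ?\<phi> ` a \<in> U})"
    using f(2) by (intro bexI[of _ "\<lambda>v. f (m v)"]) auto
qed blast

lemma span_abelian:
  assumes "\<And>x y. x \<in> B \<Longrightarrow> y \<in> B \<Longrightarrow> bracket x y = 0" "x \<in> cmat.span B" "y \<in> cmat.span B"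
  shows "bracket x y = 0"
proof -
  have "bracket x y = 0" if "x \<in> B" for x
    using cpair.linear_eq_0_on_span[OF clinear_bracket, of B x] assms(1)[OF that] assms(3) by blast
  then show ?thesis
    using cpair.linear_eq_0_on_span[OF clinear_bracket_left, of B y] assms(2) by blast
qed

lemma nonabelian_open:
  assumes V: "cmat.subspace V"
  shows "grassmannian_open r V {a \<in> grassmannian r V. \<exists>x\<in>a. \<exists>y\<in>a. bracket x y \<noteq> 0}"
  unfolding grassmannian_open_iff
proof (intro conjI ballI impI)
  fix v assume v: "v \<in> frames r V"
    "cmat.span (v ` {..<r}) \<in> {a \<in> grassmannian r V. \<exists>x\<in>a. \<exists>y\<in>a. bracket x y \<noteq> 0}"
  have "\<exists>k<r. \<exists>l<r. bracket (v k) (v l) \<noteq> 0"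
  proof (rule ccontr)
    assume "\<not> (\<exists>k<r. \<exists>l<r. bracket (v k) (v l) \<noteq> 0)"
    then have "bracket x y = 0" if "x \<in> v ` {..<r}" "y \<in> v ` {..<r}" for x y using that by auto
    from span_abelian[OF this] v(2) show False by blast
  qed
  then obtain k l where kl: "k < r" "l < r" "bracket (v k) (v l) \<noteq> 0" by blast
  then obtain i j where ij: "bracket (v k) (v l) $ i $ j \<noteq> 0" by (auto simp: vec_eq_iff)
  define f where "f = (\<lambda>v. bracket (v k) (v l :: 'a cmat) $ i $ j)"
  have "f \<in> fun_algebra (tuple_coords r)"
    unfolding f_def bracket_def matrix_matrix_mult_def vector_minus_component vec_lambda_beta
    by (intro fun_algebra_diff fun_algebra_sum fun_algebra.mult tuple_coord_in kl)
  moreover have "cmat.span (w ` {..<r}) \<in> {a \<in> grassmannian r V. \<exists>x\<in>a. \<exists>y\<in>a. bracket x y \<noteq> 0}"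
    if w: "w \<in> frames r V" "f w \<noteq> 0" for w
  proof -
    have "w k \<in> cmat.span (w ` {..<r})" "w l \<in> cmat.span (w ` {..<r})"
      using kl by (auto intro: cmat.span_base)
    moreover have "bracket (w k) (w l) \<noteq> 0" using w(2) by (auto simp: f_def)
    ultimately show ?thesis using frame_span[OF V w(1)] by blast
  qed
  ultimately show "\<exists>f\<in>fun_algebra (tuple_coords r). f v \<noteq> 0 \<and> (\<forall>w\<in>frames r V. f w \<noteq> 0 \<longrightarrow>
      cmat.span (w ` {..<r}) \<in> {a \<in> grassmannian r V. \<exists>x\<in>a. \<exists>y\<in>a. bracket x y \<noteq> 0})"
    using ij by (intro bexI[of _ f]) (auto simp: f_def)
qed blast

text \<open>A point of \<open>W\<close> in the span of a frame is a fixed linear combination of the frame, and the same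
  combination of a nearby frame is still in \<open>W\<close>.\<close>

lemma meets_open:
  assumes V: "cmat.subspace V" and W: "openin zariski_mat W"
  shows "grassmannian_open r V {a \<in> grassmannian r V. a \<inter> W \<noteq> {}}"
  unfolding grassmannian_open_iff
proof (intro conjI ballI impI)
  fix v assume v: "v \<in> frames r V" "cmat.span (v ` {..<r}) \<in> {a \<in> grassmannian r V. a \<inter> W \<noteq> {}}"
  then obtain x where x: "x \<in> cmat.span (v ` {..<r})" "x \<in> W" by blast
  then obtain c where c: "x = (\<Sum>k<r. mscale (c k) (v k))" using in_span_image_lessThan by blast
  from bspec[OF W[unfolded zariski_mat_def openin_zariski] x(2)]
  obtain f where f: "f \<in> fun_algebra coords" "f x \<noteq> 0" "{y. f y \<noteq> 0} \<subseteq> W" by blast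
  let ?s = "\<lambda>w. \<Sum>k<r. mscale (c k) (w k :: 'a cmat)"
  have "(\<lambda>w. f (?s w)) \<in> fun_algebra (tuple_coords r)"
    using f(1)
  proof (rule fun_algebra_compose)
    fix f :: "'a cmat \<Rightarrow> complex" assume "f \<in> coords"
    then obtain i j where "f = (\<lambda>X. X $ i $ j)" by (auto simp: coords_def)
    then have eq: "(\<lambda>w. f (?s w)) = (\<lambda>w. \<Sum>k<r. c k * w k $ i $ j)" by (simp add: sum_nth2)
    show "(\<lambda>w. f (?s w)) \<in> fun_algebra (tuple_coords r)"
      unfolding eq by (intro fun_algebra_sum fun_algebra.mult fun_algebra.const tuple_coord_in) simp
  qed
  moreover have "cmat.span (w ` {..<r}) \<in> {a \<in> grassmannian r V. a \<inter> W \<noteq> {}}"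
    if w: "w \<in> frames r V" "f (?s w) \<noteq> 0" for w
  proof -
    have "?s w \<in> cmat.span (w ` {..<r})"
      by (intro cmat.span_sum cmat.span_scale cmat.span_base) simp
    moreover have "?s w \<in> W" using f(3) w(2) by blast
    ultimately show ?thesis using frame_span[OF V w(1)] by blast
  qed
  moreover have "f (?s v) \<noteq> 0" using f(2) unfolding c .
  ultimately show "\<exists>f\<in>fun_algebra (tuple_coords r). f v \<noteq> 0 \<and> (\<forall>w\<in>frames r V. f w \<noteq> 0 \<longrightarrow>
      cmat.span (w ` {..<r}) \<in> {a \<in> grassmannian r V. a \<inter> W \<noteq> {}})"
    by (intro bexI[of _ "\<lambda>w. f (?s w)"]) auto
qed blast

section \<open>The centralizer map in local coordinates\<close>

lemma fun_algebra_det: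
  assumes "\<And>i j. (\<lambda>x. M x $ i $ j) \<in> fun_algebra L" shows "(\<lambda>x. det (M x)) \<in> fun_algebra L"
  unfolding det_def
  by (intro fun_algebra_sum fun_algebra.mult fun_algebra.const fun_algebra_prod assms)

lemma subspace_projection:
  assumes F: "cmat.subspace F"
  shows "\<exists>Q. clinear Q \<and> (\<forall>x\<in>F. Q x = x) \<and> (\<forall>x. Q x \<in> F)"
proof -
  obtain B where B: "B \<subseteq> F" "cmat.independent B" "F \<subseteq> cmat.span B" "card B = cmat.dim F"
    using cmat.basis_exists by blast
  have sp: "cmat.span B = F" using B F by (intro cmat.span_subspace)
  let ?Q = "cpair.construct B (\<lambda>x. x)"
  have lin: "clinear ?Q" by (rule cpair.linear_construct[OF B(2)])
  have "?Q x = x" if "x \<in> F" for x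
  proof (rule cpair.linear_eq_on[OF lin, of "\<lambda>x. x" x B])
    show "clinear (\<lambda>x. x)" by (rule clinearI) simp_all
    show "x \<in> cmat.span B" using that sp by simp
    show "?Q b = b" if "b \<in> B" for b by (rule cpair.construct_basis[OF B(2) that])
  qed
  moreover have "?Q x \<in> F" for x using cpair.construct_in_span[OF B(2), of "\<lambda>x. x" x] sp by simp
  ultimately show ?thesis using lin by blast
qed

text \<open>Operators on matrices become square matrices indexed by pairs, so that Cramer's rule applies to them.\<close>

definition flat :: "'n::finite cmat \<Rightarrow> complex ^ ('n \<times> 'n)"
  where "flat X = (\<chi> p. X $ fst p $ snd p)"

definition unflat :: "complex ^ ('n::finite \<times> 'n) \<Rightarrow> 'n cmat"
  where "unflat x = (\<chi> i j. x $ (i, j))"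

definition operator_matrix :: "('n::finite cmat \<Rightarrow> 'n cmat) \<Rightarrow> complex ^ ('n \<times> 'n) ^ ('n \<times> 'n)"
  where "operator_matrix f = (\<chi> p q. flat (f (\<chi> i j. if i = fst q \<and> j = snd q then 1 else 0)) $ p)"

lemma unflat_flat: "unflat (flat X) = X"
  by (simp add: flat_def unflat_def vec_eq_iff)

lemma operator_matrix_mult:
  assumes "clinear f" shows "operator_matrix f *v flat X = flat (f X)"
proof -
  have "(operator_matrix f *v flat X) $ p = flat (f X) $ p" for p
  proof -
    have "f X = (\<Sum>q\<in>UNIV. mscale (X $ fst q $ snd q) (f (\<chi> i j. if i = fst q \<and> j = snd q then 1 else 0)))"
      by (subst matrix_unit_expansion[of X]) (simp add: clinear_simps[OF assms] case_prod_beta)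
    then have "flat (f X) $ p = (\<Sum>q\<in>UNIV. X $ fst q $ snd q *
        f (\<chi> i j. if i = fst q \<and> j = snd q then 1 else 0) $ fst p $ snd p)"
      by (simp add: flat_def sum_nth2)
    then show ?thesis
      by (simp add: operator_matrix_def matrix_vector_mult_def flat_def mult.commute)
  qed
  then show ?thesis by (simp add: vec_eq_iff)
qed

lemma operator_matrix_id: "operator_matrix (\<lambda>x. x) = mat 1"
  by (simp add: operator_matrix_def flat_def mat_def vec_eq_iff prod_eq_iff)

text \<open>Cramer's rule, cleared of denominators: the solution scaled by the determinant is polynomial in the
  entries of the operator and of the right-hand side.\<close>

lemma operator_solution:
  assumes f: "clinear f" and d: "det (operator_matrix f) \<noteq> 0" and y: "f y = b"
  shows "mscale (det (operator_matrix f)) y =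
    unflat (\<chi> k. det (\<chi> i j. if j = k then flat b $ i else operator_matrix f $ i $ j))"
proof -
  let ?M = "operator_matrix f"
  have "?M *v flat y = flat b" using operator_matrix_mult[OF f] y by simp
  then have "flat y = (\<chi> k. det (\<chi> i j. if j = k then flat b $ i else ?M $ i $ j) / det ?M)"
    by (rule cramer[OF d, THEN iffD1])
  from arg_cong[OF this, of unflat]
  have "y = unflat (\<chi> k. det (\<chi> i j. if j = k then flat b $ i else ?M $ i $ j) / det ?M)"
    unfolding unflat_flat .
  then have "y $ i $ j = unflat (\<chi> k. det (\<chi> i j. if j = k then flat b $ i else ?M $ i $ j) / det ?M) $ i $ j" for i j
    by (rule arg_cong)
  then show ?thesis using d by (simp add: vec_eq_iff unflat_def)
qed

context symmetric_pair begin

text \<open>Near a regular \<open>u\<^sub>0\<close> the centralizer has a basis depending polynomially on \<open>u\<close>. Let \<open>q\<close> be a complement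
  of the centralizer of \<open>u\<^sub>0\<close> in \<open>\<pp>\<close>, and let \<open>T\<close> be a left inverse of \<open>ad u\<^sub>0\<close> on \<open>q\<close>. The operator
  \<open>B u\<close> extends \<open>T \<circ> ad u\<close> from \<open>q\<close> to all matrices and is the identity for \<open>u = u\<^sub>0\<close>. Where its
  determinant \<open>d\<close> does not vanish, \<open>ad u\<close> is injective on \<open>q\<close>; so the centralizer of \<open>u\<close> projects
  injectively along \<open>q\<close> to that of \<open>u\<^sub>0\<close>, and by minimality of the dimension bijectively. The preimage
  of a basis vector \<open>e k\<close> is \<open>e k - y\<close> with \<open>y \<in> q\<close> and \<open>B u y = T [u, e k]\<close>, so \<open>y\<close> is given by Cramer's
  rule; scaling by \<open>d u\<close> removes the denominator.\<close>

lemma centralizer_chart: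
  assumes u0: "u\<^sub>0 \<in> regular_elements G \<theta>" and dim0: "cmat.dim (\<cc> u\<^sub>0) = r"
  shows "\<exists>d w. d \<in> fun_algebra coords \<and> (\<forall>k<r. \<forall>i j. (\<lambda>u. w u k $ i $ j) \<in> fun_algebra coords) \<and>
    d u\<^sub>0 \<noteq> 0 \<and> (\<forall>u\<in>\<pp>. d u \<noteq> 0 \<longrightarrow> u \<in> regular_elements G \<theta> \<and> cmat.span (w u ` {..<r}) = \<cc> u)"
proof -
  have u0p: "u\<^sub>0 \<in> \<pp>" and min: "\<And>v. v \<in> \<pp> \<Longrightarrow> cmat.dim (\<cc> u\<^sub>0) \<le> cmat.dim (\<cc> v)"
    using u0 by (auto simp: regular_elements_def)
  have cp: "\<cc> u \<subseteq> \<pp>" for u by (auto simp: centralizer_p_def)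
  have "\<cc> u\<^sub>0 \<in> grassmannian r \<pp>" using cp centralizer_subspace dim0 by (simp add: grassmannian_def)
  from frame_of_subspace[OF this] obtain e where e: "cmat.span (e ` {..<r}) = \<cc> u\<^sub>0" by blast
  have ec: "e k \<in> \<cc> u\<^sub>0" if "k < r" for k
    unfolding e[symmetric] by (rule cmat.span_base) (use that in simp)
  obtain \<pi> where \<pi>: "clinear \<pi>" "\<And>x. x \<in> \<cc> u\<^sub>0 \<Longrightarrow> \<pi> x = x" "\<And>x. \<pi> x \<in> \<cc> u\<^sub>0"
    using subspace_projection[OF centralizer_subspace] by blast
  define q where "q = {x \<in> \<pp>. \<pi> x = 0}"
  have q: "cmat.subspace q"
    using p_subspace by (intro cmat.subspaceI)
      (auto simp: q_def clinear_simps[OF \<pi>(1)] cmat.subspace_0 cmat.subspace_add cmat.subspace_scale)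
  obtain Q where Q: "clinear Q" "\<And>x. x \<in> q \<Longrightarrow> Q x = x" "\<And>x. Q x \<in> q"
    using subspace_projection[OF q] by blast
  have "inj_on (bracket u\<^sub>0) q"
  proof (rule inj_onI)
    fix x y assume xy: "x \<in> q" "y \<in> q" "bracket u\<^sub>0 x = bracket u\<^sub>0 y"
    then have "x - y \<in> q" using q by (simp add: cmat.subspace_diff)
    moreover have "bracket u\<^sub>0 (x - y) = 0" using xy by (simp add: bracket_simps)
    ultimately have "x - y \<in> \<cc> u\<^sub>0" "\<pi> (x - y) = 0" by (auto simp: q_def centralizer_p_def)
    then show "x = y" using \<pi>(2) by fastforce
  qed
  then obtain T where T: "clinear T" "\<And>x. x \<in> q \<Longrightarrow> T (bracket u\<^sub>0 x) = x"
    using cpair.linear_exists_left_inverse_on[OF clinear_bracket q] by blast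
  \<comment> \<open>\<open>Q\<close> makes \<open>B u\<close> an operator on all matrices, so that it has a determinant polynomial in \<open>u\<close>.\<close>
  define B where "B u y = T (bracket u (Q y)) + (y - Q y)" for u y
  have B: "clinear (B u)" for u
    by (rule clinearI)
      (simp_all add: B_def clinear_simps[OF T(1)] clinear_simps[OF Q(1)] bracket_simps cscale_simps algebra_simps)
  have Bq: "B u y = T (bracket u y)" if "y \<in> q" for u y using Q(2)[OF that] by (simp add: B_def)
  have "B u\<^sub>0 = (\<lambda>x. x)" by (rule ext) (simp add: B_def T(2)[OF Q(3)])
  define d where "d u = det (operator_matrix (B u))" for u
  have B_entry: "(\<lambda>u. B u y $ i $ j) \<in> fun_algebra coords" for y i j
  proof -
    have "clinear (\<lambda>u. T (bracket u (Q y)))" by (rule clinear_compose[OF T(1) clinear_bracket_left])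
    then have "(\<lambda>u. T (bracket u (Q y)) $ i $ j + (y - Q y) $ i $ j) \<in> fun_algebra coords"
      by (intro fun_algebra.add fun_algebra.const clinear_coord_in)
    then show ?thesis by (simp add: B_def)
  qed
  have M_entry: "(\<lambda>u. operator_matrix (B u) $ i $ j) \<in> fun_algebra coords" for i j
    unfolding operator_matrix_def flat_def vec_lambda_beta by (rule B_entry)
  have d_in: "d \<in> fun_algebra coords"
    unfolding d_def by (rule fun_algebra_det[OF M_entry])
  have d0: "d u\<^sub>0 \<noteq> 0" by (simp add: d_def \<open>B u\<^sub>0 = (\<lambda>x. x)\<close> operator_matrix_id)
  define num where "num u k = unflat (\<chi> l. det (\<chi> i j. if j = l then flat (T (bracket u (e k))) $ i
      else operator_matrix (B u) $ i $ j))" for u k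
  define w where "w u k = mscale (d u) (e k) - num u k" for u k
  have num_entry: "(\<lambda>u. num u k $ i $ j) \<in> fun_algebra coords" for k i j
  proof -
    have "(\<lambda>u. if b then flat (T (bracket u (e k))) $ i else operator_matrix (B u) $ i $ j) \<in> fun_algebra coords"
      for b i j
      using clinear_coord_in[OF clinear_compose[OF T(1) clinear_bracket_left[of "e k"]]] M_entry
      by (cases b) (simp_all add: flat_def)
    then show ?thesis
      unfolding num_def unflat_def vec_lambda_beta by (intro fun_algebra_det) simp
  qed
  have w_entry: "(\<lambda>u. w u k $ i $ j) \<in> fun_algebra coords" for k i j
    unfolding w_def vector_minus_component mscale_nth
    by (intro fun_algebra_diff fun_algebra.mult fun_algebra.const num_entry d_in)
  have main: "u \<in> regular_elements G \<theta> \<and> cmat.span (w u ` {..<r}) = \<cc> u" if u: "u \<in> \<pp>" and du: "d u \<noteq> 0" for u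
  proof -
    have sol: "mscale (d u) y = num u k" if "B u y = T (bracket u (e k))" for y k
      using operator_solution[OF B du[unfolded d_def] that] by (simp add: d_def num_def)
    have inj: "y = 0" if "y \<in> q" "bracket u y = 0" for y
    proof -
      have "B u y = 0" using Bq[OF that(1)] that(2) by (simp add: clinear_simps[OF T(1)])
      then have "mscale (det (operator_matrix (B u))) y = mscale (det (operator_matrix (B u))) 0"
        using operator_solution[OF B du[unfolded d_def], of y 0]
          operator_solution[OF B du[unfolded d_def], of 0 0] by (simp add: clinear_simps[OF B])
      then show ?thesis using du by (simp add: d_def)
    qed
    have inj_\<pi>: "x = 0" if "x \<in> \<cc> u" "\<pi> x = 0" for x
      using inj[of x] that by (auto simp: q_def centralizer_p_def)
    have "inj_on \<pi> (\<cc> u)"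
    proof (rule inj_onI)
      fix x y assume xy: "x \<in> \<cc> u" "y \<in> \<cc> u" "\<pi> x = \<pi> y"
      then have "x - y \<in> \<cc> u" by (simp add: cmat.subspace_diff[OF centralizer_subspace])
      moreover have "\<pi> (x - y) = 0" using xy by (simp add: clinear_simps[OF \<pi>(1)])
      ultimately show "x = y" using inj_\<pi>[of "x - y"] by simp
    qed
    then have dimu: "cmat.dim (\<pi> ` \<cc> u) = cmat.dim (\<cc> u)"
      by (intro cfpair.dim_image_eq[OF \<pi>(1)]) (simp add: cmat.span_eq_iff[THEN iffD2, OF centralizer_subspace])
    have im: "\<pi> ` \<cc> u = \<cc> u\<^sub>0"
    proof (rule cfd.subspace_dim_equal)
      show "cmat.subspace (\<pi> ` \<cc> u)" by (rule cpair.linear_subspace_image[OF \<pi>(1) centralizer_subspace])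
    qed (use \<pi>(3) centralizer_subspace dimu min[OF u] in auto)
    then have "cmat.dim (\<cc> u) = cmat.dim (\<cc> u\<^sub>0)" using dimu by simp
    then have reg: "u \<in> regular_elements G \<theta>" using u min by (simp add: regular_elements_def)
    have w: "w u k \<in> \<cc> u \<and> \<pi> (w u k) = mscale (d u) (e k)" if k: "k < r" for k
    proof -
      obtain c where c: "c \<in> \<cc> u" "\<pi> c = e k" using im ec[OF k] by (metis imageE)
      have "e k - c \<in> \<pp>" using c(1) ec[OF k] cp cmat.subspace_diff[OF p_subspace] by blast
      then have yq: "e k - c \<in> q" using c(2) \<pi>(2)[OF ec[OF k]] by (simp add: q_def clinear_simps[OF \<pi>(1)])
      have "bracket u c = 0" using c(1) by (simp add: centralizer_p_def)
      then have "B u (e k - c) = T (bracket u (e k))"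
        unfolding Bq[OF yq] by (simp add: bracket_simps)
      from sol[OF this, symmetric] have "w u k = mscale (d u) c" by (simp add: w_def cscale_simps)
      then show ?thesis
        using c by (simp add: cmat.subspace_scale[OF centralizer_subspace] clinear_simps[OF \<pi>(1)])
    qed
    have "cmat.span (w u ` {..<r}) = \<cc> u"
    proof
      show "cmat.span (w u ` {..<r}) \<subseteq> \<cc> u"
        by (rule cmat.span_minimal[OF _ centralizer_subspace]) (use w in blast)
      show "\<cc> u \<subseteq> cmat.span (w u ` {..<r})"
      proof
        fix x assume x: "x \<in> \<cc> u"
        have "\<pi> x \<in> cmat.span (e ` {..<r})" using \<pi>(3) e by simp
        then obtain a where a: "\<pi> x = (\<Sum>k<r. mscale (a k) (e k))" using in_span_image_lessThan by blast
        let ?x' = "\<Sum>k<r. mscale (a k / d u) (w u k)"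
        have "\<pi> ?x' = (\<Sum>k<r. mscale (a k) (e k))"
          using w du by (simp add: clinear_simps[OF \<pi>(1)])
        then have "\<pi> (x - ?x') = 0" using a by (simp add: clinear_simps[OF \<pi>(1)])
        moreover have "x - ?x' \<in> \<cc> u"
          using x w by (intro cmat.subspace_diff[OF centralizer_subspace] cmat.subspace_sum[OF centralizer_subspace]
            cmat.subspace_scale[OF centralizer_subspace]) auto
        ultimately have "x = ?x'" using inj_\<pi>[of "x - ?x'"] by simp
        moreover have "?x' \<in> cmat.span (w u ` {..<r})"
          by (intro cmat.span_sum cmat.span_scale cmat.span_base) simp
        ultimately show "x \<in> cmat.span (w u ` {..<r})" by simp
      qed
    qed
    with reg show ?thesis ..
  qed
  show ?thesis
    by (intro exI[of _ d] exI[of _ w] conjI allI impI ballI d_in w_entry d0) (use main in blast)+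
qed

section \<open>Orbits and decomposition classes\<close>

abbreviation "rk \<equiv> pair_rank G \<theta>"

lemma reductions_subset: "reductions G \<theta> \<subseteq> grassmannian rk \<pp>"
  unfolding reductions_def
  by (rule order_trans[OF closure_of_subset_topspace]) (simp add: topspace_grassmannian[OF p_subspace])

lemma in_reductions_iff:
  "a \<in> reductions G \<theta> \<longleftrightarrow> a \<in> grassmannian rk \<pp> \<and>
    (\<forall>U. grassmannian_open rk \<pp> U \<longrightarrow> a \<in> U \<longrightarrow> (\<exists>b\<in>cartan_subspaces G \<theta>. b \<in> U))"
  unfolding reductions_def in_closure_of topspace_grassmannian[OF p_subspace] openin_grassmannian_topology
  by blast

text \<open>Being abelian is a closed condition on subspaces, and Cartan subspaces are abelian because they lie in
  Cartan subalgebras.\<close>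

lemma reduction_abelian:
  assumes a: "a \<in> reductions G \<theta>" and "x \<in> a" "y \<in> a" shows "bracket x y = 0"
proof (rule ccontr)
  assume "bracket x y \<noteq> 0"
  with assms have "a \<in> {a \<in> grassmannian rk \<pp>. \<exists>x\<in>a. \<exists>y\<in>a. bracket x y \<noteq> 0}"
    using reductions_subset by blast
  then obtain b where "b \<in> cartan_subspaces G \<theta>" "\<exists>x\<in>b. \<exists>y\<in>b. bracket x y \<noteq> 0"
    using a nonabelian_open[OF p_subspace, of rk] unfolding in_reductions_iff by blast
  then show False using cartan_subspace_abelian by blast
qed

lemma grassmannian_adjoint:
  assumes k: "k \<in> fixed_group" and a: "a \<in> grassmannian r \<pp>"
  shows "adjoint_action k ` a \<in> grassmannian r \<pp>"
  using a p_adjoint[OF k]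
  by (auto simp: grassmannian_def dim_adjoint[OF k_inv[OF k]] cpair.linear_subspace_image[OF clinear_adjoint])

lemma reductions_adjoint:
  assumes k: "k \<in> fixed_group" and a: "a \<in> reductions G \<theta>"
  shows "adjoint_action k ` a \<in> reductions G \<theta>"
  unfolding in_reductions_iff
proof (intro conjI allI impI)
  have aG: "a \<in> grassmannian rk \<pp>" using a reductions_subset by blast
  show "adjoint_action k ` a \<in> grassmannian rk \<pp>" by (rule grassmannian_adjoint[OF k aG])
  fix U assume U: "grassmannian_open rk \<pp> U" "adjoint_action k ` a \<in> U"
  let ?U' = "{a \<in> grassmannian rk \<pp>. adjoint_action k ` a \<in> U}"
  have "grassmannian_open rk \<pp> ?U'"
    by (rule grassmannian_open_action[OF p_subspace k_inv[OF k] p_adjoint_image[OF k] U(1)])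
  moreover have "a \<in> ?U'" using aG U(2) by blast
  ultimately obtain b where "b \<in> cartan_subspaces G \<theta>" "b \<in> ?U'"
    using a unfolding in_reductions_iff by blast
  then show "\<exists>b\<in>cartan_subspaces G \<theta>. b \<in> U" using cartan_subspace_adjoint[OF k] by blast
qed

lemma regular_orbit_element:
  assumes orb: "orb \<in> regular_orbits G \<theta>" and b: "b \<in> orb"
  shows "b \<in> reductions G \<theta>" "\<exists>u\<in>associated_class G \<theta> orb. b = \<cc> u"
proof -
  obtain a where a: "a \<in> reductions G \<theta>" "orb = K_orbit G \<theta> a"
    and "orb \<inter> regular_reductions G \<theta> \<noteq> {}"
    using orb by (auto simp: regular_orbits_def)
  then obtain c where c: "c \<in> K_orbit G \<theta> a" "c \<in> regular_reductions G \<theta>" by blast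
  \<comment> \<open>Move from \<open>b\<close> to the base point \<open>a\<close> of the orbit and on to a reduction known to be regular.\<close>
  have orbit: "\<exists>k\<in>fixed_group. c = adjoint_action k ` a" if "c \<in> K_orbit G \<theta> a" for c
    using that K_group_subset unfolding K_orbit_def by blast
  obtain k where k: "k \<in> fixed_group" "c = adjoint_action k ` a" using orbit[OF c(1)] by blast
  obtain l where l: "l \<in> fixed_group" "b = adjoint_action l ` a"
    using orbit b[unfolded a(2)] by blast
  obtain u where u: "u \<in> regular_elements G \<theta>" "adjoint_action k ` a = \<cc> u"
    using c(2) unfolding regular_reductions_def k(2) by blast
  show "b \<in> reductions G \<theta>" unfolding l(2) by (rule reductions_adjoint[OF l(1) a(1)])
  note k' = fixed_group_inv[OF k(1)]
  let ?u = "adjoint_action l (adjoint_action (matrix_inv k) u)"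
  have "a = adjoint_action (matrix_inv k) ` \<cc> u"
    unfolding u(2)[symmetric] by (simp only: adjoint_image_inv[OF k_inv[OF k(1)]])
  then have "b = \<cc> ?u" by (simp only: l(2) centralizer_adjoint[OF k'] centralizer_adjoint[OF l(1)])
  moreover have "?u \<in> regular_elements G \<theta>" by (intro regular_adjoint l(1) k' u(1))
  ultimately show "\<exists>u\<in>associated_class G \<theta> orb. b = \<cc> u"
    using b unfolding associated_class_def by blast
qed

text \<open>The existence of one regular orbit is essential: it provides a regular element whose centralizer is a
  point of the Grassmannian, and all regular elements have centralizers of the same dimension.\<close>

lemma regular_dim:
  assumes orb: "orb \<in> regular_orbits G \<theta>" and u: "u \<in> regular_elements G \<theta>"
  shows "cmat.dim (\<cc> u) = rk"
proof -
  obtain b where "b \<in> regular_reductions G \<theta>" using orb by (auto simp: regular_orbits_def)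
  then obtain v where v: "v \<in> regular_elements G \<theta>" "\<cc> v \<in> reductions G \<theta>"
    by (auto simp: regular_reductions_def)
  then have "cmat.dim (\<cc> v) = rk" using reductions_subset by (auto simp: grassmannian_def)
  moreover have "cmat.dim (\<cc> u) = cmat.dim (\<cc> v)"
    using u v(1) by (intro antisym) (simp_all add: regular_elements_def)
  ultimately show ?thesis by simp
qed

lemma more_general_orbits_iff:
  assumes "O\<^sub>0 \<subseteq> reductions G \<theta>" "O\<^sub>1 \<subseteq> reductions G \<theta>"
  shows "more_general (reductions_topology G \<theta>) O\<^sub>1 O\<^sub>0 \<longleftrightarrow>
    (\<forall>a\<in>O\<^sub>0. \<forall>U. grassmannian_open rk \<pp> U \<longrightarrow> a \<in> U \<longrightarrow> (\<exists>b\<in>O\<^sub>1. b \<in> U))"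
proof -
  have "more_general (reductions_topology G \<theta>) O\<^sub>1 O\<^sub>0 \<longleftrightarrow>
    O\<^sub>0 \<subseteq> grassmannian_topology rk \<pp> closure_of O\<^sub>1"
    using assms
    by (auto simp: more_general_def reductions_topology_def closure_of_subtopology Int_absorb1)
  also have "\<dots> \<longleftrightarrow> (\<forall>a\<in>O\<^sub>0. \<forall>U. grassmannian_open rk \<pp> U \<longrightarrow> a \<in> U \<longrightarrow> (\<exists>b\<in>O\<^sub>1. b \<in> U))"
    using assms(1) reductions_subset
    unfolding subset_iff in_closure_of topspace_grassmannian[OF p_subspace] openin_grassmannian_topology
    by blast
  finally show ?thesis .
qed

lemma more_general_classes_iff:
  assumes "D\<^sub>0 \<subseteq> \<pp>" "D\<^sub>1 \<subseteq> \<pp>"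
  shows "more_general (subtopology zariski_mat \<pp>) D\<^sub>1 D\<^sub>0 \<longleftrightarrow>
    (\<forall>u\<in>D\<^sub>0. \<forall>f\<in>fun_algebra coords. f u \<noteq> 0 \<longrightarrow> (\<exists>v\<in>D\<^sub>1. f v \<noteq> 0))"
proof -
  have "u \<in> zariski_mat closure_of D\<^sub>1 \<longleftrightarrow> (\<forall>f\<in>fun_algebra coords. f u \<noteq> 0 \<longrightarrow> (\<exists>v\<in>D\<^sub>1. f v \<noteq> 0))" for u
  proof
    assume u: "u \<in> zariski_mat closure_of D\<^sub>1"
    show "\<forall>f\<in>fun_algebra coords. f u \<noteq> 0 \<longrightarrow> (\<exists>v\<in>D\<^sub>1. f v \<noteq> 0)"
    proof (intro ballI impI)
      fix f :: "'n cmat \<Rightarrow> complex" assume f: "f \<in> fun_algebra coords" "f u \<noteq> 0"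
      have "openin zariski_mat {v. f v \<noteq> 0}"
        unfolding zariski_mat_def openin_zariski by (intro ballI bexI[OF _ f(1)]) simp
      then have "\<exists>v. v \<in> D\<^sub>1 \<and> v \<in> {v. f v \<noteq> 0}"
        by (intro u[unfolded in_closure_of, THEN conjunct2, THEN spec, THEN mp]) (simp add: f(2))
      then show "\<exists>v\<in>D\<^sub>1. f v \<noteq> 0" by (simp add: Bex_def)
    qed
  next
    assume u: "\<forall>f\<in>fun_algebra coords. f u \<noteq> 0 \<longrightarrow> (\<exists>v\<in>D\<^sub>1. f v \<noteq> 0)"
    have "\<exists>v. v \<in> D\<^sub>1 \<and> v \<in> T" if T: "u \<in> T" "openin zariski_mat T" for T
    proof -
      from bspec[OF T(2)[unfolded zariski_mat_def openin_zariski] T(1)]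
      obtain f where f: "f \<in> fun_algebra coords" "f u \<noteq> 0" "{y. f y \<noteq> 0} \<subseteq> T" by blast
      from u[THEN bspec, OF f(1), THEN mp, OF f(2)] show ?thesis using f(3) by blast
    qed
    then show "u \<in> zariski_mat closure_of D\<^sub>1"
      unfolding in_closure_of zariski_mat_def by simp
  qed
  then show ?thesis
    using assms by (auto simp: more_general_def closure_of_subtopology Int_absorb1 subset_iff)
qed

lemma associated_class_subset: "associated_class G \<theta> orb \<subseteq> \<pp>"
  by (auto simp: associated_class_def regular_elements_def)

text \<open>Continuity of the centralizer map: the chart around \<open>u\<close> pulls back an open neighbourhood of the
  centralizer of \<open>u\<close> to an open neighbourhood of \<open>u\<close>, which by hypothesis meets the other class.\<close>

lemma orbits_more_general_if_classes:
  assumes orb: "O\<^sub>0 \<in> regular_orbits G \<theta>"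
    and D: "\<And>u f. u \<in> associated_class G \<theta> O\<^sub>0 \<Longrightarrow> f \<in> fun_algebra coords \<Longrightarrow> f u \<noteq> 0 \<Longrightarrow>
      \<exists>v\<in>associated_class G \<theta> O\<^sub>1. f v \<noteq> 0"
    and a: "a \<in> O\<^sub>0" and U: "grassmannian_open rk \<pp> U" "a \<in> U"
  shows "\<exists>b\<in>O\<^sub>1. b \<in> U"
proof -
  obtain u where u: "u \<in> associated_class G \<theta> O\<^sub>0" "a = \<cc> u"
    using regular_orbit_element(2)[OF orb a] by blast
  have reg: "u \<in> regular_elements G \<theta>" using u(1) by (simp add: associated_class_def)
  obtain d w where d: "d \<in> fun_algebra coords" "d u \<noteq> 0"
    and w: "\<forall>k<rk. \<forall>i j. (\<lambda>u. w u k $ i $ j) \<in> fun_algebra coords"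
    and chart: "\<forall>u\<in>\<pp>. d u \<noteq> 0 \<longrightarrow> u \<in> regular_elements G \<theta> \<and> cmat.span (w u ` {..<rk}) = \<cc> u"
    using centralizer_chart[OF reg regular_dim[OF orb reg]] by (elim exE conjE)
  define m where "m v = restrict (w v) {..<rk}" for v
  have m: "m v \<in> frames rk \<pp> \<and> cmat.span (m v ` {..<rk}) = \<cc> v" if v: "v \<in> \<pp>" "d v \<noteq> 0" for v
  proof -
    have "v \<in> regular_elements G \<theta>" and sp: "cmat.span (w v ` {..<rk}) = \<cc> v" using chart v by auto
    then have dim: "cmat.dim (w v ` {..<rk}) = rk"
      using regular_dim[OF orb] cmat.dim_span[of "w v ` {..<rk}"] by simp
    have "w v k \<in> \<pp>" if "k < rk" for k
    proof -
      have "w v k \<in> \<cc> v" unfolding sp[symmetric] by (rule cmat.span_base) (use that in simp)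
      then show ?thesis by (simp add: centralizer_p_def)
    qed
    then show ?thesis using dim sp by (simp add: m_def frames_def)
  qed
  have up: "u \<in> \<pp>" using u(1) associated_class_subset by blast
  have "m u \<in> frames rk \<pp>" "cmat.span (m u ` {..<rk}) \<in> U" using m[OF up d(2)] U(2) u(2) by auto
  with U(1) obtain f where f: "f \<in> fun_algebra (tuple_coords rk)" "f (m u) \<noteq> 0"
    "\<forall>v\<in>frames rk \<pp>. f v \<noteq> 0 \<longrightarrow> cmat.span (v ` {..<rk}) \<in> U"
    unfolding grassmannian_open_iff by blast
  have "(\<lambda>v. f (m v)) \<in> fun_algebra coords"
    using f(1)
  proof (rule fun_algebra_compose)
    fix f :: "(nat \<Rightarrow> 'n cmat) \<Rightarrow> complex" assume "f \<in> tuple_coords rk"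
    then obtain k i j where "f = (\<lambda>v. v k $ i $ j)" and k: "k < rk" by (auto simp: tuple_coords_def)
    then have "(\<lambda>v. f (m v)) = (\<lambda>v. w v k $ i $ j)" by (simp add: m_def)
    then show "(\<lambda>v. f (m v)) \<in> fun_algebra coords" using w k by simp
  qed
  then have "(\<lambda>v. d v * f (m v)) \<in> fun_algebra coords" by (rule fun_algebra.mult[OF d(1)])
  from D[OF u(1) this] obtain v where v: "v \<in> associated_class G \<theta> O\<^sub>1" "d v * f (m v) \<noteq> 0"
    using d(2) f(2) by auto
  then have "m v \<in> frames rk \<pp>" "cmat.span (m v ` {..<rk}) = \<cc> v"
    using m associated_class_subset by auto
  then have "\<cc> v \<in> U" using f(3) v(2) by auto
  moreover have "\<cc> v \<in> O\<^sub>1" using v(1) by (simp add: associated_class_def)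
  ultimately show ?thesis by blast
qed

text \<open>The subspaces meeting an open set \<open>W\<close> of \<open>\<pp>\<close> form an open set. Choosing \<open>W\<close> inside the regular
  locus, a subspace \<open>b\<close> of the other orbit contains a regular \<open>v \<in> W\<close>. As \<open>b\<close> is abelian it lies in
  the centralizer of \<open>v\<close>, and by dimension it equals this centralizer; so \<open>v\<close> is in the other class.\<close>

lemma classes_more_general_if_orbits:
  assumes orb0: "O\<^sub>0 \<in> regular_orbits G \<theta>" and orb1: "O\<^sub>1 \<in> regular_orbits G \<theta>"
    and O: "\<And>a U. a \<in> O\<^sub>0 \<Longrightarrow> grassmannian_open rk \<pp> U \<Longrightarrow> a \<in> U \<Longrightarrow> \<exists>b\<in>O\<^sub>1. b \<in> U"
    and u: "u \<in> associated_class G \<theta> O\<^sub>0" and f: "f \<in> fun_algebra coords" "f u \<noteq> 0"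
  shows "\<exists>v\<in>associated_class G \<theta> O\<^sub>1. f v \<noteq> 0"
proof -
  have reg: "u \<in> regular_elements G \<theta>" and a: "\<cc> u \<in> O\<^sub>0" using u by (auto simp: associated_class_def)
  have up: "u \<in> \<pp>" using u associated_class_subset by blast
  obtain d w where d: "d \<in> fun_algebra coords" "d u \<noteq> 0"
    and chart: "\<forall>u\<in>\<pp>. d u \<noteq> 0 \<longrightarrow> u \<in> regular_elements G \<theta> \<and> cmat.span (w u ` {..<rk}) = \<cc> u"
    using centralizer_chart[OF reg regular_dim[OF orb0 reg]] by (elim exE conjE)
  \<comment> \<open>The factor \<open>d\<close> keeps \<open>W\<close> inside the regular locus.\<close>
  define W where "W = {v. d v * f v \<noteq> 0}"
  have "openin zariski_mat W"
    unfolding zariski_mat_def openin_zariski W_def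
    by (intro ballI bexI[OF _ fun_algebra.mult[OF d(1) f(1)]]) simp
  then have "grassmannian_open rk \<pp> {a \<in> grassmannian rk \<pp>. a \<inter> W \<noteq> {}}" by (rule meets_open[OF p_subspace])
  moreover have "\<cc> u \<in> {a \<in> grassmannian rk \<pp>. a \<inter> W \<noteq> {}}"
  proof -
    have "\<cc> u \<in> grassmannian rk \<pp>" using regular_orbit_element(1)[OF orb0 a] reductions_subset by blast
    moreover have "u \<in> \<cc> u \<inter> W" using centralizer_self[OF up] d(2) f(2) by (simp add: W_def)
    ultimately show ?thesis by blast
  qed
  ultimately obtain b v where b: "b \<in> O\<^sub>1" "b \<in> grassmannian rk \<pp>" and v: "v \<in> b" "v \<in> W"
    using O[OF a] by blast
  have vp: "v \<in> \<pp>" using b(2) v(1) by (auto simp: grassmannian_def)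
  have regv: "v \<in> regular_elements G \<theta>" using chart vp v(2) by (auto simp: W_def)
  have "b \<subseteq> \<cc> v"
    using reduction_abelian[OF regular_orbit_element(1)[OF orb1 b(1)] v(1)] b(2)
    by (auto simp: centralizer_p_def grassmannian_def)
  then have "b = \<cc> v"
    using b(2) regular_dim[OF orb1 regv] centralizer_subspace
    by (intro cfd.subspace_dim_equal) (auto simp: grassmannian_def)
  then have "v \<in> associated_class G \<theta> O\<^sub>1" using regv b(1) by (simp add: associated_class_def)
  moreover have "f v \<noteq> 0" using v(2) by (simp add: W_def)
  ultimately show ?thesis by blast
qed

end

theorem corollary3p10:
  fixes G :: "'n::finite cmat set" and \<theta> :: "'n cmat \<Rightarrow> 'n cmat"
    and O\<^sub>0 O\<^sub>1 :: "'n cmat set set" and D\<^sub>0 D\<^sub>1 :: "'n cmat set"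
  assumes "reductive_symmetric_pair G \<theta>"
    and "O\<^sub>0 \<in> regular_orbits G \<theta>" and "O\<^sub>1 \<in> regular_orbits G \<theta>"
    and "D\<^sub>0 = associated_class G \<theta> O\<^sub>0" and "D\<^sub>1 = associated_class G \<theta> O\<^sub>1"
  shows "more_general (reductions_topology G \<theta>) O\<^sub>1 O\<^sub>0 \<longleftrightarrow>
    more_general (subtopology zariski_mat (p_space G \<theta>)) D\<^sub>1 D\<^sub>0"
proof -
  interpret symmetric_pair G \<theta> by unfold_locales (rule assms(1))
  have "O\<^sub>0 \<subseteq> reductions G \<theta>" "O\<^sub>1 \<subseteq> reductions G \<theta>"
    using regular_orbit_element(1) assms(2,3) by blast+
  note orbits = more_general_orbits_iff[OF this]
  have "D\<^sub>0 \<subseteq> \<pp>" "D\<^sub>1 \<subseteq> \<pp>" unfolding assms(4,5) by (rule associated_class_subset)+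
  note classes = more_general_classes_iff[OF this]
  show ?thesis
    unfolding orbits classes
  proof (intro iffI ballI allI impI)
    fix u and f :: "'n cmat \<Rightarrow> complex"
    assume O: "\<forall>a\<in>O\<^sub>0. \<forall>U. grassmannian_open rk \<pp> U \<longrightarrow> a \<in> U \<longrightarrow> (\<exists>b\<in>O\<^sub>1. b \<in> U)"
      and u: "u \<in> D\<^sub>0" and f: "f \<in> fun_algebra coords" "f u \<noteq> 0"
    show "\<exists>v\<in>D\<^sub>1. f v \<noteq> 0"
      unfolding assms(5)
      by (rule classes_more_general_if_orbits[OF assms(2,3) _ u[unfolded assms(4)] f]) (use O in blast)
  next
    fix a U
    assume D: "\<forall>u\<in>D\<^sub>0. \<forall>f\<in>fun_algebra coords. f u \<noteq> 0 \<longrightarrow> (\<exists>v\<in>D\<^sub>1. f v \<noteq> 0)"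
      and a: "a \<in> O\<^sub>0" and U: "grassmannian_open rk \<pp> U" "a \<in> U"
    show "\<exists>b\<in>O\<^sub>1. b \<in> U"
    proof (rule orbits_more_general_if_classes[OF assms(2) _ a U])
      fix u and f :: "'n cmat \<Rightarrow> complex"
      assume "u \<in> associated_class G \<theta> O\<^sub>0" "f \<in> fun_algebra coords" "f u \<noteq> 0"
      from D[unfolded assms(4,5), THEN bspec, OF this(1), THEN bspec, OF this(2), THEN mp, OF this(3)]
      show "\<exists>v\<in>associated_class G \<theta> O\<^sub>1. f v \<noteq> 0" .
    qed
  qed
qed

end
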